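(* If $r_\lambda$ is a real resonance point corresponding to $z=\lambda\pm i0$ (of a line $\{H_r=H_0+rV:r\in\mathbb R\}$ regular at an essentially regular point $\lambda$), then the absolute value of the signature of the resonance matrices $Q_{\lambda\mp i0}(r_\lambda)JP_{\lambda\pm i0}(r_\lambda)$ is less than or equal to the dimension of the vector space $\Upsilon^1_{\lambda+i0}(r_\lambda)$: $$\bigl|\operatorname{sign}Q_{\lambda\mp i0}(r_\lambda)JP_{\lambda\pm i0}(r_\lambda)\bigr|\le\dim\Upsilon^1_{\lambda+i0}(r_\lambda).$$
   Context: Setting. $\mathcal H,\mathcal K$ are complex separable Hilbert spaces. $F:\mathcal H\to\mathcal K$ is a closed densely defined operator with trivial kernel and co-kernel. $\{H_r=H_0+rV:r\in\mathbb R\}$ is a line of self-adjoint operators on $\mathcal H$, $V=F^*JF$ self-adjoint with $J$ bounded self-adjoint on $\mathcal K$. Standing assumptions: all $H_r$ have a common dense domain $\mathcal D$, $\mathcal D\subset\operatorname{dom}(F)\cap\operatorname{dom}(V)$, $V$ is relatively compact with respect to each $H_r$, and for non-real $z$ the operator $T_z(H_r):=F(H_r-z)^{-1}F^*$ (densely defined on $\operatorname{dom}F^*$) extends to a compact operator on $\mathcal K$, also denoted $T_z(H_r)$. $\Lambda(H_r,F)$ is the set of real $\lambda$ for which the norm limits $T_{\lambda\pm i0}(H_r):=\lim_{y\to0^+}T_{\lambda\pm iy}(H_r)$ exist (assumed of full Lebesgue measure). It is assumed that $\lambda\in\Lambda(H_r,F)$ for some real $r$ (that is, the line is regular at $\lambda$);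 a real $r$ is non-resonant if $\lambda\in\Lambda(H_r,F)$, otherwise it is a real resonance point. For $z=\lambda\pm i0$ and non-resonant $s$ put $A_z(s)=T_z(H_s)J$ and $B_z(s)=JT_z(H_s)$; as functions of $s$ they extend meromorphically to $\mathbb C$, their real poles being the real resonance points. For such a pole $r_\lambda$: $\Upsilon^1_z(r_\lambda)=\{u\in\mathcal K:(1+(r_\lambda-s)A_z(s))u=0\}$ (independent of the non-resonant real $s$); $P_z(r_\lambda)=\frac1{2\pi i}\oint_{C(r_\lambda)}A_z(s)\,ds$ and $Q_z(r_\lambda)=\frac1{2\pi i}\oint_{C(r_\lambda)}B_z(s)\,ds$, with $C(r_\lambda)$ a small counter-clockwise circle around $r_\lambda$ enclosing no other poles. These are finite-rank idempotents with $P_{\lambda\pm i0}(r_\lambda)^*=Q_{\lambda\mp i0}(r_\lambda)$, so $Q_{\lambda\mp i0}(r_\lambda)JP_{\lambda\pm i0}(r_\lambda)$ are finite-rank and self-adjoint. The signature of a finite-rank self-adjoint operator is the rank of its positive part minus the rank of its negative part. *)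

theory Defs
  imports "HOL-Complex_Analysis.Complex_Analysis"
begin

section \<open>Complex Hilbert spaces\<close>

class scaleC = fixes scaleC :: "complex \<Rightarrow> 'a \<Rightarrow> 'a" (infixr \<open>*\<^sub>C\<close> 75)

class complex_vector = real_vector + scaleC +
  assumes scaleC_add_right: "a *\<^sub>C (x + y) = a *\<^sub>C x + a *\<^sub>C y"
    and scaleC_add_left: "(a + b) *\<^sub>C x = a *\<^sub>C x + b *\<^sub>C x"
    and scaleC_scaleC: "a *\<^sub>C (b *\<^sub>C x) = (a * b) *\<^sub>C x"
    and scaleC_one: "1 *\<^sub>C x = x"
    and scaleR_scaleC: "r *\<^sub>R x = complex_of_real r *\<^sub>C x"

class complex_normed_vector = complex_vector + real_normed_vector +
  assumes norm_scaleC: "norm (a *\<^sub>C x) = cmod a * norm x"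

text \<open>The inner product is linear in its second argument.\<close>

class complex_inner = complex_normed_vector +
  fixes cinner :: "'a \<Rightarrow> 'a \<Rightarrow> complex"
  assumes cinner_commute: "cinner x y = cnj (cinner y x)"
    and cinner_add_right: "cinner x (y + z) = cinner x y + cinner x z"
    and cinner_scaleC_right: "cinner x (a *\<^sub>C y) = a * cinner x y"
    and cinner_self: "cinner x x = complex_of_real ((norm x)\<^sup>2)"

class chilbert_space = complex_inner + complete_space

instantiation complex :: chilbert_space
begin

definition "scaleC_complex a x = (a * x :: complex)"
definition "cinner_complex x y = (cnj x * y :: complex)"

instance
proof
  fix a b x y z :: complex and r :: real
  show "cinner x x = complex_of_real ((norm x)\<^sup>2)"
    using complex_norm_square[of x] by (simp add: cinner_complex_def mult.commute)
qed (simp_all add: scaleC_complex_def cinner_complex_def algebra_simps norm_mult scaleR_conv_of_real)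

end

global_interpretation complex_vector: vector_space "scaleC :: complex \<Rightarrow> 'a \<Rightarrow> 'a::complex_vector"
  defines cdim = complex_vector.dim
  by unfold_locales (simp_all add: scaleC_add_right scaleC_add_left scaleC_scaleC scaleC_one)

section \<open>Bounded complex-linear operators\<close>

lemma bounded_linear_scaleC: "bounded_linear (\<lambda>x. c *\<^sub>C (x :: 'a::complex_normed_vector))"
proof (rule bounded_linear_intro)
  show "c *\<^sub>C (r *\<^sub>R x) = r *\<^sub>R (c *\<^sub>C x)" for r and x :: 'a
    by (simp add: scaleR_scaleC scaleC_scaleC mult.commute)
  show "norm (c *\<^sub>C x) \<le> norm x * cmod c" for x :: 'a
    by (simp add: norm_scaleC mult.commute)
qed (rule scaleC_add_right)

lemma blinfun_apply_scaleC:
  fixes T :: "'a::real_normed_vector \<Rightarrow>\<^sub>L 'b::complex_normed_vector"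
  shows "blinfun_apply (Blinfun (\<lambda>x. c *\<^sub>C blinfun_apply T x)) = (\<lambda>x. c *\<^sub>C blinfun_apply T x)"
  by (rule bounded_linear_Blinfun_apply)
     (rule bounded_linear_compose[OF bounded_linear_scaleC blinfun.bounded_linear_right])

typedef (overloaded) ('a, 'b) cblinfun (\<open>(_ \<Rightarrow>\<^sub>C\<^sub>L /_)\<close> [22, 21] 21) =
  "{T :: 'a::complex_normed_vector \<Rightarrow>\<^sub>L 'b::complex_normed_vector.
     \<forall>c x. blinfun_apply T (c *\<^sub>C x) = c *\<^sub>C blinfun_apply T x}"
  by (rule exI[of _ 0]) (simp add: complex_vector.scale_zero_right)

setup_lifting type_definition_cblinfun

lift_definition cblinfun_apply ::
  "('a::complex_normed_vector \<Rightarrow>\<^sub>C\<^sub>L 'b::complex_normed_vector) \<Rightarrow> 'a \<Rightarrow> 'b"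
  is blinfun_apply .

declare [[coercion cblinfun_apply]]

instantiation cblinfun :: (complex_normed_vector, complex_normed_vector) complex_normed_vector
begin

lift_definition norm_cblinfun :: "('a \<Rightarrow>\<^sub>C\<^sub>L 'b) \<Rightarrow> real" is norm .

lift_definition zero_cblinfun :: "'a \<Rightarrow>\<^sub>C\<^sub>L 'b" is 0
  by (simp add: complex_vector.scale_zero_right)

lift_definition plus_cblinfun :: "('a \<Rightarrow>\<^sub>C\<^sub>L 'b) \<Rightarrow> ('a \<Rightarrow>\<^sub>C\<^sub>L 'b) \<Rightarrow> 'a \<Rightarrow>\<^sub>C\<^sub>L 'b" is "(+)"
  by (simp add: blinfun.add_left scaleC_add_right)

lift_definition minus_cblinfun :: "('a \<Rightarrow>\<^sub>C\<^sub>L 'b) \<Rightarrow> ('a \<Rightarrow>\<^sub>C\<^sub>L 'b) \<Rightarrow> 'a \<Rightarrow>\<^sub>C\<^sub>L 'b" is "(-)"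
  by (simp add: blinfun.diff_left complex_vector.scale_right_diff_distrib)

lift_definition uminus_cblinfun :: "('a \<Rightarrow>\<^sub>C\<^sub>L 'b) \<Rightarrow> 'a \<Rightarrow>\<^sub>C\<^sub>L 'b" is uminus
  by (simp add: blinfun.minus_left complex_vector.scale_minus_right)

lift_definition scaleR_cblinfun :: "real \<Rightarrow> ('a \<Rightarrow>\<^sub>C\<^sub>L 'b) \<Rightarrow> 'a \<Rightarrow>\<^sub>C\<^sub>L 'b" is scaleR
  by (simp add: blinfun.scaleR_left scaleR_scaleC scaleC_scaleC mult.commute)

lift_definition scaleC_cblinfun :: "complex \<Rightarrow> ('a \<Rightarrow>\<^sub>C\<^sub>L 'b) \<Rightarrow> 'a \<Rightarrow>\<^sub>C\<^sub>L 'b"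
  is "\<lambda>c T. Blinfun (\<lambda>x. c *\<^sub>C blinfun_apply T x)"
  by (simp add: blinfun_apply_scaleC scaleC_scaleC mult.commute)

definition "dist_cblinfun S T = norm (S - T :: 'a \<Rightarrow>\<^sub>C\<^sub>L 'b)"
definition "sgn_cblinfun T = scaleR (inverse (norm T)) (T :: 'a \<Rightarrow>\<^sub>C\<^sub>L 'b)"
definition "uniformity_cblinfun =
  (INF e\<in>{0<..}. principal {(S, T :: 'a \<Rightarrow>\<^sub>C\<^sub>L 'b). dist S T < e})"
definition "open_cblinfun U =
  (\<forall>S\<in>U. \<forall>\<^sub>F (S', T) in uniformity. S' = S \<longrightarrow> (T :: 'a \<Rightarrow>\<^sub>C\<^sub>L 'b) \<in> U)"

lemma cblinfun_apply_scaleC: "cblinfun_apply (c *\<^sub>C T) x = c *\<^sub>C cblinfun_apply T x"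
  by (simp add: cblinfun_apply.rep_eq scaleC_cblinfun.rep_eq blinfun_apply_scaleC)

lemma cblinfun_apply_add: "cblinfun_apply (S + T) x = cblinfun_apply S x + cblinfun_apply T x"
  by (simp add: cblinfun_apply.rep_eq plus_cblinfun.rep_eq blinfun.add_left)

lemma cblinfun_eqI: "(\<And>x. cblinfun_apply S x = cblinfun_apply T x) \<Longrightarrow> S = T"
  by (metis Rep_cblinfun_inject blinfun_eqI cblinfun_apply.rep_eq)

instance
proof
  fix a b :: complex and r s :: real and S T U :: "'a \<Rightarrow>\<^sub>C\<^sub>L 'b"
  show "S + T + U = S + (T + U)" "S + T = T + S" "0 + S = S" "- S + S = 0" "S - T = S + - T"
    by (transfer; simp)+
  show "r *\<^sub>R (S + T) = r *\<^sub>R S + r *\<^sub>R T" "(r + s) *\<^sub>R S = r *\<^sub>R S + s *\<^sub>R S"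
    "r *\<^sub>R s *\<^sub>R S = (r * s) *\<^sub>R S" "1 *\<^sub>R S = S"
    by (transfer; simp add: scaleR_right_distrib scaleR_left_distrib)+
  show "a *\<^sub>C (S + T) = a *\<^sub>C S + a *\<^sub>C T" "(a + b) *\<^sub>C S = a *\<^sub>C S + b *\<^sub>C S"
    "a *\<^sub>C b *\<^sub>C S = (a * b) *\<^sub>C S" "1 *\<^sub>C S = S"
    by (rule cblinfun_eqI, simp add: cblinfun_apply_scaleC cblinfun_apply_add scaleC_add_right
        scaleC_add_left scaleC_scaleC scaleC_one)+
  show "r *\<^sub>R S = complex_of_real r *\<^sub>C S"
    by (rule cblinfun_eqI, subst cblinfun_apply_scaleC, transfer)
       (simp add: blinfun.scaleR_left scaleR_scaleC)
  show "dist S T = norm (S - T)" by (rule dist_cblinfun_def)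
  show "sgn S = inverse (norm S) *\<^sub>R S" by (rule sgn_cblinfun_def)
  show "uniformity = (INF e\<in>{0<..}. principal {(S, T :: 'a \<Rightarrow>\<^sub>C\<^sub>L 'b). dist S T < e})"
    by (rule uniformity_cblinfun_def)
  show "open U = (\<forall>S\<in>U. \<forall>\<^sub>F (S', T) in uniformity. S' = S \<longrightarrow> T \<in> U)"
    for U :: "('a \<Rightarrow>\<^sub>C\<^sub>L 'b) set"
    by (rule open_cblinfun_def)
  show "norm S = 0 \<longleftrightarrow> S = 0" "norm (S + T) \<le> norm S + norm T" "norm (r *\<^sub>R S) = \<bar>r\<bar> * norm S"
    by (transfer; simp add: norm_triangle_ineq)+
  have le: "norm (c *\<^sub>C R) \<le> cmod c * norm R" for c and R :: "'a \<Rightarrow>\<^sub>C\<^sub>L 'b"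
  proof -
    have "norm (cblinfun_apply (c *\<^sub>C R) x) \<le> cmod c * norm R * norm x" for x
      unfolding cblinfun_apply_scaleC norm_scaleC mult.assoc
      by (rule mult_left_mono, transfer, rule norm_blinfun, simp)
    then show ?thesis
      by transfer (rule norm_blinfun_bound, simp_all)
  qed
  show "norm (a *\<^sub>C S) = cmod a * norm S"
  proof (cases "a = 0")
    case True
    moreover have "0 \<le> norm R" for R :: "'a \<Rightarrow>\<^sub>C\<^sub>L 'b" by transfer simp
    ultimately show ?thesis using le[of a S] by (simp add: antisym)
  next
    case False
    have "S = inverse a *\<^sub>C (a *\<^sub>C S)"
      by (rule cblinfun_eqI) (simp add: cblinfun_apply_scaleC scaleC_scaleC scaleC_one False)
    then have "norm S \<le> cmod (inverse a) * norm (a *\<^sub>C S)" by (metis le)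
    then have "cmod a * norm S \<le> norm (a *\<^sub>C S)"
      using False by (simp add: norm_divide field_simps)
    with le[of a S] show ?thesis by simp
  qed
qed

end

lift_definition id_cblinfun :: "'a::complex_normed_vector \<Rightarrow>\<^sub>C\<^sub>L 'a" is id_blinfun
  by simp

lift_definition cblinfun_compose ::
  "('b::complex_normed_vector \<Rightarrow>\<^sub>C\<^sub>L 'c::complex_normed_vector) \<Rightarrow> ('a::complex_normed_vector \<Rightarrow>\<^sub>C\<^sub>L 'b) \<Rightarrow> 'a \<Rightarrow>\<^sub>C\<^sub>L 'c"
  (infixl \<open>o\<^sub>C\<^sub>L\<close> 67) is blinfun_compose
  by simp

definition compact_op :: "('a::complex_normed_vector \<Rightarrow>\<^sub>C\<^sub>L 'b::complex_normed_vector) \<Rightarrow> bool" where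
  "compact_op T \<longleftrightarrow> compact (closure (cblinfun_apply T ` cball 0 1))"

definition selfadjoint_op :: "('a::complex_inner \<Rightarrow>\<^sub>C\<^sub>L 'a) \<Rightarrow> bool" where
  "selfadjoint_op T \<longleftrightarrow> (\<forall>x y. cinner (T x) y = cinner x (T y))"

definition positive_op :: "('a::complex_inner \<Rightarrow>\<^sub>C\<^sub>L 'a) \<Rightarrow> bool" where
  "positive_op T \<longleftrightarrow> (\<forall>x. Im (cinner x (T x)) = 0 \<and> 0 \<le> Re (cinner x (T x)))"

definition rank_op :: "('a::complex_normed_vector \<Rightarrow>\<^sub>C\<^sub>L 'b::complex_normed_vector) \<Rightarrow> nat" where
  "rank_op T = cdim (range (cblinfun_apply T))"

text \<open>A self-adjoint operator \<open>T\<close> is in a unique way the difference \<open>T\<^sub>+ - T\<^sub>-\<close> of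
  positive operators with \<open>T\<^sub>+ T\<^sub>- = 0\<close>.\<close>

definition positive_part :: "('a::complex_inner \<Rightarrow>\<^sub>C\<^sub>L 'a) \<Rightarrow> ('a \<Rightarrow>\<^sub>C\<^sub>L 'a)" where
  "positive_part T =
    (THE P. positive_op P \<and> positive_op (P - T) \<and> P o\<^sub>C\<^sub>L (P - T) = 0)"

definition negative_part :: "('a::complex_inner \<Rightarrow>\<^sub>C\<^sub>L 'a) \<Rightarrow> ('a \<Rightarrow>\<^sub>C\<^sub>L 'a)" where
  "negative_part T = positive_part T - T"

definition signature_op :: "('a::complex_inner \<Rightarrow>\<^sub>C\<^sub>L 'a) \<Rightarrow> int" where
  "signature_op T = int (rank_op (positive_part T)) - int (rank_op (negative_part T))"

section \<open>Unbounded operators\<close>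

text \<open>An unbounded operator is identified with its graph, a set of pairs; the domain of the
  operator is the \<^const>\<open>Domain\<close> of the graph. Sums, products and inverses have their natural
  (maximal) domains. Note that relational composition is diagrammatic: the operator product
  \<open>S T\<close> (first \<open>T\<close>, then \<open>S\<close>) has the graph \<open>T O S\<close>.\<close>

definition linear_operator :: "('a::complex_vector \<times> 'b::complex_vector) set \<Rightarrow> bool" where
  "linear_operator G \<longleftrightarrow> single_valued G \<and> (0, 0) \<in> G \<and>
    (\<forall>x y x' y'. (x, y) \<in> G \<longrightarrow> (x', y') \<in> G \<longrightarrow> (x + x', y + y') \<in> G) \<and>
    (\<forall>c x y. (x, y) \<in> G \<longrightarrow> (c *\<^sub>C x, c *\<^sub>C y) \<in> G)"

definition densely_defined :: "('a::topological_space \<times> 'b) set \<Rightarrow> bool" where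
  "densely_defined G \<longleftrightarrow> closure (Domain G) = UNIV"

definition op_adjoint :: "('a::complex_inner \<times> 'b::complex_inner) set \<Rightarrow> ('b \<times> 'a) set" where
  "op_adjoint G = {(y, x). \<forall>(u, v)\<in>G. cinner v y = cinner u x}"

definition selfadjoint :: "('a::complex_inner \<times> 'a) set \<Rightarrow> bool" where
  "selfadjoint G \<longleftrightarrow> linear_operator G \<and> densely_defined G \<and> op_adjoint G = G"

definition op_kernel :: "('a \<times> 'b::zero) set \<Rightarrow> 'a set" where
  "op_kernel G = {x. (x, 0) \<in> G}"

text \<open>In the Hilbert space sense: the orthogonal complement of the range.\<close>

definition op_cokernel :: "('a \<times> 'b::complex_inner) set \<Rightarrow> 'b set" where
  "op_cokernel G = {y. \<forall>v\<in>Range G. cinner v y = 0}"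

definition op_graph :: "('a::complex_normed_vector \<Rightarrow>\<^sub>C\<^sub>L 'b::complex_normed_vector) \<Rightarrow> ('a \<times> 'b) set" where
  "op_graph T = {(x, T x) | x. True}"

definition op_plus :: "('a \<times> 'b::plus) set \<Rightarrow> ('a \<times> 'b) set \<Rightarrow> ('a \<times> 'b) set" where
  "op_plus G K = {(x, y + z) | x y z. (x, y) \<in> G \<and> (x, z) \<in> K}"

definition op_scale :: "complex \<Rightarrow> ('a \<times> 'b::complex_vector) set \<Rightarrow> ('a \<times> 'b) set" where
  "op_scale c G = {(x, c *\<^sub>C y) | x y. (x, y) \<in> G}"

definition op_resolvent :: "('a::complex_normed_vector \<times> 'a) set \<Rightarrow> complex \<Rightarrow> ('a \<times> 'a) set" where
  "op_resolvent H z = (op_plus H (op_graph (- (z *\<^sub>C id_cblinfun))))\<inverse>"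

definition relatively_compact ::
    "('a::complex_normed_vector \<times> 'b::complex_normed_vector) set \<Rightarrow> ('a \<times> 'a) set \<Rightarrow> bool" where
  "relatively_compact V H \<longleftrightarrow> Domain H \<subseteq> Domain V \<and>
    (\<forall>z. Im z \<noteq> 0 \<longrightarrow> (\<exists>T. compact_op T \<and> op_resolvent H z O V = op_graph T))"

section \<open>Meromorphic functions with values in a complex normed space\<close>

definition vholomorphic_on :: "(complex \<Rightarrow> 'a::complex_normed_vector) \<Rightarrow> complex set \<Rightarrow> bool" where
  "vholomorphic_on g S \<longleftrightarrow> (\<forall>s\<in>S. \<exists>D. (g has_derivative (\<lambda>h. h *\<^sub>C D)) (at s within S))"

text \<open>Poles are of finite order. In infinite dimensions this is stronger than
  \<^term>\<open>is_pole\<close>: the norm may also tend to infinity at an essential singularity.\<close>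

definition vpole :: "(complex \<Rightarrow> 'a::complex_normed_vector) \<Rightarrow> complex \<Rightarrow> bool" where
  "vpole g a \<longleftrightarrow> (\<exists>n>0. \<exists>\<rho>>0. \<exists>h. vholomorphic_on h (ball a \<rho>) \<and> h a \<noteq> 0 \<and>
    (\<forall>s\<in>ball a \<rho> - {a}. (s - a) ^ n *\<^sub>C g s = h s))"

definition vmeromorphic :: "(complex \<Rightarrow> 'a::complex_normed_vector) \<Rightarrow> bool" where
  "vmeromorphic g \<longleftrightarrow> (\<forall>a. (\<exists>\<rho>>0. vholomorphic_on g (ball a \<rho>)) \<or> vpole g a)"

definition meromorphic_extension ::
    "real set \<Rightarrow> (real \<Rightarrow> 'a::complex_normed_vector) \<Rightarrow> complex \<Rightarrow> 'a" where
  "meromorphic_extension X f =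
    (SOME g. vmeromorphic g \<and> (\<forall>s\<in>X. g (complex_of_real s) = f s))"

definition vcontour_integral :: "(real \<Rightarrow> complex) \<Rightarrow> (complex \<Rightarrow> 'a::complex_normed_vector) \<Rightarrow> 'a" where
  "vcontour_integral \<gamma> g =
    integral {0..1} (\<lambda>t. vector_derivative \<gamma> (at t within {0..1}) *\<^sub>C g (\<gamma> t))"

definition small_radius :: "(complex \<Rightarrow> 'a::complex_normed_vector) \<Rightarrow> complex \<Rightarrow> real" where
  "small_radius g a = (SOME \<rho>. 0 < \<rho> \<and> (\<forall>s\<in>cball a \<rho> - {a}. \<not> vpole g s))"

definition vresidue :: "(complex \<Rightarrow> 'a::complex_normed_vector) \<Rightarrow> complex \<Rightarrow> 'a" where
  "vresidue g a =
    (1 / (2 * of_real pi * \<i>)) *\<^sub>C vcontour_integral (circlepath a (small_radius g a)) g"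

section \<open>Resonance points of a line of self-adjoint operators\<close>

text \<open>\<open>F (H - z)\<inverse> F\<^sup>*\<close> with its natural domain.\<close>

definition sandwiched_graph ::
    "('h::complex_inner \<times> 'k::complex_inner) set \<Rightarrow> ('h \<times> 'h) set \<Rightarrow> complex \<Rightarrow> ('k \<times> 'k) set" where
  "sandwiched_graph F H z = op_adjoint F O op_resolvent H z O F"

definition sandwiched ::
    "('h::complex_inner \<times> 'k::complex_inner) set \<Rightarrow> ('h \<times> 'h) set \<Rightarrow> complex \<Rightarrow> ('k \<Rightarrow>\<^sub>C\<^sub>L 'k)" where
  "sandwiched F H z = (THE T. sandwiched_graph F H z \<subseteq> op_graph T)"

text \<open>A boundary point \<open>lam \<plusminus> i0\<close> is given by the real number \<open>lam\<close> and a sign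
  \<open>\<sigma> \<in> {1, -1}\<close>.\<close>

definition sandwiched_bdry ::
    "('h::complex_inner \<times> 'k::complex_inner) set \<Rightarrow> ('h \<times> 'h) set \<Rightarrow> real \<Rightarrow> real \<Rightarrow> ('k \<Rightarrow>\<^sub>C\<^sub>L 'k)" where
  "sandwiched_bdry F H lam \<sigma> = Lim (at_right 0) (\<lambda>y. sandwiched F H (Complex lam (\<sigma> * y)))"

definition regular_points ::
    "('h::complex_inner \<times> 'k::complex_inner) set \<Rightarrow> ('h \<times> 'h) set \<Rightarrow> real set" where
  "regular_points F H = {lam. \<forall>\<sigma>\<in>{1, -1}. \<exists>L.
    ((\<lambda>y. sandwiched F H (Complex lam (\<sigma> * y))) \<longlongrightarrow> L) (at_right 0)}"

text \<open>In the remaining definitions \<open>H\<close> is the whole line \<open>r \<mapsto> H\<^sub>r\<close>.\<close>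

definition nonresonant ::
    "('h::complex_inner \<times> 'k::complex_inner) set \<Rightarrow> (real \<Rightarrow> ('h \<times> 'h) set) \<Rightarrow> real \<Rightarrow> real set" where
  "nonresonant F H lam = {r. lam \<in> regular_points F (H r)}"

definition A_op ::
    "('h::complex_inner \<times> 'k::complex_inner) set \<Rightarrow> ('k \<Rightarrow>\<^sub>C\<^sub>L 'k) \<Rightarrow> (real \<Rightarrow> ('h \<times> 'h) set) \<Rightarrow>
      real \<Rightarrow> real \<Rightarrow> real \<Rightarrow> ('k \<Rightarrow>\<^sub>C\<^sub>L 'k)" where
  "A_op F J H lam \<sigma> s = sandwiched_bdry F (H s) lam \<sigma> o\<^sub>C\<^sub>L J"

definition B_op ::
    "('h::complex_inner \<times> 'k::complex_inner) set \<Rightarrow> ('k \<Rightarrow>\<^sub>C\<^sub>L 'k) \<Rightarrow> (real \<Rightarrow> ('h \<times> 'h) set) \<Rightarrow>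
      real \<Rightarrow> real \<Rightarrow> real \<Rightarrow> ('k \<Rightarrow>\<^sub>C\<^sub>L 'k)" where
  "B_op F J H lam \<sigma> s = J o\<^sub>C\<^sub>L sandwiched_bdry F (H s) lam \<sigma>"

definition P_op ::
    "('h::complex_inner \<times> 'k::complex_inner) set \<Rightarrow> ('k \<Rightarrow>\<^sub>C\<^sub>L 'k) \<Rightarrow> (real \<Rightarrow> ('h \<times> 'h) set) \<Rightarrow>
      real \<Rightarrow> real \<Rightarrow> real \<Rightarrow> ('k \<Rightarrow>\<^sub>C\<^sub>L 'k)" where
  "P_op F J H lam \<sigma> r =
    vresidue (meromorphic_extension (nonresonant F H lam) (A_op F J H lam \<sigma>)) (complex_of_real r)"

definition Q_op ::
    "('h::complex_inner \<times> 'k::complex_inner) set \<Rightarrow> ('k \<Rightarrow>\<^sub>C\<^sub>L 'k) \<Rightarrow> (real \<Rightarrow> ('h \<times> 'h) set) \<Rightarrow>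
      real \<Rightarrow> real \<Rightarrow> real \<Rightarrow> ('k \<Rightarrow>\<^sub>C\<^sub>L 'k)" where
  "Q_op F J H lam \<sigma> r =
    vresidue (meromorphic_extension (nonresonant F H lam) (B_op F J H lam \<sigma>)) (complex_of_real r)"

text \<open>The space \<open>\<Upsilon>\<^sup>1\<close> at \<open>r\<close>, computed from the non-resonant point \<open>s\<close>.\<close>

definition Upsilon1 ::
    "('h::complex_inner \<times> 'k::complex_inner) set \<Rightarrow> ('k \<Rightarrow>\<^sub>C\<^sub>L 'k) \<Rightarrow> (real \<Rightarrow> ('h \<times> 'h) set) \<Rightarrow>
      real \<Rightarrow> real \<Rightarrow> real \<Rightarrow> real \<Rightarrow> 'k set" where
  "Upsilon1 F J H lam \<sigma> r s = {u. u + (r - s) *\<^sub>R A_op F J H lam \<sigma> s u = 0}"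

end

theory Submission
  imports Defs
begin

text \<open>
For a nonresonant \<open>s\<close> put \<open>T = T\<^sub>z(H\<^sub>s)\<close>, \<open>A = T J\<close>, \<open>c = r\<^sub>\<lambda> - s\<close> and \<open>M = 1 + c A\<close>. By the resolvent
identity \<open>A\<^sub>z(r) = A (1 + (r - s) A)\<^sup>-\<^sup>1\<close>, so \<open>P\<close> is the Riesz projection of \<open>M\<close> at the eigenvalue \<open>0\<close>,
\<open>M\<close> is nilpotent on \<open>E = ran P\<close> and \<open>\<Upsilon>\<^sup>1 = ker M \<subseteq> E\<close>; likewise \<open>Q = P\<^sup>*\<close>, so that \<open>Q J P\<close> represents the
form \<open>h(u, v) = \<langle>u, J v\<rangle>\<close> on \<open>E\<close>. Since \<open>Im T\<close> is semidefinite, \<open>M\<close> is dissipative for \<open>h\<close> up to sign.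
Let \<open>W \<subseteq> E\<close> be a maximal \<open>M\<close>-invariant \<open>h\<close>-isotropic subspace with \<open>T J = T\<^sup>* J\<close> on \<open>W\<close>. Dissipativity and
nilpotency give \<open>M W\<^sup>\<bottom> \<subseteq> W\<close>, where \<open>W\<^sup>\<bottom>\<close> is the \<open>h\<close>-complement in \<open>E\<close>, hence
\<open>dim W\<^sup>\<bottom> \<le> dim (ker M) + dim W\<close>. As \<open>W\<close> is isotropic, its image under \<open>Q J P\<close> has dimension at most the
number of positive, and at most the number of negative, eigenvalues of \<open>Q J P\<close>, and counting
dimensions yields the bound.
\<close>

section \<open>Inner products and bounded operators\<close>

text \<open>Three obstacles shape the proof. The form h is not known to be nondegenerate on E, so
  dimensions are counted with the image of W under \<open>Q J P\<close>; what \<open>Q J P\<close>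
  kills in W is absorbed by what it kills in E. The meromorphic extensions are arbitrary choices,
  tied to the operators only at real nonresonant points. Invertibility of
  \<open>1 + (r - s) A\<close> forces r to be nonresonant, so nonresonant points fill a punctured
  real neighbourhood of the resonance point, and the identity theorem then determines the residue.
  Finally, one space bounds the signature for either sign of z: \<open>1 + c T J\<close> and
  \<open>1 + c T' J\<close>, with T' the adjoint of T, have the same kernel, because Im T is
  semidefinite and a kernel vector u of either operator yields a vector J u on which T and T'
  agree.\<close>

type_synonym 'a endo = "'a \<Rightarrow>\<^sub>C\<^sub>L 'a"

lemma cinner_add_left: "cinner (x + y) z = cinner x z + cinner (y::'a::complex_inner) z"
  by (metis cinner_add_right cinner_commute complex_cnj_add)

lemma cinner_scaleC_left: "cinner (a *\<^sub>C x) y = cnj a * cinner (x::'a::complex_inner) y"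
  by (metis cinner_commute cinner_scaleC_right complex_cnj_mult)

lemma cinner_zero_right [simp]: "cinner (x::'a::complex_inner) 0 = 0"
  using cinner_add_right[of x 0 0] by simp

lemma cinner_zero_left [simp]: "cinner 0 (x::'a::complex_inner) = 0"
  using cinner_add_left[of 0 0 x] by simp

lemma cinner_minus_right: "cinner x (- y) = - cinner (x::'a::complex_inner) y"
  using cinner_add_right[of x y "- y"] by (simp add: eq_neg_iff_add_eq_0 add.commute)

lemma cinner_minus_left: "cinner (- x) y = - cinner (x::'a::complex_inner) y"
  using cinner_add_left[of x "- x" y] by (simp add: eq_neg_iff_add_eq_0 add.commute)

lemma cinner_diff_right: "cinner x (y - z) = cinner x y - cinner (x::'a::complex_inner) z"
  by (metis cinner_add_right cinner_minus_right diff_conv_add_uminus)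

lemma cinner_diff_left: "cinner (x - y) z = cinner x z - cinner (y::'a::complex_inner) z"
  by (metis cinner_add_left cinner_minus_left diff_conv_add_uminus)

lemmas cinner_simps = cinner_add_left cinner_add_right cinner_diff_left cinner_diff_right
  cinner_minus_left cinner_minus_right cinner_scaleC_left cinner_scaleC_right

lemma cinner_sum_right: "cinner (x::'a::complex_inner) (\<Sum>i\<in>I. f i) = (\<Sum>i\<in>I. cinner x (f i))"
  by (induction I rule: infinite_finite_induct) (simp_all add: cinner_add_right)

lemma cinner_eq_zero_iff [simp]: "cinner x x = 0 \<longleftrightarrow> (x::'a::complex_inner) = 0"
  by (simp add: cinner_self)

lemma Re_cinner_self: "Re (cinner x x) = (norm (x::'a::complex_inner))\<^sup>2"
  by (simp add: cinner_self)

lemma norm_add_square: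
  "(norm (x + y))\<^sup>2 = (norm x)\<^sup>2 + (norm y)\<^sup>2 + 2 * Re (cinner (x::'a::complex_inner) y)"
proof -
  have "Re (cinner y x) = Re (cinner x y)" by (subst cinner_commute) simp
  then show ?thesis
    by (simp flip: Re_cinner_self add: cinner_add_left cinner_add_right)
qed

lemma cinner_Cauchy_Schwarz: "cmod (cinner x y) \<le> norm x * norm (y::'a::complex_inner)"
proof (cases "x = 0")
  case False
  define c where "c = cinner x y / complex_of_real ((norm x)\<^sup>2)"
  have nx: "(norm x)\<^sup>2 \<noteq> 0" using False by simp
  have "cinner x (y - c *\<^sub>C x) = 0"
    using False by (simp add: cinner_diff_right cinner_scaleC_right cinner_self c_def)
  then have orth: "cinner (c *\<^sub>C x) (y - c *\<^sub>C x) = 0"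
    by (simp only: cinner_scaleC_left) simp
  have "(norm y)\<^sup>2 = (norm (c *\<^sub>C x))\<^sup>2 + (norm (y - c *\<^sub>C x))\<^sup>2"
    using norm_add_square[of "c *\<^sub>C x" "y - c *\<^sub>C x"] orth by simp
  then have "(norm (c *\<^sub>C x))\<^sup>2 \<le> (norm y)\<^sup>2" by simp
  then have "cmod c * norm x \<le> norm y" by (simp add: norm_scaleC)
  moreover have "cmod c = cmod (cinner x y) / (norm x)\<^sup>2"
    by (simp add: c_def norm_divide norm_power)
  ultimately show ?thesis using False
    by (simp add: power2_eq_square divide_simps mult.commute split: if_splits)
qed simp

lemma bounded_bilinear_cinner: "bounded_bilinear (cinner :: 'a::complex_inner \<Rightarrow> 'a \<Rightarrow> complex)"
proof
  show "\<exists>K. \<forall>a b::'a. cmod (cinner a b) \<le> norm a * norm b * K"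
    using cinner_Cauchy_Schwarz by (metis mult.right_neutral)
qed (simp_all add: cinner_simps scaleR_scaleC, simp_all add: scaleC_complex_def)

lemmas tendsto_cinner = bounded_bilinear.tendsto[OF bounded_bilinear_cinner]

lemma cinner_extI: "(\<And>x. cinner x y = cinner x z) \<Longrightarrow> y = (z::'a::complex_inner)"
  by (metis cinner_diff_right cinner_eq_zero_iff right_minus_eq)

lemma cblinfun_eq_iff: "S = T \<longleftrightarrow> (\<forall>x. cblinfun_apply S x = cblinfun_apply T x)"
  using cblinfun_eqI by blast

lemma cblinfun_apply_zero [simp]: "cblinfun_apply 0 x = 0"
  by (simp add: cblinfun_apply.rep_eq zero_cblinfun.rep_eq)

lemma cblinfun_apply_minus: "cblinfun_apply (- S) x = - cblinfun_apply S x"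
  by (simp add: cblinfun_apply.rep_eq uminus_cblinfun.rep_eq blinfun.minus_left)

lemma cblinfun_apply_diff: "cblinfun_apply (S - T) x = cblinfun_apply S x - cblinfun_apply T x"
  by (simp add: cblinfun_apply.rep_eq minus_cblinfun.rep_eq blinfun.diff_left)

lemma cblinfun_apply_id [simp]: "cblinfun_apply id_cblinfun x = x"
  by (simp add: cblinfun_apply.rep_eq id_cblinfun.rep_eq)

lemma cblinfun_apply_compose [simp]: "cblinfun_apply (S o\<^sub>C\<^sub>L T) x = S (T x)"
  by (simp add: cblinfun_apply.rep_eq cblinfun_compose.rep_eq)

lemma cblinfun_add_right: "cblinfun_apply S (x + y) = cblinfun_apply S x + cblinfun_apply S y"
  by (simp add: cblinfun_apply.rep_eq blinfun.add_right)

lemma cblinfun_diff_right: "cblinfun_apply S (x - y) = cblinfun_apply S x - cblinfun_apply S y"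
  by (simp add: cblinfun_apply.rep_eq blinfun.diff_right)

lemma cblinfun_minus_right: "cblinfun_apply S (- x) = - cblinfun_apply S x"
  by (simp add: cblinfun_apply.rep_eq blinfun.minus_right)

lemma cblinfun_scaleC_right: "cblinfun_apply S (c *\<^sub>C x) = c *\<^sub>C cblinfun_apply S x"
  by transfer simp

lemma cblinfun_zero_right [simp]: "cblinfun_apply S 0 = 0"
  by (simp add: cblinfun_apply.rep_eq blinfun.zero_right)

lemmas cblinfun_simps = cblinfun_apply_add cblinfun_apply_minus cblinfun_apply_diff
  cblinfun_apply_scaleC cblinfun_add_right cblinfun_diff_right cblinfun_minus_right
  cblinfun_scaleC_right

lemma cblinfun_sum_left: "cblinfun_apply (\<Sum>i\<in>I. f i) x = (\<Sum>i\<in>I. cblinfun_apply (f i) x)"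
  by (induction I rule: infinite_finite_induct) (simp_all add: cblinfun_apply_add)

lemma cblinfun_sum_right: "cblinfun_apply S (\<Sum>i\<in>I. f i) = (\<Sum>i\<in>I. cblinfun_apply S (f i))"
  by (induction I rule: infinite_finite_induct) (simp_all add: cblinfun_add_right)

lemma norm_cblinfun: "norm (cblinfun_apply S x) \<le> norm S * norm x"
  by transfer (rule norm_blinfun)

lemma norm_cblinfun_bound:
  "0 \<le> b \<Longrightarrow> (\<And>x. norm (cblinfun_apply S x) \<le> b * norm x) \<Longrightarrow> norm S \<le> b"
  by transfer (rule norm_blinfun_bound)

lemma bounded_bilinear_cblinfun_apply:
  "bounded_bilinear (cblinfun_apply :: ('a::complex_normed_vector \<Rightarrow>\<^sub>C\<^sub>L 'b::complex_normed_vector) \<Rightarrow> _)"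
proof
  show "\<exists>K. \<forall>(a :: 'a \<Rightarrow>\<^sub>C\<^sub>L 'b) b. norm (cblinfun_apply a b) \<le> norm a * norm b * K"
    by (rule exI[of _ 1]) (simp add: norm_cblinfun)
qed (simp_all add: cblinfun_simps scaleR_scaleC)

lemma bounded_bilinear_cblinfun_compose:
  "bounded_bilinear (cblinfun_compose ::
    ('b::complex_normed_vector \<Rightarrow>\<^sub>C\<^sub>L 'c::complex_normed_vector) \<Rightarrow> ('a::complex_normed_vector \<Rightarrow>\<^sub>C\<^sub>L 'b) \<Rightarrow> _)"
proof
  show "\<exists>K. \<forall>(a :: 'b \<Rightarrow>\<^sub>C\<^sub>L 'c) (b :: 'a \<Rightarrow>\<^sub>C\<^sub>L 'b). norm (a o\<^sub>C\<^sub>L b) \<le> norm a * norm b * K"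
    by (rule exI[of _ 1]) (transfer, simp add: norm_blinfun_compose)
qed (simp_all add: cblinfun_eq_iff cblinfun_simps scaleR_scaleC)

lemma bounded_bilinear_scaleC:
  "bounded_bilinear (scaleC :: complex \<Rightarrow> 'a::complex_normed_vector \<Rightarrow> 'a)"
proof
  show "\<exists>K. \<forall>a (b::'a). norm (a *\<^sub>C b) \<le> norm a * norm b * K"
    by (rule exI[of _ 1]) (simp add: norm_scaleC)
  show "(r *\<^sub>R a) *\<^sub>C b = r *\<^sub>R (a *\<^sub>C b)" for r a and b :: 'a
    by (simp add: scaleR_conv_of_real scaleR_scaleC[of r "a *\<^sub>C b"] scaleC_scaleC)
  show "a *\<^sub>C (r *\<^sub>R b) = r *\<^sub>R (a *\<^sub>C b)" for r a and b :: 'a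
    by (simp add: scaleR_scaleC scaleC_scaleC mult.commute)
qed (simp_all add: scaleC_add_left scaleC_add_right)

lemmas tendsto_cblinfun_apply = bounded_bilinear.tendsto[OF bounded_bilinear_cblinfun_apply]
lemmas tendsto_cblinfun_compose = bounded_bilinear.tendsto[OF bounded_bilinear_cblinfun_compose]
lemmas tendsto_scaleC = bounded_bilinear.tendsto[OF bounded_bilinear_scaleC]
lemmas bounded_linear_cblinfun_apply =
  bounded_bilinear.bounded_linear_right[OF bounded_bilinear_cblinfun_apply]

lemma bounded_linear_matrix_coefficient:
  "bounded_linear (\<lambda>T. cinner x (cblinfun_apply T y))"
  by (rule bounded_linear_compose[OF bounded_bilinear.bounded_linear_right[OF bounded_bilinear_cinner]
      bounded_bilinear.bounded_linear_left[OF bounded_bilinear_cblinfun_apply]])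

lemma norm_cblinfun_compose: "norm (S o\<^sub>C\<^sub>L T) \<le> norm S * norm T"
  by transfer (rule norm_blinfun_compose)

lemma cblinfun_compose_id [simp]: "id_cblinfun o\<^sub>C\<^sub>L S = S"
  by (simp add: cblinfun_eq_iff)

lemma cblinfun_compose_zero [simp]: "0 o\<^sub>C\<^sub>L S = 0" "S o\<^sub>C\<^sub>L 0 = 0"
  by (simp_all add: cblinfun_eq_iff)

lemma cblinfun_of_function:
  fixes f :: "'a::complex_normed_vector \<Rightarrow> 'b::complex_normed_vector"
  assumes "\<And>x y. f (x + y) = f x + f y" "\<And>c x. f (c *\<^sub>C x) = c *\<^sub>C f x"
    and "\<And>x. norm (f x) \<le> norm x * K"
  obtains T :: "'a \<Rightarrow>\<^sub>C\<^sub>L 'b" where "cblinfun_apply T = f"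
proof -
  have bl: "bounded_linear f"
    by (rule bounded_linear_intro[where K = K]) (use assms in \<open>auto simp: scaleR_scaleC\<close>)
  have "cblinfun_apply (Abs_cblinfun (Blinfun f)) = f"
    unfolding cblinfun_apply.rep_eq
    by (subst Abs_cblinfun_inverse)
       (simp_all add: bounded_linear_Blinfun_apply[OF bl] assms(2))
  then show ?thesis by (rule that)
qed

section \<open>Completeness of the space of bounded operators\<close>

instance chilbert_space \<subseteq> banach ..

text \<open>Completeness makes continuous operator-valued integrands integrable, hence the contour
  integral in \<open>vresidue\<close> a genuine integral. The limit exists among real-linear
  operators, and complex linearity passes to it pointwise.\<close>

instance cblinfun :: (complex_normed_vector, chilbert_space) banach
proof
  fix X :: "nat \<Rightarrow> 'a \<Rightarrow>\<^sub>C\<^sub>L 'b"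
  assume C: "Cauchy X"
  have dist_eq: "dist (Rep_cblinfun S) (Rep_cblinfun T) = dist S T" for S T :: "'a \<Rightarrow>\<^sub>C\<^sub>L 'b"
    by (simp add: dist_norm norm_cblinfun.rep_eq minus_cblinfun.rep_eq)
  have "Cauchy (\<lambda>n. Rep_cblinfun (X n))"
    using C unfolding Cauchy_def dist_eq .
  then obtain L where L: "(\<lambda>n. Rep_cblinfun (X n)) \<longlonglongrightarrow> L"
    by (metis Cauchy_convergent convergent_def)
  have "blinfun_apply L (c *\<^sub>C x) = c *\<^sub>C blinfun_apply L x" for c x
  proof (rule LIMSEQ_unique)
    show "(\<lambda>n. blinfun_apply (Rep_cblinfun (X n)) (c *\<^sub>C x)) \<longlonglongrightarrow> blinfun_apply L (c *\<^sub>C x)"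
      by (intro blinfun.tendsto L tendsto_const)
    have "(\<lambda>n. c *\<^sub>C blinfun_apply (Rep_cblinfun (X n)) x) \<longlonglongrightarrow> c *\<^sub>C blinfun_apply L x"
      by (intro tendsto_scaleC blinfun.tendsto L tendsto_const)
    then show "(\<lambda>n. blinfun_apply (Rep_cblinfun (X n)) (c *\<^sub>C x)) \<longlonglongrightarrow> c *\<^sub>C blinfun_apply L x"
      by (simp add: Rep_cblinfun[simplified])
  qed
  then have "Rep_cblinfun (Abs_cblinfun L) = L" by (simp add: Abs_cblinfun_inverse)
  then have "X \<longlonglongrightarrow> Abs_cblinfun L"
    using L by (simp add: tendsto_iff flip: dist_eq)
  then show "convergent X" by (auto simp: convergent_def)
qed

section \<open>Orthogonal projections\<close>

abbreviation csubspace :: "'a::complex_vector set \<Rightarrow> bool" where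
  "csubspace \<equiv> complex_vector.subspace"

abbreviation cspan :: "'a::complex_vector set \<Rightarrow> 'a set" where
  "cspan \<equiv> complex_vector.span"

abbreviation cindependent :: "'a::complex_vector set \<Rightarrow> bool" where
  "cindependent \<equiv> complex_vector.independent"

lemma csubspaceD:
  assumes "csubspace Z"
  shows "0 \<in> Z" "x \<in> Z \<Longrightarrow> y \<in> Z \<Longrightarrow> x + y \<in> Z" "x \<in> Z \<Longrightarrow> y \<in> Z \<Longrightarrow> x - y \<in> Z"
    "x \<in> Z \<Longrightarrow> c *\<^sub>C x \<in> Z"
  using assms by (auto intro: complex_vector.subspace_0 complex_vector.subspace_add
      complex_vector.subspace_diff complex_vector.subspace_scale)

text \<open>The c that makes \<open>w + c z\<close> orthogonal to z shortens w by the length of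
  \<open>c z\<close> (Pythagoras), so minimality forces c = 0.\<close>

lemma minimal_norm_orthogonal:
  fixes w z :: "'a::complex_inner"
  assumes min: "\<And>c. norm w \<le> norm (w + c *\<^sub>C z)"
  shows "cinner z w = 0"
proof (cases "z = 0")
  case False
  define c where "c = - (cinner z w / complex_of_real ((norm z)\<^sup>2))"
  have orth: "cinner (w + c *\<^sub>C z) ((- c) *\<^sub>C z) = 0"
  proof -
    have "cinner (w + c *\<^sub>C z) z = 0"
      using False cinner_commute[of w z]
      by (simp add: cinner_simps cinner_self c_def)
    then show ?thesis by (simp only: cinner_scaleC_right) simp
  qed
  have "(norm w)\<^sup>2 = (norm (w + c *\<^sub>C z))\<^sup>2 + (norm ((- c) *\<^sub>C z))\<^sup>2"
    using norm_add_square[of "w + c *\<^sub>C z" "(- c) *\<^sub>C z"] orth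
    by (simp add: complex_vector.scale_minus_left)
  moreover have "(norm w)\<^sup>2 \<le> (norm (w + c *\<^sub>C z))\<^sup>2"
    using min[of c] by (simp add: power_mono)
  ultimately have "(norm ((- c) *\<^sub>C z))\<^sup>2 \<le> 0" by linarith
  then have "c = 0" using False by (simp add: norm_scaleC)
  then show ?thesis using False by (simp add: c_def)
qed simp

text \<open>A sequence in Z whose distances to x tend to the infimum is Cauchy by the parallelogram
  law; its limit is a nearest point, and minimality gives orthogonality.\<close>

theorem orthogonal_decomposition:
  fixes Z :: "'a::chilbert_space set"
  assumes sub: "csubspace Z" and cl: "closed Z"
  obtains y where "y \<in> Z" "\<And>z. z \<in> Z \<Longrightarrow> cinner z (x - y) = 0"
proof -
  define d where "d = infdist x Z"
  have ne: "Z \<noteq> {}" using csubspaceD(1)[OF sub] by auto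
  have d_le: "d \<le> norm (x - z)" if "z \<in> Z" for z
    using infdist_le[OF that, of x] by (simp add: d_def dist_norm)
  have d0: "d \<ge> 0" by (simp add: d_def infdist_nonneg)
  have "\<exists>z\<in>Z. norm (x - z) < d + inverse (Suc n)" for n
  proof (rule ccontr)
    assume "\<not> ?thesis"
    then have "d + inverse (Suc n) \<le> infdist x Z"
      unfolding infdist_notempty[OF ne] by (intro cINF_greatest ne) (auto simp: dist_norm not_less)
    then show False by (simp add: d_def del: of_nat_Suc)
  qed
  then obtain Y where Y: "\<And>n. Y n \<in> Z" "\<And>n. norm (x - Y n) < d + inverse (Suc n)" by metis
  \<comment> \<open>Parallelogram law for \<open>x - Y m\<close> and \<open>x - Y n\<close>; half
    their sum is x minus the midpoint, which lies in Z and so is at distance at least d.\<close>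
  have para: "(norm (Y m - Y n))\<^sup>2 \<le> 2 * (norm (x - Y m))\<^sup>2 + 2 * (norm (x - Y n))\<^sup>2 - 4 * d\<^sup>2" for m n
  proof -
    define mid where "mid = (1/2) *\<^sub>C (Y m + Y n)"
    have "mid \<in> Z" unfolding mid_def using Y csubspaceD[OF sub] by blast
    then have "d\<^sup>2 \<le> (norm (x - mid))\<^sup>2" using d_le d0 by (simp add: power_mono)
    moreover have "(x - Y m) + (x - Y n) = 2 *\<^sub>C (x - mid)"
    proof -
      have "2 *\<^sub>C x = x + x" using scaleC_add_left[of 1 1 x] by (simp add: scaleC_one)
      then show ?thesis
        by (simp add: mid_def complex_vector.scale_right_diff_distrib scaleC_scaleC scaleC_one)
    qed
    then have "(norm ((x - Y m) + (x - Y n)))\<^sup>2 = 4 * (norm (x - mid))\<^sup>2"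
      by (simp add: norm_scaleC power_mult_distrib)
    moreover have "(norm ((x - Y m) + (x - Y n)))\<^sup>2 + (norm (Y m - Y n))\<^sup>2
        = 2 * (norm (x - Y m))\<^sup>2 + 2 * (norm (x - Y n))\<^sup>2"
      using norm_add_square[of "x - Y m" "x - Y n"] norm_add_square[of "x - Y n" "- (x - Y m)"]
        cinner_commute[of "x - Y n" "x - Y m"] cinner_minus_right[of "x - Y n" "x - Y m"]
      by (simp add: norm_minus_commute)
    ultimately show ?thesis by linarith
  qed
  have lim: "(\<lambda>n. norm (x - Y n)) \<longlonglongrightarrow> d"
  proof (rule tendsto_sandwich[OF _ _ tendsto_const])
    show "(\<lambda>n. d + inverse (real (Suc n))) \<longlonglongrightarrow> d"
      using tendsto_add[OF tendsto_const LIMSEQ_inverse_real_of_nat, of d] by simp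
  qed (use Y d_le in \<open>auto intro!: always_eventually less_imp_le\<close>)
  have "Cauchy Y"
  proof (rule metric_CauchyI)
    fix e :: real assume "e > 0"
    have "(\<lambda>n. (norm (x - Y n))\<^sup>2) \<longlonglongrightarrow> d\<^sup>2" by (intro tendsto_intros lim)
    then have "\<forall>\<^sub>F n in sequentially. (norm (x - Y n))\<^sup>2 < d\<^sup>2 + e\<^sup>2 / 4"
      using \<open>e > 0\<close> by (intro order_tendstoD(2)) auto
    then obtain N where N: "\<And>n. n \<ge> N \<Longrightarrow> (norm (x - Y n))\<^sup>2 < d\<^sup>2 + e\<^sup>2 / 4"
      by (auto simp: eventually_sequentially)
    have "dist (Y m) (Y n) < e" if "m \<ge> N" "n \<ge> N" for m n
    proof -
      have "(norm (Y m - Y n))\<^sup>2 < e\<^sup>2" using para[of m n] N[OF that(1)] N[OF that(2)] by linarith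
      then show ?thesis using \<open>e > 0\<close> by (simp add: dist_norm power_less_imp_less_base)
    qed
    then show "\<exists>M. \<forall>m\<ge>M. \<forall>n\<ge>M. dist (Y m) (Y n) < e" by blast
  qed
  then obtain y where y: "Y \<longlonglongrightarrow> y" using Cauchy_convergent convergent_def by blast
  have yZ: "y \<in> Z" using closed_sequentially[OF cl _ y] Y by blast
  have "(\<lambda>n. norm (x - Y n)) \<longlonglongrightarrow> norm (x - y)" by (intro tendsto_intros y)
  then have ny: "norm (x - y) = d" using lim LIMSEQ_unique by blast
  have "cinner z (x - y) = 0" if "z \<in> Z" for z
  proof (rule minimal_norm_orthogonal)
    fix c
    have "y - c *\<^sub>C z \<in> Z" using yZ that csubspaceD[OF sub] by blast
    from d_le[OF this] show "norm (x - y) \<le> norm (x - y + c *\<^sub>C z)"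
      by (simp add: ny algebra_simps)
  qed
  with yZ show ?thesis by (rule that)
qed

text \<open>The orthogonal sum, in which the graph of a closed operator is a closed subspace; its
  orthogonal complement is the graph of the adjoint up to a swap and a sign.\<close>

instantiation prod :: (complex_inner, complex_inner) complex_inner
begin

definition scaleC_prod :: "complex \<Rightarrow> 'a \<times> 'b \<Rightarrow> 'a \<times> 'b" where
  "scaleC_prod c p = (c *\<^sub>C fst p, c *\<^sub>C snd p)"

definition cinner_prod :: "'a \<times> 'b \<Rightarrow> 'a \<times> 'b \<Rightarrow> complex" where
  "cinner_prod p q = cinner (fst p) (fst q) + cinner (snd p) (snd q)"

instance
proof
  fix a b :: complex and x y z :: "'a \<times> 'b" and r :: real
  show "norm (a *\<^sub>C x) = cmod a * norm x"
    by (simp add: scaleC_prod_def norm_prod_def norm_scaleC power_mult_distrib real_sqrt_mult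
        flip: distrib_left)
  show "cinner x y = cnj (cinner y x)"
    by (simp add: cinner_prod_def flip: cinner_commute)
  show "cinner x x = complex_of_real ((norm x)\<^sup>2)"
    by (simp add: cinner_prod_def cinner_self norm_prod_def)
qed (simp_all add: scaleC_prod_def cinner_prod_def scaleC_add_left scaleC_add_right scaleC_scaleC
      scaleC_one cinner_simps scaleR_prod_def scaleR_scaleC prod_eq_iff algebra_simps)

end

instance prod :: (chilbert_space, chilbert_space) chilbert_space ..

lemma dense_if_no_orthogonal_vector:
  fixes Z :: "'a::chilbert_space set"
  assumes sub: "csubspace Z" and orth: "\<And>y. (\<And>z. z \<in> Z \<Longrightarrow> cinner z y = 0) \<Longrightarrow> y = 0"
  shows "closure Z = UNIV"
proof -
  have "csubspace (closure Z)"
  proof (rule complex_vector.subspaceI)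
    show "0 \<in> closure Z" using csubspaceD(1)[OF sub] closure_subset by blast
    show "x + y \<in> closure Z" if "x \<in> closure Z" "y \<in> closure Z" for x y
      using that unfolding closure_sequential
      by (metis (no_types, lifting) csubspaceD(2)[OF sub] tendsto_add)
    show "c *\<^sub>C x \<in> closure Z" if "x \<in> closure Z" for x c
      using that unfolding closure_sequential
      by (metis (no_types, lifting) csubspaceD(4)[OF sub] tendsto_scaleC tendsto_const)
  qed
  moreover have "x \<in> closure Z" if *: "csubspace (closure Z)" for x
  proof -
    obtain y where y: "y \<in> closure Z" "\<And>z. z \<in> closure Z \<Longrightarrow> cinner z (x - y) = 0"
      using orthogonal_decomposition[OF * closed_closure] by blast
    have "x - y = 0" using y(2) closure_subset by (intro orth) blast
    then show ?thesis using y(1) by simp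
  qed
  ultimately show ?thesis by blast
qed

section \<open>Finite-dimensional subspaces\<close>

abbreviation ran :: "('a::complex_normed_vector \<Rightarrow>\<^sub>C\<^sub>L 'b::complex_normed_vector) \<Rightarrow> 'b set" where
  "ran S \<equiv> range (cblinfun_apply S)"

abbreviation clinear :: "('a::complex_vector \<Rightarrow> 'b::complex_vector) \<Rightarrow> bool" where
  "clinear \<equiv> Vector_Spaces.linear (*\<^sub>C) (*\<^sub>C)"

lemma clinearI:
  assumes "\<And>x y. f (x + y) = f x + f y" "\<And>c x. f (c *\<^sub>C x) = c *\<^sub>C f x"
  shows "clinear f"
  unfolding Vector_Spaces.linear_iff using assms by (simp add: complex_vector.vector_space_axioms)

lemma clinear_cblinfun: "clinear (cblinfun_apply S)"
  by (rule clinearI) (simp_all add: cblinfun_simps)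

text \<open>\<open>cdim\<close> is 0 on infinite-dimensional sets, so comparisons of dimensions
  carry this as a hypothesis. The spanning set may lie outside V, which makes passage to subsets
  immediate.\<close>

definition finite_dim :: "'a::complex_vector set \<Rightarrow> bool" where
  "finite_dim V \<longleftrightarrow> (\<exists>B. finite B \<and> V \<subseteq> cspan B)"

lemma finite_dim_basis:
  assumes "finite_dim V"
  obtains B where "B \<subseteq> V" "cindependent B" "finite B"
    "V \<subseteq> cspan B" "card B = cdim V"
proof -
  obtain B where B: "B \<subseteq> V" "cindependent B" "V \<subseteq> cspan B"
    "card B = cdim V"
    using complex_vector.basis_exists by blast
  with assms have "finite B"
    unfolding finite_dim_def by (meson complex_vector.independent_span_bound order_trans)
  with B show ?thesis by (rule_tac that)
qed

lemma finite_dim_subset: "finite_dim W \<Longrightarrow> V \<subseteq> W \<Longrightarrow> finite_dim V"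
  unfolding finite_dim_def by blast

lemma cdim_mono:
  assumes "finite_dim W" "V \<subseteq> W"
  shows "cdim V \<le> cdim W"
  by (metis assms complex_vector.dim_le_card finite_dim_basis order_trans)

lemma card_le_cdim:
  assumes "finite_dim W" "B \<subseteq> W" "cindependent B"
  shows "finite B \<and> card B \<le> cdim W"
  by (metis assms complex_vector.independent_span_bound finite_dim_basis order_trans)

lemma finite_dim_image:
  assumes "finite_dim V" "clinear f"
  shows "finite_dim (f ` V)"
proof -
  interpret f: Vector_Spaces.linear "(*\<^sub>C)" "(*\<^sub>C)" f by fact
  show ?thesis using assms(1) unfolding finite_dim_def
    by (metis (no_types) f.span_image finite_imageI image_mono)
qed

lemma in_cspan_finite_iff:
  assumes "finite B"
  shows "x \<in> cspan B \<longleftrightarrow> (\<exists>u. x = (\<Sum>b\<in>B. u b *\<^sub>C b))"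
  using complex_vector.span_finite[OF assms] by auto

theorem rank_nullity:
  assumes sub: "csubspace U" and fin: "finite_dim U" and lin: "clinear f"
  shows "cdim U = cdim {u\<in>U. f u = 0} + cdim (f ` U)"
proof -
  interpret f: Vector_Spaces.linear "(*\<^sub>C)" "(*\<^sub>C)" f by fact
  define K where "K = {u\<in>U. f u = 0}"
  have K: "csubspace K"
    using sub unfolding K_def
    by (auto intro!: complex_vector.subspaceI simp: csubspaceD f.add f.scale)
  have "finite_dim K" using fin by (rule finite_dim_subset) (auto simp: K_def)
  then obtain BK where BK: "BK \<subseteq> K" "cindependent BK" "finite BK"
    "K \<subseteq> cspan BK" "card BK = cdim K"
    by (rule finite_dim_basis)
  have "BK \<subseteq> U" using BK(1) by (auto simp: K_def)
  then obtain B where B: "BK \<subseteq> B" "B \<subseteq> U" "cindependent B" "U \<subseteq> cspan B"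
    using complex_vector.maximal_independent_subset_extend[OF _ BK(2)] by metis
  have finB: "finite B" and cardB: "card B = cdim U"
    using card_le_cdim[OF fin B(2,3)] complex_vector.basis_card_eq_dim[OF B(2,4,3)] by auto
  define C where "C = B - BK"
  have finC: "finite C" using finB by (simp add: C_def)
  \<comment> \<open>A vector spanned by C and killed by f is also spanned by BK; the difference of
    its two expansions is a linear relation on the independent set B.\<close>
  have "x = 0" if x: "x \<in> cspan C" "f x = 0" for x
  proof -
    have "x \<in> U" using x(1) B(2) sub complex_vector.span_minimal[of C U] by (auto simp: C_def)
    then have "x \<in> cspan BK" using x(2) BK(4) by (auto simp: K_def)
    then obtain v where v: "x = (\<Sum>b\<in>BK. v b *\<^sub>C b)" using in_cspan_finite_iff[OF BK(3)] by blast
    obtain u where u: "x = (\<Sum>b\<in>C. u b *\<^sub>C b)" using x(1) in_cspan_finite_iff[OF finC] by blast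
    define w where "w b = (if b \<in> C then u b else - v b)" for b
    have "(\<Sum>b\<in>B. w b *\<^sub>C b) = (\<Sum>b\<in>C. w b *\<^sub>C b) + (\<Sum>b\<in>BK. w b *\<^sub>C b)"
      unfolding C_def using B(1) finB by (rule sum.subset_diff)
    also have "(\<Sum>b\<in>C. w b *\<^sub>C b) = x" unfolding u by (intro sum.cong) (auto simp: w_def)
    also have "(\<Sum>b\<in>BK. w b *\<^sub>C b) = - x" unfolding v sum_negf[symmetric]
      by (intro sum.cong) (auto simp: w_def C_def)
    finally have "(\<Sum>b\<in>B. w b *\<^sub>C b) = 0" by simp
    then have "w b = 0" if "b \<in> B" for b
      using complex_vector.independentD[OF B(3) finB subset_refl] that by blast
    then have "u b = 0" if "b \<in> C" for b using that by (metis C_def DiffD1 w_def)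
    then show ?thesis using u by simp
  qed
  then have inj: "inj_on f (cspan C)"
    using f.inj_on_iff_eq_0[OF complex_vector.subspace_span] by blast
  have "cindependent C"
    using complex_vector.independent_mono[OF B(3), of C] by (auto simp: C_def)
  then have indep: "cindependent (f ` C)"
    using inj by (rule f.independent_inj_on_image)
  have "f x \<in> cspan (f ` C)" if "x \<in> U" for x
  proof -
    have "f x \<in> f ` cspan B" using that B(4) by blast
    also have "\<dots> = cspan (f ` B)" by (rule f.span_image[symmetric])
    also have "f ` B \<subseteq> insert 0 (f ` C)" using BK(1) by (auto simp: C_def K_def)
    then have "cspan (f ` B) \<subseteq> cspan (f ` C)"
      by (metis complex_vector.span_insert_0 complex_vector.span_mono)
    finally show ?thesis .
  qed
  then have "card (f ` C) = cdim (f ` U)"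
    using indep B(2) by (intro complex_vector.basis_card_eq_dim) (auto simp: C_def)
  moreover have "card (f ` C) = card C"
    using inj complex_vector.span_superset inj_on_subset by (intro card_image) blast
  moreover have "card B = card C + card BK"
    using finB B(1) by (simp add: C_def card_Diff_subset finite_subset card_mono)
  ultimately show ?thesis using cardB BK(5) by (simp add: K_def)
qed

text \<open>With a basis b of Y, the map sending u to the sum of \<open><b, u> b\<close> has rank at
  most dim Y. By independence, whatever it kills is orthogonal to every b, hence to Y. Rank-nullity
  on E concludes.\<close>

lemma cdim_le_orthogonal:
  fixes E Y :: "'a::complex_inner set"
  assumes sub: "csubspace E" and fin: "finite_dim E" "finite_dim Y"
  shows "cdim E \<le> cdim {u\<in>E. \<forall>y\<in>Y. cinner y u = 0} + cdim Y"
proof -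
  obtain B where B: "B \<subseteq> Y" "cindependent B" "finite B"
    "Y \<subseteq> cspan B" "card B = cdim Y"
    using fin(2) by (rule finite_dim_basis)
  define f where "f u = (\<Sum>b\<in>B. cinner b u *\<^sub>C b)" for u
  have lin: "clinear f"
    by (rule clinearI)
       (simp_all add: f_def cinner_simps scaleC_add_left sum.distrib complex_vector.scale_sum_right
         scaleC_scaleC)
  have "cinner y u = 0" if u: "f u = 0" and y: "y \<in> Y" for u y
  proof -
    have "cinner b u = 0" if "b \<in> B" for b
      using complex_vector.independentD[OF B(2,3) subset_refl, of "\<lambda>b. cinner b u"] that u
      unfolding f_def by blast
    moreover obtain c where "y = (\<Sum>b\<in>B. c b *\<^sub>C b)"
      using y B(4) in_cspan_finite_iff[OF B(3)] by blast
    ultimately have "cinner u y = 0"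
      by (simp add: cinner_sum_right cinner_scaleC_right cinner_commute[of u])
    then show ?thesis by (subst cinner_commute) simp
  qed
  then have "cdim {u\<in>E. f u = 0} \<le> cdim {u\<in>E. \<forall>y\<in>Y. cinner y u = 0}"
    by (intro cdim_mono finite_dim_subset[OF fin(1)]) auto
  moreover have "f u \<in> cspan B" for u
    unfolding in_cspan_finite_iff[OF B(3)] f_def by (rule exI[of _ "\<lambda>b. cinner b u"]) simp
  then have "cdim (f ` E) \<le> card B"
    using B(3) by (intro complex_vector.dim_le_card) auto
  ultimately show ?thesis
    using rank_nullity[OF sub fin(1) lin] B(5) by linarith
qed

text \<open>Take a nonzero polynomial p of least degree with p(f) v = 0; \<open>ev p\<close> stands
  for p(f) v. Splitting off a root a leaves q of smaller degree, so q(f) v is nonzero, and f acts on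
  it as multiplication by a.\<close>

lemma eigenvector_exists:
  fixes f :: "'a::complex_vector \<Rightarrow> 'a"
  assumes fin: "finite_dim R" and lin: "clinear f" and inv: "\<And>x. x \<in> R \<Longrightarrow> f x \<in> R"
    and v: "v \<in> R" "v \<noteq> 0" and sub: "csubspace R"
  obtains \<mu> w where "w \<in> R" "w \<noteq> 0" "f w = \<mu> *\<^sub>C w"
proof -
  interpret f: Vector_Spaces.linear "(*\<^sub>C)" "(*\<^sub>C)" f by fact
  define e where "e k = (f ^^ k) v" for k
  have eR: "e k \<in> R" for k by (induction k) (use v inv in \<open>simp_all add: e_def\<close>)
  define ev where "ev p = (\<Sum>k\<le>degree p. coeff p k *\<^sub>C e k)" for p
  have ev_eq: "ev p = (\<Sum>k\<le>N. coeff p k *\<^sub>C e k)" if "degree p \<le> N" for p N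
    unfolding ev_def using that
    by (intro sum.mono_neutral_left) (auto simp: coeff_eq_0)
  have evR: "ev p \<in> R" for p
    unfolding ev_def using eR sub
    by (intro complex_vector.subspace_sum) (auto intro: csubspaceD)
  \<comment> \<open>Either two of the first d + 1 iterates of v coincide, and a difference of
    monomials works, or they are d + 1 distinct vectors in a space of dimension d, and a linear
    relation among them supplies the coefficients.\<close>
  have "\<exists>p. p \<noteq> 0 \<and> ev p = 0"
  proof -
    define d where "d = cdim R"
    show ?thesis
    proof (cases "inj_on e {..d}")
      case False
      then obtain i j where ij: "i \<noteq> j" "e i = e j" by (auto simp: inj_on_def)
      define p where "p = monom 1 i - monom (1::complex) j"
      have "ev p = (\<Sum>k\<le>max i j. coeff p k *\<^sub>C e k)"
        by (rule ev_eq) (auto simp: p_def intro!: degree_diff_le order_trans[OF degree_monom_le])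
      also have "\<dots> = (\<Sum>k\<le>max i j. coeff (monom 1 i) k *\<^sub>C e k) - (\<Sum>k\<le>max i j. coeff (monom 1 j) k *\<^sub>C e k)"
        by (simp add: p_def complex_vector.scale_left_diff_distrib sum_subtractf)
      also have "\<dots> = e i - e j"
        by (simp add: if_distrib[of "\<lambda>c. c *\<^sub>C _"] scaleC_one cong: if_cong)
      finally have "ev p = 0" using ij by simp
      moreover have "coeff p i \<noteq> 0" using ij by (simp add: p_def)
      ultimately show ?thesis by (metis coeff_0)
    next
      case True
      define S where "S = e ` {..d}"
      have "card S = Suc d" using True by (simp add: S_def card_image)
      then have "complex_vector.dependent S"
        using card_le_cdim[OF fin, of S] eR by (auto simp: S_def d_def)
      then obtain u b where u: "(\<Sum>x\<in>S. u x *\<^sub>C x) = 0" "b \<in> S" "u b \<noteq> 0"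
        using complex_vector.dependent_finite[of S] by (auto simp: S_def)
      define p where "p = Poly (map (\<lambda>k. u (e k)) [0..<Suc d])"
      have co: "coeff p k = (if k \<le> d then u (e k) else 0)" for k
        by (simp add: p_def nth_default_def less_Suc_eq_le del: upt_Suc)
      have "degree p \<le> d" by (rule degree_le) (simp add: co)
      then have "ev p = (\<Sum>k\<le>d. u (e k) *\<^sub>C e k)" by (simp add: ev_eq co)
      also have "\<dots> = (\<Sum>x\<in>S. u x *\<^sub>C x)" unfolding S_def using True by (simp add: sum.reindex)
      finally have "ev p = 0" using u by simp
      moreover obtain k where "k \<le> d" "b = e k" using u(2) by (auto simp: S_def)
      then have "coeff p k \<noteq> 0" using u(3) co by simp
      ultimately show ?thesis by (metis coeff_0)
    qed
  qed
  then obtain p where p: "p \<noteq> 0" "ev p = 0"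
    and min: "\<And>q. q \<noteq> 0 \<Longrightarrow> ev q = 0 \<Longrightarrow> degree p \<le> degree q"
    using ex_has_least_nat[of "\<lambda>p. p \<noteq> 0 \<and> ev p = 0" _ degree] by metis
  have "degree p \<noteq> 0"
  proof
    assume "degree p = 0"
    then have "coeff p 0 *\<^sub>C v = 0" using p(2) by (simp add: ev_def e_def)
    then show False using p(1) v(2) \<open>degree p = 0\<close> leading_coeff_0_iff by fastforce
  qed
  then have "\<exists>i\<in>{1..degree p}. coeff p i \<noteq> 0"
    using p(1) by (intro bexI[of _ "degree p"]) auto
  then obtain a where "poly p a = 0"
    using fundamental_theorem_of_algebra[of "coeff p" "degree p"] unfolding poly_altdef by blast
  then obtain q where q: "p = [:- a, 1:] * q" by (auto simp: poly_eq_0_iff_dvd elim: dvdE)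
  have q0: "q \<noteq> 0" using p(1) q by auto
  have dp: "degree p = Suc (degree q)"
    unfolding q using q0 by (subst degree_mult_eq) auto
  have "ev q \<noteq> 0" using min[OF q0] dp by auto
  have co: "coeff p k = (case k of 0 \<Rightarrow> 0 | Suc j \<Rightarrow> coeff q j) - a * coeff q k" for k
    by (simp add: q coeff_pCons split: nat.split)
  have "(\<Sum>k\<le>Suc (degree q). (case k of 0 \<Rightarrow> 0 | Suc j \<Rightarrow> coeff q j) *\<^sub>C e k) = f (ev q)"
    by (subst sum.atMost_Suc_shift) (simp add: ev_def f.sum f.scale e_def)
  moreover have "(\<Sum>k\<le>Suc (degree q). (a * coeff q k) *\<^sub>C e k) = a *\<^sub>C ev q"
    by (subst ev_eq[of q "Suc (degree q)"])
       (simp_all add: complex_vector.scale_sum_right scaleC_scaleC scaleC_add_right del: sum.atMost_Suc)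
  moreover have "ev p = (\<Sum>k\<le>Suc (degree q). (case k of 0 \<Rightarrow> 0 | Suc j \<Rightarrow> coeff q j) *\<^sub>C e k) -
      (\<Sum>k\<le>Suc (degree q). (a * coeff q k) *\<^sub>C e k)"
    by (subst ev_eq[of p "Suc (degree q)"])
       (simp_all add: dp co complex_vector.scale_left_diff_distrib sum_subtractf del: sum.atMost_Suc)
  ultimately have "f (ev q) = a *\<^sub>C ev q" using p(2) by simp
  with evR \<open>ev q \<noteq> 0\<close> show ?thesis by (rule that)
qed

section \<open>Finite-rank self-adjoint operators\<close>

lemma selfadjoint_opD: "selfadjoint_op T \<Longrightarrow> cinner (T x) y = cinner x (T y)"
  by (simp add: selfadjoint_op_def)

text \<open>Polarization: the defect d is sesquilinear and vanishes on the diagonal. Evaluating it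
  at \<open>x + y\<close> and at \<open>x + i y\<close> shows that \<open>d x y\<close> is both
  minus and plus \<open>d y x\<close>.\<close>

lemma selfadjoint_if_real_form:
  fixes T :: "'a::complex_inner endo"
  assumes "\<And>x. Im (cinner x (T x)) = 0"
  shows "selfadjoint_op T"
proof -
  define d where "d x y = cinner (T x) y - cinner x (T y)" for x y
  have d0: "d x x = 0" for x
    using assms[of x] cinner_commute[of "T x" x] by (simp add: d_def complex_eq_iff)
  have add: "d (x + y) (x + y) = d x x + d x y + d y x + d y y" for x y
    by (simp add: d_def cinner_simps cblinfun_simps)
  have sc: "d x (\<i> *\<^sub>C y) = \<i> * d x y" "d (\<i> *\<^sub>C y) x = - \<i> * d y x" for x y
    by (simp_all add: d_def cinner_simps cblinfun_simps algebra_simps)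
  have "d x y = 0" for x y
  proof -
    have 1: "d x y + d y x = 0" using add[of x y] d0 by simp
    have "\<i> * (d x y - d y x) = 0" using add[of x "\<i> *\<^sub>C y"] d0 by (simp add: sc algebra_simps)
    then have "d x y = d y x" by simp
    with 1 show ?thesis by simp
  qed
  then show ?thesis by (simp add: selfadjoint_op_def d_def)
qed

text \<open>Along \<open>x + t y\<close> with y = S x the nonnegative form is a quadratic in real t
  without constant term, so its linear coefficient, twice the squared norm of y, must
  vanish.\<close>

lemma positive_op_null:
  fixes S :: "'a::complex_inner endo"
  assumes pos: "positive_op S" and x: "Re (cinner x (S x)) = 0"
  shows "S x = 0"
proof -
  have sa: "selfadjoint_op S"
    using pos by (intro selfadjoint_if_real_form) (simp add: positive_op_def)
  define y where "y = S x"
  have quad: "0 \<le> 2 * t * (norm y)\<^sup>2 + t\<^sup>2 * Re (cinner y (S y))" for t :: real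
  proof -
    define c where "c = complex_of_real t"
    have "0 \<le> Re (cinner (x + c *\<^sub>C y) (S (x + c *\<^sub>C y)))"
      using pos by (simp add: positive_op_def)
    also have "cinner (x + c *\<^sub>C y) (S (x + c *\<^sub>C y))
      = cinner x (S x) + c * cinner x (S y) + cnj c * cinner y (S x) + cnj c * c * cinner y (S y)"
      by (simp add: cinner_simps cblinfun_simps algebra_simps)
    also have "cinner x (S y) = cinner y y" using selfadjoint_opD[OF sa, of x y] by (simp add: y_def)
    also have "cinner y (S x) = cinner y y" by (simp add: y_def)
    finally show ?thesis using x
      by (simp add: c_def cinner_self power2_eq_square algebra_simps)
  qed
  define k where "k = Re (cinner y (S y))"
  have k0: "k \<ge> 0" using pos by (simp add: positive_op_def k_def)
  have "norm y = 0"
  proof (rule ccontr)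
    assume "norm y \<noteq> 0"
    then have n: "(norm y)\<^sup>2 > 0" by simp
    \<comment> \<open>Close to the minimizer of the quadratic; k + 1 instead of k also covers k =
      0.\<close>
    define t where "t = - (norm y)\<^sup>2 / (k + 1)"
    have t: "t < 0" using n k0 by (simp add: t_def divide_neg_pos)
    have "2 * (norm y)\<^sup>2 + t * k = ((2 * (k + 1) - k) * (norm y)\<^sup>2) / (k + 1)"
      using k0 by (simp add: t_def field_simps)
    also have "\<dots> > 0" using n k0 by simp
    finally have "t * (2 * (norm y)\<^sup>2 + t * k) < 0" using t by (simp add: mult_neg_pos)
    then show False using quad[of t] by (simp add: k_def power2_eq_square algebra_simps)
  qed
  then show ?thesis by (simp add: y_def)
qed

section \<open>Spectral decomposition in finite rank, and the signature as a count of
  eigenvalues\<close>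

definition orthonormal :: "'a::complex_inner set \<Rightarrow> bool" where
  "orthonormal B \<longleftrightarrow> (\<forall>a\<in>B. \<forall>b\<in>B. cinner a b = (if a = b then 1 else 0))"

lemma orthonormal_sum:
  assumes "orthonormal B" "finite B" "C \<subseteq> B" "b \<in> B"
  shows "cinner b (\<Sum>c\<in>C. u c *\<^sub>C c) = (if b \<in> C then u b else 0)"
proof -
  have "cinner b (\<Sum>c\<in>C. u c *\<^sub>C c) = (\<Sum>c\<in>C. if c = b then u b else 0)"
    using assms(1,3,4) unfolding cinner_sum_right orthonormal_def
    by (intro sum.cong) (auto simp: cinner_scaleC_right)
  then show ?thesis using finite_subset[OF assms(3,2)] by simp
qed

lemma orthonormal_subset: "orthonormal B \<Longrightarrow> C \<subseteq> B \<Longrightarrow> orthonormal C"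
  unfolding orthonormal_def by blast

lemma orthonormal_independent:
  assumes "orthonormal B" "finite B"
  shows "cindependent B"
proof (rule complex_vector.independent_if_scalars_zero[OF assms(2)])
  fix u b assume "(\<Sum>x\<in>B. u x *\<^sub>C x) = 0" "b \<in> B"
  then show "u b = 0" using orthonormal_sum[OF assms subset_refl, of b u] by simp
qed

text \<open>Only nonzero eigenvalues are listed, with multiplicity, so B is a basis of the range and
  its cardinality is the rank.\<close>

locale diagonalized =
  fixes G :: "'a::complex_inner endo" and B :: "'a set" and l :: "'a \<Rightarrow> real"
  assumes finite_B: "finite B" and orthonormal_B: "orthonormal B" and l_nonzero: "b \<in> B \<Longrightarrow> l b \<noteq> 0"
    and G_eq: "G x = (\<Sum>b\<in>B. (complex_of_real (l b) * cinner b x) *\<^sub>C b)"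
begin

lemma G_basis: "b \<in> B \<Longrightarrow> G b = complex_of_real (l b) *\<^sub>C b"
proof -
  assume b: "b \<in> B"
  have "G b = (\<Sum>c\<in>B. if c = b then complex_of_real (l b) *\<^sub>C b else 0)"
    unfolding G_eq using orthonormal_B b
    by (intro sum.cong) (auto simp: orthonormal_def)
  then show ?thesis using finite_B b by simp
qed

lemma cinner_G: "cinner x (G x) = complex_of_real (\<Sum>b\<in>B. l b * (cmod (cinner b x))\<^sup>2)"
proof -
  have "cinner x (G x) = (\<Sum>b\<in>B. complex_of_real (l b) * (cinner b x * cinner x b))"
    by (simp add: G_eq cinner_sum_right cinner_scaleC_right mult.assoc)
  also have "\<dots> = complex_of_real (\<Sum>b\<in>B. l b * (cmod (cinner b x))\<^sup>2)"
    unfolding of_real_sum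
    by (intro sum.cong refl) (simp only: cinner_commute[of x] of_real_mult complex_norm_square)
  finally show ?thesis .
qed

lemma selfadjoint: "selfadjoint_op G"
  by (rule selfadjoint_if_real_form) (simp add: cinner_G)

lemma cinner_basis_G: "b \<in> B \<Longrightarrow> cinner b (G x) = complex_of_real (l b) * cinner b x"
  using selfadjoint_opD[OF selfadjoint, of b x] by (simp add: G_basis cinner_scaleC_left)

lemma positive: "(\<And>b. b \<in> B \<Longrightarrow> l b > 0) \<Longrightarrow> positive_op G"
  by (simp add: positive_op_def cinner_G sum_nonneg less_imp_le)

lemma range_eq: "range G = cspan B"
proof (intro equalityI subsetI)
  fix y assume "y \<in> range G"
  then show "y \<in> cspan B"
    by (auto simp: G_eq intro!: complex_vector.span_sum complex_vector.span_scale
        intro: complex_vector.span_base)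
next
  fix y assume "y \<in> cspan B"
  then obtain u where "y = (\<Sum>b\<in>B. u b *\<^sub>C b)" using in_cspan_finite_iff[OF finite_B] by blast
  also have "\<dots> = G (\<Sum>b\<in>B. (u b / l b) *\<^sub>C b)"
    unfolding cblinfun_sum_right
    by (intro sum.cong) (simp_all add: cblinfun_simps G_basis scaleC_scaleC l_nonzero)
  finally show "y \<in> range G" by blast
qed

lemma rank_eq: "cdim (range G) = card B"
  unfolding range_eq
  by (intro complex_vector.dim_span_eq_card_independent orthonormal_independent orthonormal_B finite_B)

lemma restrict:
  assumes "C \<subseteq> B"
  obtains P :: "'a endo" where "diagonalized P C l"
proof -
  define f where "f x = (\<Sum>b\<in>C. (complex_of_real (l b) * cinner b x) *\<^sub>C b)" for x
  have "norm (f x) \<le> norm x * (\<Sum>b\<in>C. \<bar>l b\<bar> * norm b * norm b)" for x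
    unfolding f_def sum_distrib_left
  proof (rule sum_norm_le)
    fix b assume "b \<in> C"
    have "\<bar>l b\<bar> * cmod (cinner b x) * norm b \<le> \<bar>l b\<bar> * (norm b * norm x) * norm b"
      by (intro mult_right_mono mult_left_mono cinner_Cauchy_Schwarz) auto
    then show "norm ((complex_of_real (l b) * cinner b x) *\<^sub>C b) \<le> norm x * (\<bar>l b\<bar> * norm b * norm b)"
      by (simp add: norm_scaleC norm_mult algebra_simps)
  qed
  moreover have "f (x + y) = f x + f y" "f (c *\<^sub>C x) = c *\<^sub>C f x" for x y c
    by (simp_all add: f_def cinner_simps distrib_left scaleC_add_left sum.distrib
        complex_vector.scale_sum_right scaleC_scaleC mult.left_commute)
  ultimately obtain P :: "'a endo" where "cblinfun_apply P = f"
    using cblinfun_of_function[of f] by blast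
  then have "diagonalized P C l"
    using assms finite_B orthonormal_B l_nonzero
    by unfold_locales (auto simp: f_def intro: finite_subset orthonormal_subset)
  then show ?thesis by (rule that)
qed

text \<open>\<open>positive_part\<close> is a definite description, so any candidate P must be
  identified. P commutes with G, and its action on an eigenvector e of G with eigenvalue k is
  forced. For k > 0 the vector N e, where N = P - G, satisfies N (N e) = - k N e, which positivity
  of N allows only if N e = 0. For k at most 0 the squared norm of P e equals
  \<open>k <e, P e>\<close>, which is not positive.\<close>

lemma positive_part_unique:
  assumes P: "positive_op P" "positive_op (P - G)" "P o\<^sub>C\<^sub>L (P - G) = 0"
  shows "P x = (\<Sum>b\<in>{b\<in>B. l b > 0}. (complex_of_real (l b) * cinner b x) *\<^sub>C b)"
proof -
  have Psa: "selfadjoint_op P"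
    using P(1) by (intro selfadjoint_if_real_form) (simp add: positive_op_def)
  have PP: "P (P y) = P (G y)" for y
    using P(3) by (simp add: cblinfun_eq_iff cblinfun_simps)
  \<comment> \<open>P G equals P P, which is self-adjoint, so it coincides with its adjoint G
    P.\<close>
  have comm: "P (G y) = G (P y)" for y
  proof (rule cinner_extI)
    fix x
    show "cinner x (P (G y)) = cinner x (G (P y))"
      by (metis PP Psa selfadjoint selfadjoint_opD)
  qed
  have eig: "P e = (if k > 0 then complex_of_real k *\<^sub>C e else 0)" if e: "G e = complex_of_real k *\<^sub>C e" for e k
  proof (cases "k > 0")
    case True
    define N where "N = P - G"
    have "N (P e) = 0" by (simp add: N_def cblinfun_simps PP comm)
    then have "N (N e) = - (complex_of_real k *\<^sub>C N e)" by (simp add: N_def cblinfun_simps e)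
    then have "Re (cinner (N e) (N (N e))) = - k * (norm (N e))\<^sup>2"
      by (simp add: cinner_simps cinner_self)
    moreover have "0 \<le> Re (cinner (N e) (N (N e)))" using P(2) by (simp add: positive_op_def N_def)
    ultimately have "k * (norm (N e))\<^sup>2 \<le> 0" by linarith
    then have "N e = 0" using True by (simp add: mult_le_0_iff)
    then show ?thesis using True by (simp add: N_def cblinfun_simps e)
  next
    case False
    have "cinner (P e) (P e) = complex_of_real k * cinner e (P e)"
      using selfadjoint_opD[OF Psa, of e "P e"] by (simp add: PP e cblinfun_simps cinner_simps)
    from arg_cong[OF this, of Re] have "(norm (P e))\<^sup>2 = k * Re (cinner e (P e))"
      by (simp add: Re_cinner_self)
    also have "\<dots> \<le> 0"
      using False P(1) by (simp add: positive_op_def mult_le_0_iff)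
    finally have "P e = 0" by simp
    then show ?thesis using False by simp
  qed
  \<comment> \<open>The component of x orthogonal to B lies in the kernel of G, so it falls under
    the eigenvalue k = 0, where P vanishes.\<close>
  define x0 where "x0 = x - (\<Sum>b\<in>B. cinner b x *\<^sub>C b)"
  have "G x0 = 0"
    unfolding x0_def cblinfun_diff_right cblinfun_sum_right
    by (simp add: G_eq[of x] cblinfun_simps G_basis scaleC_scaleC mult.commute)
  then have "P x0 = 0" using eig[of x0 0] by simp
  then have "P x = (\<Sum>b\<in>B. cinner b x *\<^sub>C P b)"
    by (simp add: x0_def cblinfun_diff_right cblinfun_sum_right cblinfun_simps)
  also have "\<dots> = (\<Sum>b\<in>B. if l b > 0 then (complex_of_real (l b) * cinner b x) *\<^sub>C b else 0)"
    by (intro sum.cong refl) (simp add: eig[OF G_basis] scaleC_scaleC mult.commute)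
  also have "\<dots> = (\<Sum>b\<in>{b\<in>B. l b > 0}. (complex_of_real (l b) * cinner b x) *\<^sub>C b)"
    using finite_B by (simp add: sum.inter_filter)
  finally show ?thesis .
qed

theorem signature_eq:
  "signature_op G = int (card {b\<in>B. l b > 0}) - int (card {b\<in>B. l b < 0})"
proof -
  obtain P where P: "diagonalized P {b\<in>B. l b > 0} l" by (rule restrict[of "{b\<in>B. l b > 0}"]) auto
  obtain N where N: "diagonalized N {b\<in>B. l b < 0} l" by (rule restrict[of "{b\<in>B. l b < 0}"]) auto
  have G: "G x = P x + N x" for x
  proof -
    have "{b\<in>B. l b > 0} \<union> {b\<in>B. l b < 0} = B" using l_nonzero by (auto simp: neq_iff)
    then have "G x = (\<Sum>b\<in>{b\<in>B. l b > 0} \<union> {b\<in>B. l b < 0}. (complex_of_real (l b) * cinner b x) *\<^sub>C b)"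
      by (simp only: G_eq[of x])
    then show ?thesis
      using finite_B
      by (subst (asm) sum.union_disjoint) (auto simp: diagonalized.G_eq[OF P] diagonalized.G_eq[OF N])
  qed
  have PG: "P - G = - N" by (simp add: cblinfun_eq_iff cblinfun_simps G)
  have "positive_op P" using diagonalized.positive[OF P] by simp
  moreover have "positive_op (P - G)"
    by (auto simp: PG positive_op_def cblinfun_simps cinner_minus_right diagonalized.cinner_G[OF N]
        mult_le_0_iff intro!: sum_nonpos)
  moreover have "P (N x) = 0" for x
  proof -
    have "cinner b (N x) = 0" if "b \<in> {b\<in>B. l b > 0}" for b
    proof -
      have "cinner b (N x) = (\<Sum>c\<in>{b\<in>B. l b < 0}. complex_of_real (l c) * cinner c x * cinner b c)"
        by (simp add: diagonalized.G_eq[OF N] cinner_sum_right cinner_scaleC_right)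
      also have "\<dots> = 0"
        using that orthonormal_B by (intro sum.neutral) (auto simp: orthonormal_def)
      finally show ?thesis .
    qed
    then show ?thesis unfolding diagonalized.G_eq[OF P] by (intro sum.neutral) simp
  qed
  then have "P o\<^sub>C\<^sub>L (P - G) = 0" by (simp add: PG cblinfun_eq_iff cblinfun_simps)
  ultimately have "positive_part G = P"
    unfolding positive_part_def
  proof (intro the_equality conjI)
    fix P' assume "positive_op P' \<and> positive_op (P' - G) \<and> P' o\<^sub>C\<^sub>L (P' - G) = 0"
    then show "P' = P"
      by (intro cblinfun_eqI) (simp add: positive_part_unique diagonalized.G_eq[OF P])
  qed
  moreover from this have "range (negative_part G) = range N"
  proof -
    have "negative_part G = - N" using PG \<open>positive_part G = P\<close> by (simp add: negative_part_def)
    then have neg: "negative_part G x = N (- x)" for x by (simp add: cblinfun_simps)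
    have "N x \<in> range (negative_part G)" for x using neg[of "- x"] by (metis minus_minus rangeI)
    then show ?thesis unfolding neg by auto
  qed
  ultimately show ?thesis
    by (simp add: signature_op_def rank_op_def diagonalized.rank_eq[OF P] diagonalized.rank_eq[OF N])
qed

end

text \<open>Take an orthonormal set B of eigenvectors with nonzero eigenvalues of maximal size; rank
  bounds the size. Subtracting its spectral sum from G leaves a self-adjoint f. If f were nonzero,
  an eigenvector in its range, which is orthogonal to B, would enlarge B.\<close>

lemma diagonalization_exists:
  fixes G :: "'a::complex_inner endo"
  assumes sa: "selfadjoint_op G" and fin: "finite_dim (range G)"
  obtains B l where "diagonalized G B l"
proof -
  define eig where "eig B l \<longleftrightarrow> finite B \<and> orthonormal B \<and> (\<forall>b\<in>B. l b \<noteq> 0 \<and> G b = complex_of_real (l b) *\<^sub>C b)"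
    for B and l :: "'a \<Rightarrow> real"
  have bound: "card B \<le> cdim (range G)" if "eig B l" for B l
  proof -
    have "b \<in> range G" if "b \<in> B" for b
    proof -
      have "b = G ((1 / l b) *\<^sub>C b)"
        using \<open>eig B l\<close> that by (simp add: eig_def cblinfun_simps scaleC_scaleC scaleC_one)
      then show ?thesis by blast
    qed
    then show ?thesis
      using that card_le_cdim[OF fin, of B] orthonormal_independent by (auto simp: eig_def)
  qed
  have "eig {} (\<lambda>_. 0)" by (simp add: eig_def orthonormal_def)
  define ex where "ex n \<longleftrightarrow> (\<exists>B l. eig B l \<and> card B = n)" for n
  define n where "n = (GREATEST n. ex n)"
  have ex0: "ex 0" using \<open>eig {} (\<lambda>_. 0)\<close> unfolding ex_def by (metis card.empty)
  have ex_le: "k \<le> cdim (range G)" if "ex k" for k using that bound unfolding ex_def by blast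
  have "ex n" unfolding n_def by (rule GreatestI_nat[of ex, OF ex0 ex_le])
  then obtain B l where B: "eig B l" "card B = n" unfolding ex_def by blast
  have on: "orthonormal B" and finB: "finite B" using B by (auto simp: eig_def)
  define f where "f x = G x - (\<Sum>b\<in>B. (complex_of_real (l b) * cinner b x) *\<^sub>C b)" for x
  have lin: "clinear f"
    by (rule clinearI)
       (simp_all add: f_def cblinfun_simps cinner_simps distrib_left scaleC_add_left sum.distrib
        complex_vector.scale_sum_right scaleC_scaleC complex_vector.scale_right_diff_distrib mult.left_commute)
  interpret f: Vector_Spaces.linear "(*\<^sub>C)" "(*\<^sub>C)" f by fact
  have fsa: "cinner (f x) y = cinner x (f y)" for x y
  proof -
    have "cinner (\<Sum>b\<in>B. (complex_of_real (l b) * cinner b x) *\<^sub>C b) y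
        = (\<Sum>b\<in>B. complex_of_real (l b) * cinner x b * cinner b y)"
      by (subst cinner_commute)
         (simp add: cinner_sum_right cinner_scaleC_right flip: cinner_commute)
    then show ?thesis
      by (simp add: f_def cinner_diff_left cinner_diff_right selfadjoint_opD[OF sa] cinner_sum_right
          cinner_scaleC_right mult_ac)
  qed
  have fB: "f b = 0" if "b \<in> B" for b
  proof -
    have "(\<Sum>c\<in>B. (complex_of_real (l c) * cinner c b) *\<^sub>C c)
        = (\<Sum>c\<in>B. if c = b then complex_of_real (l b) *\<^sub>C b else 0)"
      using on that by (intro sum.cong) (auto simp: orthonormal_def)
    then show ?thesis using B(1) that by (simp add: f_def eig_def)
  qed
  have orth: "cinner b (f x) = 0" if "b \<in> B" for b x
    using fsa[of b x] fB[OF that] by simp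
  have "f x = 0" for x
  proof (rule ccontr)
    assume nz: "f x \<noteq> 0"
    have "f y \<in> range G" for y
    proof -
      have "(\<Sum>b\<in>B. (complex_of_real (l b) * cinner b y) *\<^sub>C b) = G (\<Sum>b\<in>B. cinner b y *\<^sub>C b)"
        unfolding cblinfun_sum_right using B(1)
        by (intro sum.cong) (simp_all add: eig_def cblinfun_simps scaleC_scaleC mult.commute)
      then show ?thesis by (simp add: f_def flip: cblinfun_diff_right)
    qed
    then have "finite_dim (range f)" using fin by (rule_tac finite_dim_subset) auto
    moreover have "csubspace (range f)"
      by (intro f.subspace_image) simp
    ultimately obtain \<mu> w where w: "w \<in> range f" "w \<noteq> 0" "f w = \<mu> *\<^sub>C w"
      using eigenvector_exists[of "range f" f "f x"] lin nz by blast
    have wB: "cinner b w = 0" if "b \<in> B" for b using w(1) orth[OF that] by auto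
    have "cnj \<mu> * cinner w w = \<mu> * cinner w w"
      using fsa[of w w] by (simp only: w(3) cinner_scaleC_left cinner_scaleC_right)
    then have "\<mu> = cnj \<mu>" by (metis cinner_eq_zero_iff mult_right_cancel w(2))
    then have \<mu>: "\<mu> = complex_of_real (Re \<mu>)" by (simp add: complex_eq_iff)
    \<comment> \<open>A self-adjoint operator annihilates no nonzero vector w = f v of its own
      range, since \<open><w, w> = <v, f w>\<close>.\<close>
    have "\<mu> \<noteq> 0"
    proof
      assume "\<mu> = 0"
      obtain v where "w = f v" using w(1) by blast
      then have "cinner w w = cinner v (f w)" using fsa by simp
      then show False using w \<open>\<mu> = 0\<close> by simp
    qed
    have Gw: "G w = \<mu> *\<^sub>C w" using w(3) wB by (simp add: f_def)
    define v where "v = complex_of_real (1 / norm w) *\<^sub>C w"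
    have vv: "cinner v v = 1"
      using w(2) by (simp add: cinner_self) (simp add: v_def norm_scaleC norm_divide)
    have vB: "cinner b v = 0" "cinner v b = 0" if "b \<in> B" for b
      using wB[OF that] cinner_commute[of w b] by (simp_all add: v_def cinner_simps)
    have Gv: "G v = complex_of_real (Re \<mu>) *\<^sub>C v"
      using Gw \<mu> by (simp add: v_def cblinfun_simps scaleC_scaleC mult.commute)
    have "v \<notin> B" using vB(1)[of v] vv by auto
    then have "eig (insert v B) (l(v := Re \<mu>))"
      using B(1) vv vB Gv \<open>\<mu> \<noteq> 0\<close> \<mu> by (auto simp: eig_def orthonormal_def)
    moreover have "card (insert v B) = Suc n" using \<open>v \<notin> B\<close> finB B(2) by simp
    ultimately have "ex (Suc n)" unfolding ex_def by blast
    then have "Suc n \<le> n" unfolding n_def by (rule Greatest_le_nat[of ex, OF _ ex_le])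
    then show False by simp
  qed
  then have "diagonalized G B l"
    using B(1) by unfold_locales (auto simp: eig_def f_def)
  then show ?thesis by (rule that)
qed

section \<open>Riesz theory of compact perturbations of the identity\<close>

lemma csubspace_imp_subspace: "csubspace Z \<Longrightarrow> subspace Z"
  unfolding subspace_def scaleR_scaleC by (simp add: csubspaceD)

lemma compact_op_convergent_subseq:
  fixes K :: "'a::complex_normed_vector \<Rightarrow>\<^sub>C\<^sub>L 'b::complex_normed_vector" and X :: "nat \<Rightarrow> 'a"
  assumes "compact_op K" "bounded (range X)"
  obtains r l where "strict_mono r" "(\<lambda>n. K (X (r n))) \<longlonglongrightarrow> l"
proof -
  obtain c where c: "c > 0" "\<And>n. norm (X n) \<le> c"
    using assms(2) by (auto simp: bounded_pos)
  define Y where "Y n = K (complex_of_real (1 / c) *\<^sub>C X n)" for n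
  have "Y n \<in> cblinfun_apply K ` cball 0 1" for n
    unfolding Y_def using c by (intro imageI) (simp add: norm_scaleC norm_divide)
  then have "Y n \<in> closure (cblinfun_apply K ` cball 0 1)" for n
    using closure_subset by blast
  moreover have "seq_compact (closure (cblinfun_apply K ` cball 0 1))"
    using assms(1) by (simp add: compact_op_def compact_eq_seq_compact_metric)
  ultimately obtain l r where r: "strict_mono r" "(Y \<circ> r) \<longlonglongrightarrow> l"
    by (elim seq_compactE[of _ Y]) auto
  have "(\<lambda>n. complex_of_real c *\<^sub>C Y (r n)) \<longlonglongrightarrow> complex_of_real c *\<^sub>C l"
    using r(2) by (intro tendsto_scaleC tendsto_const) (simp add: o_def)
  moreover have "complex_of_real c *\<^sub>C Y (r n) = K (X (r n))" for n
    using c(1) by (simp add: Y_def cblinfun_simps scaleC_scaleC scaleC_one)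
  ultimately show ?thesis using r(1) that by simp
qed

text \<open>Compactness of 1 - M, phrased with subsequences so that it passes directly to products
  and powers of M.\<close>

definition compact_perturbation :: "('a::complex_normed_vector endo) \<Rightarrow> bool" where
  "compact_perturbation M \<longleftrightarrow>
    (\<forall>X. bounded (range X) \<longrightarrow> (\<exists>r l. strict_mono r \<and> (\<lambda>n. X (r n) - M (X (r n :: nat))) \<longlonglongrightarrow> l))"

lemma compact_perturbationD:
  fixes X :: "nat \<Rightarrow> 'a::complex_normed_vector"
  assumes "compact_perturbation M" "bounded (range X)"
  obtains r :: "nat \<Rightarrow> nat" and l where "strict_mono r" "(\<lambda>n. X (r n) - M (X (r n))) \<longlonglongrightarrow> l"
proof -
  have "\<exists>r l. strict_mono r \<and> (\<lambda>n. X (r n) - M (X (r n :: nat))) \<longlonglongrightarrow> l"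
    using assms unfolding compact_perturbation_def by simp
  then show ?thesis using that by (elim exE conjE)
qed

lemma bounded_range_cblinfun:
  assumes "bounded (range X)"
  shows "bounded (range (\<lambda>n. cblinfun_apply S (X n)))"
  using bounded_linear_image[OF assms bounded_linear_cblinfun_apply, of S]
  unfolding image_image .

lemma compact_perturbation_id: "compact_perturbation id_cblinfun"
  unfolding compact_perturbation_def by (auto intro!: exI[of _ "\<lambda>n. n"] exI[of _ 0] simp: strict_mono_def)

text \<open>1 - M N = (1 - N) + (1 - M) N, with a subsequence extracted for each summand in
  turn.\<close>

lemma compact_perturbation_compose:
  assumes "compact_perturbation M" "compact_perturbation N"
  shows "compact_perturbation (M o\<^sub>C\<^sub>L N)"
  unfolding compact_perturbation_def
proof (intro allI impI)
  fix X :: "nat \<Rightarrow> 'a" assume X: "bounded (range X)"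
  from assms(2) X obtain r l where r: "strict_mono r" "(\<lambda>n. X (r n) - N (X (r n))) \<longlonglongrightarrow> l"
    by (rule compact_perturbationD)
  define Y where "Y n = N (X (r n))" for n
  have "bounded (range Y)"
    unfolding Y_def by (rule bounded_subset[OF bounded_range_cblinfun[OF X, of N]]) auto
  with assms(1) obtain q k where q: "strict_mono q" "(\<lambda>n. Y (q n) - M (Y (q n))) \<longlonglongrightarrow> k"
    by (rule compact_perturbationD)
  have "(\<lambda>n. X (r (q n)) - N (X (r (q n)))) \<longlonglongrightarrow> l"
    using LIMSEQ_subseq_LIMSEQ[OF r(2) q(1)] by (simp add: o_def)
  from tendsto_add[OF this q(2)]
  have "(\<lambda>n. X ((r \<circ> q) n) - (M o\<^sub>C\<^sub>L N) (X ((r \<circ> q) n))) \<longlonglongrightarrow> l + k" by (simp add: Y_def)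
  then show "\<exists>r l. strict_mono r \<and> (\<lambda>n. X (r n) - (M o\<^sub>C\<^sub>L N) (X (r n))) \<longlonglongrightarrow> l"
    using r(1) q(1) strict_mono_o by blast
qed

definition cpow :: "('a::complex_normed_vector endo) \<Rightarrow> nat \<Rightarrow> 'a endo" where
  "cpow S n = ((o\<^sub>C\<^sub>L) S ^^ n) id_cblinfun"

lemma cpow_simps [simp]: "cpow S 0 = id_cblinfun" "cpow S (Suc n) = S o\<^sub>C\<^sub>L cpow S n"
  by (simp_all add: cpow_def)

lemma cpow_add: "cpow S (m + n) x = cpow S m (cpow S n x)"
  by (induction m) simp_all

lemma cpow_commute_apply:
  fixes S T :: "'a::complex_normed_vector endo"
  assumes "\<And>x. S (T x) = T (S x)"
  shows "cpow S n (cblinfun_apply T x) = T (cpow S n x)"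
proof (induction n)
  case (Suc n)
  have "cpow S (Suc n) (cblinfun_apply T x) = S (T (cpow S n x))" using Suc by simp
  then show ?case by (simp only: assms cpow_simps cblinfun_apply_compose)
qed simp

lemma cpow_self_commute: "cpow S n (cblinfun_apply S x) = S (cpow S n x)"
  by (rule cpow_commute_apply) (rule refl)

lemma cpow_Suc_right: "cpow S (Suc n) x = cpow S n (cblinfun_apply S x)"
  by (simp add: cpow_self_commute)

lemma compact_perturbation_cpow: "compact_perturbation M \<Longrightarrow> compact_perturbation (cpow M n)"
  by (induction n) (simp_all add: compact_perturbation_id compact_perturbation_compose)

lemma subspace_kernel: "csubspace {x. cblinfun_apply S x = 0}"
  by (auto intro!: complex_vector.subspaceI simp: cblinfun_simps)

lemma subspace_range: "csubspace (ran S)"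
proof (rule complex_vector.subspaceI)
  show "0 \<in> ran S" using rangeI[of "cblinfun_apply S" 0] by simp
qed (auto simp flip: cblinfun_add_right cblinfun_scaleC_right)

lemma closed_kernel: "closed {x. cblinfun_apply S x = 0}"
  using continuous_closed_vimage[of "{0}" "cblinfun_apply S"]
    linear_continuous_at[OF bounded_linear_cblinfun_apply]
  by (auto simp: vimage_def)

text \<open>Otherwise there are unit vectors of Z with images tending to 0. As 1 - M is compact, a
  subsequence of the vectors themselves converges, and its limit is a unit vector of Z killed by
  M.\<close>

lemma compact_perturbation_bounded_below:
  fixes M :: "'a::chilbert_space endo"
  assumes cp: "compact_perturbation M" and sub: "csubspace Z" and cl: "closed Z"
    and inj: "\<And>x. x \<in> Z \<Longrightarrow> M x = 0 \<Longrightarrow> x = 0"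
  obtains c where "c > 0" "\<And>x. x \<in> Z \<Longrightarrow> norm x \<le> c * norm (M x)"
proof -
  have "\<exists>c>0. \<forall>x\<in>Z. norm x \<le> c * norm (M x)"
  proof (rule ccontr)
    assume "\<not> ?thesis"
    then have "\<exists>x\<in>Z. real (Suc n) * norm (M x) < norm x" for n
      by (meson not_le of_nat_0_less_iff zero_less_Suc)
    then obtain x where x: "\<And>n. x n \<in> Z" "\<And>n. real (Suc n) * norm (M (x n)) < norm (x n)" by metis
    define u where "u n = complex_of_real (1 / norm (x n)) *\<^sub>C x n" for n
    have pos: "norm (x n) > 0" for n
      by (rule le_less_trans[OF _ x(2)[of n]]) simp
    have uZ: "u n \<in> Z" for n unfolding u_def using x(1) csubspaceD(4)[OF sub] by blast
    have nu: "norm (u n) = 1" for n using pos[of n] by (simp add: u_def norm_scaleC norm_divide)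
    have Mu: "norm (M (u n)) \<le> inverse (real (Suc n))" for n
    proof -
      have "norm (M (u n)) = norm (M (x n)) / norm (x n)"
        by (simp add: u_def cblinfun_scaleC_right norm_scaleC norm_divide)
      also have "\<dots> \<le> inverse (real (Suc n))"
        using x(2)[of n] pos[of n] by (simp add: divide_simps mult.commute del: of_nat_Suc)
      finally show ?thesis .
    qed
    have lim0: "(\<lambda>n. M (u n)) \<longlonglongrightarrow> 0"
      by (rule Lim_null_comparison[OF always_eventually LIMSEQ_inverse_real_of_nat]) (use Mu in auto)
    have "bounded (range u)" unfolding bounded_iff using nu by auto
    with cp obtain r l where r: "strict_mono r" "(\<lambda>n. u (r n) - M (u (r n))) \<longlonglongrightarrow> l"
      by (rule compact_perturbationD)
    have Mr: "(\<lambda>n. M (u (r n))) \<longlonglongrightarrow> 0" using LIMSEQ_subseq_LIMSEQ[OF lim0 r(1)] by (simp add: o_def)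
    from tendsto_add[OF r(2) Mr] have ul: "(\<lambda>n. u (r n)) \<longlonglongrightarrow> l" by simp
    have "l \<in> Z" using closed_sequentially[OF cl _ ul] uZ by blast
    moreover have "M l = 0"
      using tendsto_cblinfun_apply[OF tendsto_const ul, of M] Mr LIMSEQ_unique by blast
    moreover have "norm l = 1" using tendsto_norm[OF ul] nu by (simp add: LIMSEQ_const_iff)
    ultimately show False using inj by force
  qed
  then show ?thesis using that by blast
qed

text \<open>M has the same range on the orthogonal complement Z of its kernel, where it is injective
  and therefore bounded below.\<close>

lemma compact_perturbation_closed_range:
  fixes M :: "'a::chilbert_space endo"
  assumes cp: "compact_perturbation M"
  shows "closed (ran M)"
proof -
  define Z where "Z = {z. \<forall>k. M k = 0 \<longrightarrow> cinner k z = 0}"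
  have sub: "csubspace Z"
    by (auto intro!: complex_vector.subspaceI simp: Z_def cinner_simps)
  have "closed {z. cinner k z = 0}" for k :: 'a
    using continuous_closed_vimage[of "{0}" "cinner k"]
      linear_continuous_at[OF bounded_bilinear.bounded_linear_right[OF bounded_bilinear_cinner]]
    by (auto simp: vimage_def)
  then have cl: "closed Z" unfolding Z_def by (simp add: Collect_all_eq closed_INT Collect_imp_eq closed_Un)
  have inj: "x = 0" if "x \<in> Z" "M x = 0" for x using that by (auto simp: Z_def)
  obtain c where c: "c > 0" "\<And>x. x \<in> Z \<Longrightarrow> norm x \<le> c * norm (M x)"
    using compact_perturbation_bounded_below[OF cp sub cl inj] by blast
  have "complete (cblinfun_apply M ` Z)"
  proof (rule complete_isometric_image[of "1 / c"])
    show "\<forall>x\<in>Z. 1 / c * norm x \<le> norm (M x)" using c by (simp add: field_simps)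
    show "complete Z" using cl complete_eq_closed by blast
  qed (use c sub csubspace_imp_subspace bounded_linear_cblinfun_apply in auto)
  moreover have "ran M = cblinfun_apply M ` Z"
  proof -
    have "M x \<in> cblinfun_apply M ` Z" for x
    proof -
      obtain y where y: "y \<in> {x. M x = 0}" "\<And>k. k \<in> {x. M x = 0} \<Longrightarrow> cinner k (x - y) = 0"
        using orthogonal_decomposition[OF subspace_kernel closed_kernel] by blast
      then have "x - y \<in> Z" "M x = M (x - y)" by (auto simp: Z_def cblinfun_diff_right)
      then show ?thesis by blast
    qed
    then show ?thesis by auto
  qed
  ultimately show ?thesis by (simp add: complete_imp_closed)
qed

text \<open>The Hilbert space form of Riesz's lemma, with the distance 1 to V attained
  exactly.\<close>

lemma unit_orthogonal_vector:
  fixes V U :: "'a::chilbert_space set"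
  assumes "csubspace U" "csubspace V" "closed V" "V \<subset> U"
  obtains x where "x \<in> U" "norm x = 1" "\<And>v. v \<in> V \<Longrightarrow> cinner v x = 0"
proof -
  obtain u where u: "u \<in> U" "u \<notin> V" using assms(4) by blast
  obtain y where y: "y \<in> V" "\<And>v. v \<in> V \<Longrightarrow> cinner v (u - y) = 0"
    using orthogonal_decomposition[OF assms(2,3)] by blast
  define x where "x = complex_of_real (1 / norm (u - y)) *\<^sub>C (u - y)"
  have "u - y \<noteq> 0" using u(2) y(1) by auto
  then have "norm x = 1" by (simp add: x_def norm_scaleC norm_divide)
  moreover have "x \<in> U" unfolding x_def using u y assms(1,4) csubspaceD[OF assms(1)] by blast
  moreover have "cinner v x = 0" if "v \<in> V" for v
    using y(2)[OF that] by (simp only: x_def cinner_scaleC_right) simp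
  ultimately show ?thesis by (rule_tac that)
qed

lemma compact_perturbation_no_separated_sequence:
  fixes x :: "nat \<Rightarrow> 'a::complex_normed_vector"
  assumes cp: "compact_perturbation M" and x: "\<And>n. norm (x n) \<le> 1"
    and sep: "\<And>m n. m < n \<Longrightarrow> 1 \<le> norm ((x m - M (x m)) - (x n - M (x n)))"
  shows False
proof -
  have "bounded (range x)" unfolding bounded_iff using x by auto
  with cp obtain r l where r: "strict_mono r" "(\<lambda>n. x (r n) - M (x (r n))) \<longlonglongrightarrow> l"
    by (rule compact_perturbationD)
  then have "Cauchy (\<lambda>n. x (r n) - M (x (r n)))" using LIMSEQ_imp_Cauchy by blast
  from CauchyD[OF this, of 1] obtain N where
    "norm ((x (r N) - M (x (r N))) - (x (r (Suc N)) - M (x (r (Suc N))))) < 1"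
    by (metis le_SucI order_refl zero_less_one)
  then show False
    using sep[of "r N" "r (Suc N)"] strict_monoD[OF r(1), of N "Suc N"] by simp
qed

lemma norm_diff_orthogonal_ge:
  assumes "cinner w x = 0" "norm (x::'a::complex_inner) = 1"
  shows "1 \<le> norm (x - w)"
proof -
  have "cinner x (- w) = 0" using assms(1) cinner_commute[of x w] by (simp add: cinner_minus_right)
  then have "(norm (x - w))\<^sup>2 = 1 + (norm w)\<^sup>2"
    using norm_add_square[of x "- w"] assms(2) by simp
  then have "1\<^sup>2 \<le> (norm (x - w))\<^sup>2" by simp
  then show ?thesis by (rule power2_le_imp_le) simp
qed

text \<open>Unit vectors in \<open>U n\<close> orthogonal to \<open>L n\<close> have images under 1
  - M at mutual distance at least 1, contradicting compactness. The disjunction covers both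
  directions: the first alternative serves decreasing ranges, the second increasing kernels.\<close>

lemma compact_perturbation_no_chain:
  fixes M :: "'a::chilbert_space endo" and U L :: "nat \<Rightarrow> 'a set"
  assumes cp: "compact_perturbation M"
    and sub: "\<And>n. csubspace (U n)" "\<And>n. csubspace (L n)" "\<And>n. closed (L n)" "\<And>n. L n \<subset> U n"
    and step: "\<And>m n x y. m < n \<Longrightarrow> x \<in> U m \<Longrightarrow> y \<in> U n \<Longrightarrow>
      M x + y - M y \<in> L m \<or> M y + x - M x \<in> L n"
  shows False
proof -
  have "\<exists>x. x \<in> U n \<and> norm x = 1 \<and> (\<forall>v\<in>L n. cinner v x = 0)" for n
    using unit_orthogonal_vector[OF sub] by metis
  then obtain x where x: "\<And>n. x n \<in> U n" "\<And>n. norm (x n) = 1"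
    "\<And>n v. v \<in> L n \<Longrightarrow> cinner v (x n) = 0" by metis
  have "1 \<le> norm ((x m - M (x m)) - (x n - M (x n)))" if "m < n" for m n
    using step[OF that x(1) x(1)]
  proof
    assume "M (x m) + x n - M (x n) \<in> L m"
    from norm_diff_orthogonal_ge[OF x(3)[OF this] x(2)] show ?thesis by (simp add: algebra_simps)
  next
    assume "M (x n) + x m - M (x m) \<in> L n"
    from norm_diff_orthogonal_ge[OF x(3)[OF this] x(2)] show ?thesis
      by (simp add: algebra_simps norm_minus_commute)
  qed
  then show False
    by (rule_tac compact_perturbation_no_separated_sequence[OF cp, of x]) (simp_all add: x(2))
qed

section \<open>Finite ascent and descent, and the Riesz projection at the eigenvalue 0\<close>

lemma range_cpow_stabilizes:
  fixes M :: "'a::chilbert_space endo"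
  assumes cp: "compact_perturbation M"
  obtains n where "ran (cpow M n) = ran (cpow M (Suc n))"
proof -
  define R where "R n = ran (cpow M n)" for n
  have dec: "R (Suc n) \<subseteq> R n" for n by (auto simp: R_def cpow_Suc_right simp del: cpow_simps)
  have MR: "M x \<in> R (Suc n)" if "x \<in> R n" for x n using that by (auto simp: R_def)
  have sub: "csubspace (R n)" for n unfolding R_def by (rule subspace_range)
  have cl: "closed (R n)" for n
    unfolding R_def by (rule compact_perturbation_closed_range[OF compact_perturbation_cpow[OF cp]])
  have "\<exists>n. R n = R (Suc n)"
  proof (rule ccontr)
    assume "\<not> ?thesis"
    then have strict: "R (Suc n) \<subset> R n" for n using dec by blast
    have "M x + y - M y \<in> R (Suc m)" if "m < n" "x \<in> R m" "y \<in> R n" for m n x y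
    proof -
      have "y \<in> R (Suc m)" using that(3) lift_Suc_antimono_le[of R "Suc m" n, OF dec] that(1) by auto
      moreover have "M y \<in> R (Suc m)" using MR dec calculation by blast
      ultimately show ?thesis using MR[OF that(2)] csubspaceD[OF sub] by blast
    qed
    then show False using compact_perturbation_no_chain[OF cp sub sub cl strict] by blast
  qed
  then show ?thesis using that unfolding R_def by blast
qed

lemma kernel_cpow_stabilizes:
  fixes M :: "'a::chilbert_space endo"
  assumes cp: "compact_perturbation M"
  obtains n where "{x. cpow M n x = 0} = {x. cpow M (Suc n) x = 0}"
proof -
  define R where "R n = {x. cpow M n x = 0}" for n
  have inc: "R n \<subseteq> R (Suc n)" for n by (auto simp: R_def)
  have MR: "M x \<in> R n" if "x \<in> R (Suc n)" for x n
    using that by (simp add: R_def cpow_Suc_right del: cpow_simps)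
  have sub: "csubspace (R n)" for n unfolding R_def by (rule subspace_kernel)
  have cl: "closed (R n)" for n unfolding R_def by (rule closed_kernel)
  have "\<exists>n. R n = R (Suc n)"
  proof (rule ccontr)
    assume "\<not> ?thesis"
    then have strict: "R n \<subset> R (Suc n)" for n using inc by blast
    have "M y + x - M x \<in> R n" if "m < n" "x \<in> R (Suc m)" "y \<in> R (Suc n)" for m n x y
    proof -
      have "x \<in> R n" using that(2) lift_Suc_mono_le[of R "Suc m" n, OF inc] that(1) by auto
      moreover have "M x \<in> R n" using MR inc calculation by blast
      ultimately show ?thesis using MR[OF that(3)] csubspaceD[OF sub] by blast
    qed
    then show False using compact_perturbation_no_chain[OF cp sub sub cl strict] by blast
  qed
  then show ?thesis using that unfolding R_def by blast
qed

text \<open>In infinite dimension Gram-Schmidt never stops; the resulting orthonormal sequence has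
  no convergent subsequence.\<close>

lemma finite_dim_if_precompact:
  fixes V :: "'a::complex_inner set"
  assumes sub: "csubspace V"
    and comp: "\<And>x. (\<And>n::nat. x n \<in> V) \<Longrightarrow> bounded (range x) \<Longrightarrow> \<exists>r l. strict_mono r \<and> (\<lambda>n. x (r n)) \<longlonglongrightarrow> l"
  shows "finite_dim V"
proof (rule ccontr)
  assume inf: "\<not> finite_dim V"
  define good where "good f n r \<longleftrightarrow> r \<in> V \<and> norm r = 1 \<and> (\<forall>m<n. cinner (f m) r = 0)"
    for f :: "nat \<Rightarrow> 'a" and n r
  have "\<exists>f. \<forall>n. good f n (f n)"
  proof (rule dependent_wellorder_choice)
    show "good f n r = good g n r" if "\<And>m. m < n \<Longrightarrow> f m = g m" for r f g n
      using that by (simp add: good_def)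
    fix n f assume f: "\<And>m. m < n \<Longrightarrow> good f m (f m)"
    have fV: "f m \<in> V" if "m < n" for m using f[OF that] by (simp add: good_def)
    obtain v where v: "v \<in> V" "v \<notin> cspan (f ` {..<n})"
      using inf unfolding finite_dim_def by blast
    define w where "w = v - (\<Sum>m<n. cinner (f m) v *\<^sub>C f m)"
    have "(\<Sum>m<n. cinner (f m) v *\<^sub>C f m) \<in> cspan (f ` {..<n})"
      by (auto intro!: complex_vector.span_sum complex_vector.span_scale intro: complex_vector.span_base)
    then have "w \<noteq> 0" using v(2) by (auto simp: w_def)
    have "w \<in> V" unfolding w_def using v(1) fV sub csubspaceD[OF sub]
      by (auto intro!: csubspaceD(3)[OF sub] complex_vector.subspace_sum)
    have "cinner (f m) w = 0" if "m < n" for m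
    proof -
      have "cinner (f m) (f k) = (if k = m then 1 else 0)" if "k < n" for k
      proof (cases k m rule: linorder_cases)
        case less
        then show ?thesis using f[OF \<open>m < n\<close>] cinner_commute[of "f m" "f k"] by (simp add: good_def)
      next
        case equal
        then show ?thesis using f[OF \<open>m < n\<close>] by (simp add: good_def cinner_self)
      next
        case greater
        then show ?thesis using f[OF that] by (simp add: good_def)
      qed
      then have "(\<Sum>k<n. cinner (f k) v * cinner (f m) (f k)) = (\<Sum>k<n. if k = m then cinner (f m) v else 0)"
        by (intro sum.cong) auto
      then show ?thesis using that by (simp add: w_def cinner_simps cinner_sum_right)
    qed
    then have "good f n (complex_of_real (1 / norm w) *\<^sub>C w)"
      using \<open>w \<in> V\<close> \<open>w \<noteq> 0\<close> csubspaceD(4)[OF sub]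
      unfolding good_def cinner_scaleC_right by (simp add: norm_scaleC norm_divide)
    then show "\<exists>r. good f n r" by blast
  qed
  then obtain f where f: "\<And>n. good f n (f n)" by blast
  have "bounded (range f)" unfolding bounded_iff using f by (auto simp: good_def)
  then obtain r l where r: "strict_mono r" "(\<lambda>n. f (r n)) \<longlonglongrightarrow> l"
    using comp[of f] f unfolding good_def by blast
  then have "Cauchy (\<lambda>n. f (r n))" using LIMSEQ_imp_Cauchy by blast
  from CauchyD[OF this, of 1] obtain N where N: "norm (f (r (Suc N)) - f (r N)) < 1"
    by (metis le_SucI order_refl zero_less_one)
  have "r N < r (Suc N)" using strict_monoD[OF r(1), of N "Suc N"] by simp
  then have "1 \<le> norm (f (r (Suc N)) - f (r N))"
    using f[of "r (Suc N)"] by (intro norm_diff_orthogonal_ge) (auto simp: good_def)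
  then show False using N by simp
qed

text \<open>G picks the preimage of \<open>q x\<close> in Z. Injectivity on Z makes the choice
  linear, and the lower bound of M on Z makes it continuous.\<close>

lemma compact_perturbation_inverse_on:
  fixes M q :: "'a::chilbert_space endo"
  assumes cp: "compact_perturbation M" and sub: "csubspace Z" and cl: "closed Z"
    and inj: "\<And>x. x \<in> Z \<Longrightarrow> M x = 0 \<Longrightarrow> x = 0" and surj: "\<And>x. q x \<in> cblinfun_apply M ` Z"
  obtains G :: "'a endo" where "\<And>x. G x \<in> Z" "\<And>x. M (G x) = q x"
proof -
  obtain c where c: "c > 0" "\<And>x. x \<in> Z \<Longrightarrow> norm x \<le> c * norm (M x)"
    using compact_perturbation_bounded_below[OF cp sub cl inj] by blast
  have uniq: "x = y" if "x \<in> Z" "y \<in> Z" "M x = M y" for x y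
    using inj[of "x - y"] csubspaceD(3)[OF sub that(1,2)] that(3) by (simp add: cblinfun_diff_right)
  have "\<exists>y. y \<in> Z \<and> M y = q x" for x using surj[of x] by force
  then obtain g where g: "\<And>x. g x \<in> Z" "\<And>x. M (g x) = q x" by metis
  have "g (x + y) = g x + g y" for x y
    using csubspaceD(2)[OF sub g(1) g(1)] by (rule_tac uniq) (simp_all add: g cblinfun_add_right)
  moreover have "g (a *\<^sub>C x) = a *\<^sub>C g x" for a x
    using csubspaceD(4)[OF sub g(1)] by (rule_tac uniq) (simp_all add: g cblinfun_scaleC_right)
  moreover have "norm (g x) \<le> norm x * (c * norm q)" for x
  proof -
    have "norm (g x) \<le> c * norm (q x)" using c(2)[OF g(1)] by (simp add: g)
    also have "\<dots> \<le> c * (norm q * norm x)" using c(1) by (intro mult_left_mono norm_cblinfun) simp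
    finally show ?thesis by (simp add: mult_ac)
  qed
  ultimately obtain G :: "'a endo" where "cblinfun_apply G = g"
    by (rule cblinfun_of_function)
  with g show ?thesis by (intro that[of G]) simp_all
qed

text \<open>Once ranges and kernels of the powers of M are stable, the space is the direct sum of
  the range R and the kernel of L, the n-th power of M. M is bijective on R and nilpotent on the
  kernel of L; P projects onto that kernel along R, and G inverts M on R and vanishes on the
  kernel.\<close>

theorem riesz_decomposition:
  fixes M :: "'a::chilbert_space endo"
  assumes cp: "compact_perturbation M"
  obtains P G :: "'a endo" and n where
    "\<And>x. P (P x) = P x" "\<And>x. M (P x) = P (M x)" "\<And>x. cpow M n (P x) = 0"
    "\<And>x. M (G x) = x - P x" "\<And>x. G (M x) = x - P x" "\<And>x. G (P x) = 0" "\<And>x. P (G x) = 0"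
    "finite_dim (ran P)"
proof -
  obtain i where i: "ran (cpow M i) = ran (cpow M (Suc i))"
    using range_cpow_stabilizes[OF cp] .
  obtain j where j: "{x. cpow M j x = 0} = {x. cpow M (Suc j) x = 0}"
    using kernel_cpow_stabilizes[OF cp] .
  \<comment> \<open>Ranges are stable from i on and kernels from j on; one exponent serves
    both.\<close>
  define n where "n = i + j"
  define R where "R = ran (cpow M n)"
  have MR: "M x \<in> R" if "x \<in> R" for x
    using that unfolding R_def by (auto simp flip: cpow_self_commute)
  have R_eq: "x \<in> cblinfun_apply M ` R" if x: "x \<in> R" for x
  proof -
    obtain y where "x = cpow M n y" using x unfolding R_def by blast
    then have y: "x = cpow M (j + i) y" by (simp add: n_def add.commute)
    have "cpow M i y \<in> ran (cpow M (Suc i))" using i by blast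
    then obtain z where "cpow M i y = cpow M (Suc i) z" by blast
    then have "x = M (cpow M n z)" by (simp add: y n_def cpow_add cpow_self_commute add.commute[of i])
    then show ?thesis unfolding R_def by blast
  qed
  have R_pow: "x \<in> cblinfun_apply (cpow M k) ` R" if "x \<in> R" for x k
  proof (induction k)
    case 0
    then show ?case using that by (auto simp: image_iff)
  next
    case (Suc k)
    then obtain y where y: "x = cpow M k y" "y \<in> R" by blast
    obtain z where "y = M z" "z \<in> R" using R_eq[OF y(2)] by blast
    then show ?case using y(1) by (auto simp: cpow_Suc_right simp del: cpow_simps)
  qed
  have ker1: "cpow M n x = 0" if "cpow M (Suc n) x = 0" for x
  proof -
    have "cpow M (Suc j) (cpow M i x) = 0" using that by (simp add: n_def cpow_add add.commute[of i])
    then have "cpow M j (cpow M i x) = 0" using j by blast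
    then show ?thesis by (simp add: n_def cpow_add add.commute[of i])
  qed
  have ker: "cpow M n x = 0" if "cpow M (n + k) x = 0" for x k
    using that
  proof (induction k)
    case (Suc k)
    have "cpow M (Suc n) (cpow M k x) = 0"
      using Suc.prems by (simp add: cpow_add)
    then have "cpow M (n + k) x = 0" using ker1 by (simp add: cpow_add)
    then show ?case by (rule Suc.IH)
  qed simp
  define L where "L = cpow M n"
  have cpL: "compact_perturbation L" unfolding L_def by (rule compact_perturbation_cpow[OF cp])
  have subR: "csubspace R" unfolding R_def by (rule subspace_range)
  have clR: "closed R" using compact_perturbation_closed_range[OF cpL] by (simp add: R_def L_def)
  have injL: "x = 0" if x: "x \<in> R" "L x = 0" for x
  proof -
    obtain y where "x = L y" using x(1) by (auto simp: R_def L_def)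
    then show ?thesis using x(2) ker[of n y] by (simp add: L_def cpow_add)
  qed
  have LM: "L (M x) = M (L x)" for x unfolding L_def by (rule cpow_self_commute)
  have "L x \<in> cblinfun_apply L ` R" for x
    using R_pow[of "L x" n] by (simp add: L_def R_def)
  \<comment> \<open>Q x is the element of R with the same image under L as x: the projection onto R
    along the kernel of L.\<close>
  then obtain Q :: "'a endo" where Q: "\<And>x. Q x \<in> R" "\<And>x. L (Q x) = L x"
    using compact_perturbation_inverse_on[OF cpL subR clR injL] by blast
  have uniqL: "x = y" if "x \<in> R" "y \<in> R" "L x = L y" for x y
    using injL[of "x - y"] csubspaceD(3)[OF subR that(1,2)] that(3) by (simp add: cblinfun_diff_right)
  have injM: "x = 0" if "x \<in> R" "M x = 0" for x
    using injL[OF that(1)] that(2) ker1[of x]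
    by (simp add: L_def cpow_Suc_right del: cpow_simps)
  have uniqM: "x = y" if "x \<in> R" "y \<in> R" "M x = M y" for x y
    using injM[of "x - y"] csubspaceD(3)[OF subR that(1,2)] that(3) by (simp add: cblinfun_diff_right)
  have "Q x \<in> cblinfun_apply M ` R" for x using R_eq Q(1) by blast
  then obtain G :: "'a endo" where G: "\<And>x. G x \<in> R" "\<And>x. M (G x) = Q x"
    using compact_perturbation_inverse_on[OF cp subR clR injM] by blast
  have QR: "Q x = x" if "x \<in> R" for x by (rule uniqL) (use Q that in auto)
  have QM: "Q (M x) = M (Q x)" for x
    by (rule uniqL) (simp_all add: Q MR LM)
  define P where "P = id_cblinfun - Q"
  have Px: "P x = x - Q x" for x by (simp add: P_def cblinfun_simps)
  have LP: "L (P x) = 0" for x by (simp add: Px cblinfun_simps Q)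
  \<comment> \<open>L vanishes on the range of P, so there x = x - L x, and 1 - L is
    compact.\<close>
  have "finite_dim (ran P)"
  proof (rule finite_dim_if_precompact[OF subspace_range])
    fix x assume x: "\<And>n::nat. x n \<in> ran P" "bounded (range x)"
    have "L (x n) = 0" for n using x(1)[of n] LP by auto
    moreover obtain r l where "strict_mono r" "(\<lambda>n. x (r n) - L (x (r n))) \<longlonglongrightarrow> l"
      using cpL x(2) by (rule compact_perturbationD)
    ultimately show "\<exists>r l. strict_mono r \<and> (\<lambda>n. x (r n)) \<longlonglongrightarrow> l" by auto
  qed
  moreover have "G (M x) = x - P x" for x
  proof -
    have "M (G (M x)) = M (Q x)" by (simp add: G QM)
    then show ?thesis using uniqM[OF G(1) Q(1)] by (simp add: Px)
  qed
  moreover have "G (P x) = 0" for x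
    by (rule injM[OF G(1)]) (simp add: G(2) Px cblinfun_diff_right QR[OF Q(1)])
  moreover have "P (P x) = P x" "M (P x) = P (M x)" "M (G x) = x - P x" "P (G x) = 0" for x
    by (simp_all add: Px cblinfun_diff_right QR[OF Q(1)] QM G QR[OF G(1)])
  ultimately show ?thesis using LP unfolding L_def by (intro that[of P n G])
qed

section \<open>The resolvent of a compact operator\<close>

definition seq_compact_op :: "('a::complex_normed_vector \<Rightarrow>\<^sub>C\<^sub>L 'b::complex_normed_vector) \<Rightarrow> bool" where
  "seq_compact_op A \<longleftrightarrow>
    (\<forall>X. bounded (range X) \<longrightarrow> (\<exists>r l. strict_mono r \<and> (\<lambda>n. A (X (r n :: nat))) \<longlonglongrightarrow> l))"

lemma compact_op_imp_seq_compact: "compact_op A \<Longrightarrow> seq_compact_op A"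
  unfolding seq_compact_op_def by (intro allI impI) (elim compact_op_convergent_subseq, auto)

lemma seq_compact_op_compose_right:
  assumes "seq_compact_op A"
  shows "seq_compact_op (A o\<^sub>C\<^sub>L S)"
  unfolding seq_compact_op_def
proof (intro allI impI)
  fix X :: "nat \<Rightarrow> 'c" assume "bounded (range X)"
  then have "bounded (range (\<lambda>n. cblinfun_apply S (X n)))" by (rule bounded_range_cblinfun)
  with assms show "\<exists>r l. strict_mono r \<and> (\<lambda>n. (A o\<^sub>C\<^sub>L S) (X (r n))) \<longlonglongrightarrow> l"
    unfolding seq_compact_op_def cblinfun_apply_compose by blast
qed

lemma seq_compact_op_compose_left:
  assumes "seq_compact_op A"
  shows "seq_compact_op (S o\<^sub>C\<^sub>L A)"
  unfolding seq_compact_op_def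
proof (intro allI impI)
  fix X :: "nat \<Rightarrow> 'a" assume "bounded (range X)"
  with assms obtain r l where "strict_mono r" "(\<lambda>n. A (X (r n))) \<longlonglongrightarrow> l"
    unfolding seq_compact_op_def by blast
  then have "strict_mono r" "(\<lambda>n. (S o\<^sub>C\<^sub>L A) (X (r n))) \<longlonglongrightarrow> S l"
    using tendsto_cblinfun_apply[OF tendsto_const] by auto
  then show "\<exists>r l. strict_mono r \<and> (\<lambda>n. (S o\<^sub>C\<^sub>L A) (X (r n))) \<longlonglongrightarrow> l" by blast
qed

lemma compact_perturbation_id_plus:
  assumes "seq_compact_op A"
  shows "compact_perturbation (id_cblinfun + c *\<^sub>C A)"
  unfolding compact_perturbation_def
proof (intro allI impI)
  fix X :: "nat \<Rightarrow> 'a" assume "bounded (range X)"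
  with assms obtain r l where r: "strict_mono r" "(\<lambda>n. A (X (r n))) \<longlonglongrightarrow> l"
    unfolding seq_compact_op_def by blast
  have "(\<lambda>n. (- c) *\<^sub>C A (X (r n))) \<longlonglongrightarrow> (- c) *\<^sub>C l" by (intro tendsto_scaleC tendsto_const r(2))
  with r(1) show "\<exists>r l. strict_mono r \<and> (\<lambda>n. X (r n) - (id_cblinfun + c *\<^sub>C A) (X (r n))) \<longlonglongrightarrow> l"
    by (auto simp: cblinfun_simps complex_vector.scale_minus_left)
qed

text \<open>R is \<open>A (1 + w A)\<close> to the power -1 on the second factor, written without an
  inverse; \<open>1 - w R\<close> is then the inverse of \<open>1 + w A\<close>.\<close>

definition resolvent_at :: "('a::complex_normed_vector endo) \<Rightarrow> complex \<Rightarrow> ('a endo) \<Rightarrow> bool" where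
  "resolvent_at A w R \<longleftrightarrow>
    (\<forall>x. R x + w *\<^sub>C A (R x) = A x) \<and> (\<forall>x. R x + w *\<^sub>C R (A x) = A x)"

lemma resolvent_at_unique:
  assumes "resolvent_at A w R" "resolvent_at A w R'"
  shows "R = R'"
proof (rule cblinfun_eqI)
  fix x
  have 1: "R x = A x - w *\<^sub>C A (R x)" using assms(1) by (simp add: resolvent_at_def eq_diff_eq)
  have "R' (A x) = R' (R x) + w *\<^sub>C R' (A (R x))"
    using assms(1) by (metis cblinfun_add_right cblinfun_scaleC_right resolvent_at_def)
  also have "\<dots> = A (R x)" using assms(2) by (simp add: resolvent_at_def)
  finally have "R' (A x) = A (R x)" .
  moreover have "R' x = A x - w *\<^sub>C R' (A x)" using assms(2) by (simp add: resolvent_at_def eq_diff_eq)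
  ultimately show "R x = R' x" using 1 by simp
qed

text \<open>W y is the fixed point of x -> y - t K x, a contraction with factor 1/2. The same
  estimate bounds W by 2 uniformly in t, as differentiability in t will require.\<close>

lemma inverse_near_id:
  fixes K :: "'a::chilbert_space endo"
  assumes "cmod t * norm K \<le> 1 / 2"
  obtains W :: "'a endo" where "\<And>x. W x + t *\<^sub>C K (W x) = x" "\<And>x. W x + t *\<^sub>C W (K x) = x" "norm W \<le> 2"
proof -
  have small: "norm (t *\<^sub>C K x) \<le> 1 / 2 * norm x" for x
  proof -
    have "norm (t *\<^sub>C K x) \<le> cmod t * (norm K * norm x)"
      unfolding norm_scaleC by (intro mult_left_mono norm_cblinfun) simp
    also have "\<dots> \<le> 1 / 2 * norm x"
      unfolding mult.assoc[symmetric] by (intro mult_right_mono assms) simp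
    finally show ?thesis .
  qed
  have bound: "norm x \<le> norm (x + t *\<^sub>C K x) * 2" for x
  proof -
    have "norm x \<le> norm (x + t *\<^sub>C K x) + norm (t *\<^sub>C K x)"
      using norm_triangle_ineq4[of "x + t *\<^sub>C K x" "t *\<^sub>C K x"] by simp
    then show ?thesis using small[of x] by simp
  qed
  have uniq: "x = y" if "x + t *\<^sub>C K x = y + t *\<^sub>C K y" for x y
  proof -
    have "x - y + t *\<^sub>C K (x - y) = (x + t *\<^sub>C K x) - (y + t *\<^sub>C K y)"
      by (simp add: cblinfun_diff_right complex_vector.scale_right_diff_distrib)
    then show ?thesis using bound[of "x - y"] that by simp
  qed
  have "\<exists>x. x + t *\<^sub>C K x = y" for y
  proof -
    have "\<exists>!x. y - t *\<^sub>C K x = x"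
    proof (rule banach_fix_type[of "1/2"])
      have "dist (y - t *\<^sub>C K x) (y - t *\<^sub>C K x') \<le> 1/2 * dist x x'" for x x'
      proof -
        have "(y - t *\<^sub>C K x) - (y - t *\<^sub>C K x') = t *\<^sub>C K (x' - x)"
          by (simp add: cblinfun_diff_right complex_vector.scale_right_diff_distrib)
        then show ?thesis unfolding dist_norm using small[of "x' - x"] by (simp add: norm_minus_commute)
      qed
      then show "\<forall>x x'. dist (y - t *\<^sub>C K x) (y - t *\<^sub>C K x') \<le> 1/2 * dist x x'" by blast
    qed auto
    then obtain x where "y - t *\<^sub>C K x = x" by blast
    then have "x + t *\<^sub>C K x = y" by (metis diff_add_cancel)
    then show ?thesis by blast
  qed
  then obtain g where g: "\<And>y. g y + t *\<^sub>C K (g y) = y" by metis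
  have g2: "g (x + t *\<^sub>C K x) = x" for x by (rule uniq) (rule g)
  have "g (x + y) = g x + g y" for x y
  proof (rule uniq)
    have "g x + g y + t *\<^sub>C K (g x + g y) = (g x + t *\<^sub>C K (g x)) + (g y + t *\<^sub>C K (g y))"
      by (simp add: cblinfun_add_right scaleC_add_right)
    then show "g (x + y) + t *\<^sub>C K (g (x + y)) = g x + g y + t *\<^sub>C K (g x + g y)" by (simp only: g)
  qed
  moreover have "g (c *\<^sub>C x) = c *\<^sub>C g x" for c x
  proof (rule uniq)
    have "c *\<^sub>C g x + t *\<^sub>C K (c *\<^sub>C g x) = c *\<^sub>C (g x + t *\<^sub>C K (g x))"
      by (simp add: cblinfun_scaleC_right scaleC_add_right scaleC_scaleC mult.commute)
    then show "g (c *\<^sub>C x) + t *\<^sub>C K (g (c *\<^sub>C x)) = c *\<^sub>C g x + t *\<^sub>C K (c *\<^sub>C g x)" by (simp only: g)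
  qed
  moreover have ng: "norm (g x) \<le> norm x * 2" for x using bound[of "g x"] by (simp only: g)
  ultimately obtain W :: "'a endo" where W: "cblinfun_apply W = g"
    by (rule cblinfun_of_function)
  show ?thesis
  proof (rule that[of W])
    show "W x + t *\<^sub>C K (W x) = x" for x by (simp only: W g)
    show "W x + t *\<^sub>C W (K x) = x" for x
      using g2[of x] unfolding W[symmetric] by (simp add: cblinfun_add_right cblinfun_scaleC_right)
    show "norm W \<le> 2" using ng by (intro norm_cblinfun_bound) (simp_all add: W mult.commute)
  qed
qed

section \<open>Vector-valued holomorphic functions\<close>

lemma vholomorphic_on_subset: "vholomorphic_on g T \<Longrightarrow> S \<subseteq> T \<Longrightarrow> vholomorphic_on g S"
  unfolding vholomorphic_on_def by (meson has_derivative_subset subsetD)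

lemma vholomorphic_on_cong:
  assumes "\<And>x. x \<in> S \<Longrightarrow> f x = g x"
  shows "vholomorphic_on f S \<longleftrightarrow> vholomorphic_on g S"
  unfolding vholomorphic_on_def using assms
  by (intro ball_cong refl ex_cong1 iffI) (erule (1) has_derivative_transform[rotated 2]; simp)+

lemma vholomorphic_on_local:
  assumes "\<And>p. p \<in> S \<Longrightarrow> \<exists>e>0. vholomorphic_on g (ball p e)"
  shows "vholomorphic_on g S"
  unfolding vholomorphic_on_def
proof
  fix p assume "p \<in> S"
  then obtain e where e: "e > 0" "vholomorphic_on g (ball p e)" using assms by blast
  then obtain D where "(g has_derivative (\<lambda>h. h *\<^sub>C D)) (at p within ball p e)"
    unfolding vholomorphic_on_def by force
  then have "(g has_derivative (\<lambda>h. h *\<^sub>C D)) (at p)"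
    using e(1) by (simp add: at_within_open[of _ "ball p e"])
  then show "\<exists>D. (g has_derivative (\<lambda>h. h *\<^sub>C D)) (at p within S)"
    using has_derivative_at_withinI by blast
qed

lemma vholomorphic_on_const: "vholomorphic_on (\<lambda>s. C) S"
  unfolding vholomorphic_on_def by (auto intro!: exI[of _ 0])

lemma vholomorphic_on_add:
  assumes "vholomorphic_on f S" "vholomorphic_on g S"
  shows "vholomorphic_on (\<lambda>s. f s + g s) S"
  unfolding vholomorphic_on_def
proof
  fix s assume "s \<in> S"
  then obtain D E where "(f has_derivative (\<lambda>h. h *\<^sub>C D)) (at s within S)"
    "(g has_derivative (\<lambda>h. h *\<^sub>C E)) (at s within S)"
    using assms unfolding vholomorphic_on_def by blast
  from has_derivative_add[OF this]
  show "\<exists>D. ((\<lambda>s. f s + g s) has_derivative (\<lambda>h. h *\<^sub>C D)) (at s within S)"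
    by (intro exI[of _ "D + E"]) (simp add: scaleC_add_right)
qed

lemma vholomorphic_on_sum:
  "(\<And>i. i \<in> I \<Longrightarrow> vholomorphic_on (f i) S) \<Longrightarrow> vholomorphic_on (\<lambda>s. \<Sum>i\<in>I. f i s) S"
  by (induction I rule: infinite_finite_induct) (auto simp: vholomorphic_on_const vholomorphic_on_add)

lemma vholomorphic_on_scaleC:
  assumes "f holomorphic_on S" "vholomorphic_on g S"
  shows "vholomorphic_on (\<lambda>s. f s *\<^sub>C g s) S"
  unfolding vholomorphic_on_def
proof
  fix s assume "s \<in> S"
  then obtain d E where d: "(f has_field_derivative d) (at s within S)"
    and E: "(g has_derivative (\<lambda>h. h *\<^sub>C E)) (at s within S)"
    using assms unfolding vholomorphic_on_def holomorphic_on_def field_differentiable_def by blast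
  have "((\<lambda>s. f s *\<^sub>C g s) has_derivative (\<lambda>h. f s *\<^sub>C (h *\<^sub>C E) + (d * h) *\<^sub>C g s)) (at s within S)"
    by (rule bounded_bilinear.FDERIV[OF bounded_bilinear_scaleC _ E])
       (use d in \<open>simp add: has_field_derivative_def\<close>)
  then show "\<exists>D. ((\<lambda>s. f s *\<^sub>C g s) has_derivative (\<lambda>h. h *\<^sub>C D)) (at s within S)"
    by (intro exI[of _ "f s *\<^sub>C E + d *\<^sub>C g s"])
       (simp add: scaleC_add_right scaleC_scaleC mult.commute)
qed

lemma vholomorphic_on_linear:
  assumes "vholomorphic_on g S" "bounded_linear L" "\<And>c x. L (c *\<^sub>C x) = c *\<^sub>C L x"
  shows "vholomorphic_on (\<lambda>s. L (g s)) S"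
  unfolding vholomorphic_on_def
proof
  fix s assume "s \<in> S"
  then obtain D where "(g has_derivative (\<lambda>h. h *\<^sub>C D)) (at s within S)"
    using assms unfolding vholomorphic_on_def by blast
  from bounded_linear.has_derivative[OF assms(2) this]
  show "\<exists>D. ((\<lambda>s. L (g s)) has_derivative (\<lambda>h. h *\<^sub>C D)) (at s within S)"
    by (intro exI[of _ "L D"]) (simp add: assms(3))
qed

lemma vholomorphic_on_complex: "vholomorphic_on f S \<longleftrightarrow> f holomorphic_on S"
  unfolding vholomorphic_on_def holomorphic_on_def field_differentiable_def has_field_derivative_def
  by (simp add: scaleC_complex_def mult.commute)

lemma vholomorphic_on_imp_continuous_on: "vholomorphic_on g S \<Longrightarrow> continuous_on S g"
  unfolding vholomorphic_on_def continuous_on_eq_continuous_within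
  using has_derivative_continuous by blast

lemma vholomorphic_on_shift:
  assumes "vholomorphic_on g (ball 0 d)"
  shows "vholomorphic_on (\<lambda>s. g (s - a)) (ball a d)"
  unfolding vholomorphic_on_def
proof
  fix s assume s: "s \<in> ball a d"
  then have "s - a \<in> ball 0 d" by (simp add: dist_norm norm_minus_commute)
  then obtain D where "(g has_derivative (\<lambda>h. h *\<^sub>C D)) (at (s - a) within ball 0 d)"
    using assms unfolding vholomorphic_on_def by blast
  then have "(g has_derivative (\<lambda>h. h *\<^sub>C D)) (at (s - a))"
    using \<open>s - a \<in> ball 0 d\<close> by (simp add: at_within_open[of _ "ball 0 d"])
  moreover have "((\<lambda>s. s - a) has_derivative (\<lambda>h. h)) (at s within ball a d)"
    by (auto intro!: derivative_eq_intros)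
  ultimately show "\<exists>D. ((\<lambda>s. g (s - a)) has_derivative (\<lambda>h. h *\<^sub>C D)) (at s within ball a d)"
    using has_derivative_compose[of "\<lambda>s. s - a" "\<lambda>h. h" s "ball a d" g] by blast
qed

text \<open>The identity \<open>W t' - W t = (t - t') W t' K W t\<close> and the uniform bound make
  W Lipschitz. Inserting this into the identity once more gives the derivative
  \<open>- W t K W t\<close>.\<close>

lemma vholomorphic_on_inverse_family:
  fixes K :: "'a::chilbert_space endo" and W :: "complex \<Rightarrow> 'a endo"
  assumes W: "\<And>t x. t \<in> S \<Longrightarrow> W t x + t *\<^sub>C K (W t x) = x"
      "\<And>t x. t \<in> S \<Longrightarrow> W t x + t *\<^sub>C W t (K x) = x" "\<And>t. t \<in> S \<Longrightarrow> norm (W t) \<le> c"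
  shows "vholomorphic_on W S"
proof -
  have diff: "W t' - W t = (t - t') *\<^sub>C (W t' o\<^sub>C\<^sub>L K o\<^sub>C\<^sub>L W t)" if "t \<in> S" "t' \<in> S" for t t'
  proof (rule cblinfun_eqI)
    fix x
    define y where "y = W t x"
    have x: "x = y + t *\<^sub>C K y" using W(1)[OF that(1)] by (simp add: y_def)
    have "W t' x = W t' y + t *\<^sub>C W t' (K y)" by (simp add: x cblinfun_simps)
    moreover have "y = W t' y + t' *\<^sub>C W t' (K y)" using W(2)[OF that(2)] by simp
    ultimately have "W t' x - y = t *\<^sub>C W t' (K y) - t' *\<^sub>C W t' (K y)"
      by (metis add_diff_cancel_left)
    then show "(W t' - W t) x = ((t - t') *\<^sub>C (W t' o\<^sub>C\<^sub>L K o\<^sub>C\<^sub>L W t)) x"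
      by (simp add: cblinfun_simps complex_vector.scale_left_diff_distrib flip: y_def)
  qed
  show ?thesis
    unfolding vholomorphic_on_def
  proof
    fix t assume t: "t \<in> S"
    have c0: "c \<ge> 0" using W(3)[OF t] norm_ge_zero order_trans by blast
    define D where "D = - (W t o\<^sub>C\<^sub>L K o\<^sub>C\<^sub>L W t)"
    define k where "k = c * norm K * c"
    have lip: "norm (W t' - W t) \<le> cmod (t' - t) * k" if "t' \<in> S" for t'
    proof -
      have "norm (W t' o\<^sub>C\<^sub>L K o\<^sub>C\<^sub>L W t) \<le> norm (W t' o\<^sub>C\<^sub>L K) * norm (W t)" by (rule norm_cblinfun_compose)
      also have "\<dots> \<le> (norm (W t') * norm K) * norm (W t)"
        by (intro mult_right_mono norm_cblinfun_compose) simp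
      also have "\<dots> \<le> k" unfolding k_def
        using W(3)[OF t] W(3)[OF that] c0 by (intro mult_mono) auto
      finally show ?thesis
        unfolding diff[OF t that] norm_scaleC by (simp add: norm_minus_commute mult_left_mono)
    qed
    show "\<exists>D. (W has_derivative (\<lambda>h. h *\<^sub>C D)) (at t within S)"
    proof (rule exI[of _ D], rule has_derivativeI_sandwich[of 1])
      show "bounded_linear (\<lambda>h. h *\<^sub>C D)"
        by (rule bounded_bilinear.bounded_linear_left[OF bounded_bilinear_scaleC])
      define H where "H t' = cmod (t' - t) * k * (norm K * c)" for t'
      have "(H \<longlongrightarrow> cmod (t - t) * k * (norm K * c)) (at t within S)"
        unfolding H_def by (intro tendsto_intros)
      then show "(H \<longlongrightarrow> 0) (at t within S)" by simp
      show "norm (W t' - W t - (t' - t) *\<^sub>C D) / norm (t' - t) \<le> H t'"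
        if t': "t' \<in> S" "t' \<noteq> t" "dist t' t < 1" for t'
      proof -
        have "W t' - W t - (t' - t) *\<^sub>C D = (t - t') *\<^sub>C ((W t' - W t) o\<^sub>C\<^sub>L K o\<^sub>C\<^sub>L W t)"
        proof -
          have "(W t' - W t) o\<^sub>C\<^sub>L K o\<^sub>C\<^sub>L W t = (W t' o\<^sub>C\<^sub>L K o\<^sub>C\<^sub>L W t) - (W t o\<^sub>C\<^sub>L K o\<^sub>C\<^sub>L W t)"
            by (simp add: cblinfun_eq_iff cblinfun_simps)
          moreover have "(t' - t) *\<^sub>C D = (t - t') *\<^sub>C (W t o\<^sub>C\<^sub>L K o\<^sub>C\<^sub>L W t)"
            unfolding D_def
            by (metis complex_vector.scale_minus_left complex_vector.scale_minus_right minus_diff_eq)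
          ultimately show ?thesis
            using diff[OF t t'(1)] by (simp add: complex_vector.scale_right_diff_distrib)
        qed
        moreover have "norm ((W t' - W t) o\<^sub>C\<^sub>L K o\<^sub>C\<^sub>L W t) \<le> H t'"
        proof -
          have "norm ((W t' - W t) o\<^sub>C\<^sub>L K o\<^sub>C\<^sub>L W t) \<le> norm ((W t' - W t) o\<^sub>C\<^sub>L K) * norm (W t)"
            by (rule norm_cblinfun_compose)
          also have "\<dots> \<le> (norm (W t' - W t) * norm K) * norm (W t)"
            by (intro mult_right_mono norm_cblinfun_compose) simp
          also have "\<dots> \<le> ((cmod (t' - t) * k) * norm K) * c"
            using W(3)[OF t] lip[OF t'(1)] c0 by (intro mult_mono) (auto simp: k_def)
          finally show ?thesis by (simp add: H_def mult_ac)
        qed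
        ultimately show ?thesis
          using t'(2) by (simp add: norm_scaleC norm_minus_commute)
      qed
    qed simp
  qed
qed

text \<open>The Laurent expansion of the resolvent of \<open>A\<close> at \<open>w\<close>. On the range of the Riesz projection
  \<open>P\<close> the operator \<open>A\<close> is invertible and \<open>N\<close> is the nilpotent part of its inverse there,
  \<open>A\<^sup>-\<^sup>1 = N - w\<close>, so the resolvent at \<open>w + t\<close> restricts to \<open>(t + N)\<^sup>-\<^sup>1\<close>.\<close>

lemma resolvent_laurent:
  fixes A :: "'a::chilbert_space endo"
  assumes A: "seq_compact_op A" and M_def: "M = id_cblinfun + w *\<^sub>C A"
  obtains P G N :: "'a endo" and H :: "complex \<Rightarrow> 'a endo" and n m :: nat and d :: real where
    "\<And>x. P (P x) = P x" "\<And>x. M (P x) = P (M x)" "\<And>x. cpow M n (P x) = 0"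
    "\<And>x. M (G x) = x - P x" "\<And>x. G (M x) = x - P x" "finite_dim (ran P)"
    "d > 0" "vholomorphic_on H (ball 0 d)"
    "\<And>t. t \<in> ball 0 d \<Longrightarrow> t \<noteq> 0 \<or> m = 0 \<Longrightarrow>
      resolvent_at A (w + t) ((\<Sum>k<m. ((- 1) ^ k / t ^ Suc k) *\<^sub>C (cpow N k o\<^sub>C\<^sub>L P)) + H t)"
    "m = 0 \<Longrightarrow> P = 0" "\<And>k. m = Suc k \<Longrightarrow> cpow N k o\<^sub>C\<^sub>L P \<noteq> 0"
proof -
  have cpM: "compact_perturbation M" unfolding M_def by (rule compact_perturbation_id_plus[OF A])
  obtain P G :: "'a endo" and n where PP: "\<And>x. P (P x) = P x" and MP: "\<And>x. M (P x) = P (M x)"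
    and nil: "\<And>x. cpow M n (P x) = 0" and MG: "\<And>x. M (G x) = x - P x" and GM: "\<And>x. G (M x) = x - P x"
    and GP: "\<And>x. G (P x) = 0" and PG: "\<And>x. P (G x) = 0" and finP: "finite_dim (ran P)"
    by (rule riesz_decomposition[OF cpM]) (rule that)
  have Mx: "M x = x + w *\<^sub>C A x" for x by (simp add: M_def cblinfun_simps)
  have "A (P x) = P (A x) \<and> A (G x) = G (A x)" for x
  proof (cases "w = 0")
    \<comment> \<open>For w = 0 the relation w A = M - 1 says nothing about A, but then M = 1, and
      nilpotency on the range of P forces P = 0.\<close>
    case True
    then have M1: "M = id_cblinfun" by (simp add: M_def cblinfun_eq_iff cblinfun_simps)
    have "cpow M k y = y" for k y by (induction k) (simp_all add: M1)
    then have "P y = 0" for y using nil[of y] by simp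
    then show ?thesis using MG M1 by simp
  next
    case False
    have "w *\<^sub>C A (P x) = w *\<^sub>C P (A x)" using MP[of x] by (simp add: Mx cblinfun_simps)
    moreover have "M (G x) = G (M x)" by (simp add: MG GM)
    then have "w *\<^sub>C A (G x) = w *\<^sub>C G (A x)" by (simp add: Mx cblinfun_simps)
    ultimately show ?thesis using False by simp
  qed
  then have AP: "A (P x) = P (A x)" and AG: "A (G x) = G (A x)" for x by blast+
  have MA: "M (A x) = A (M x)" for x by (simp add: Mx cblinfun_simps)
  \<comment> \<open>The finite Neumann series, inverse of 1 - M on the range of P.\<close>
  define S where "S = (\<Sum>k<n. cpow M k o\<^sub>C\<^sub>L P)"
  have Sx: "S x = (\<Sum>k<n. cpow M k (P x))" for x by (simp add: S_def cblinfun_sum_left)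
  have SM: "S (M x) = M (S x)" for x
    by (simp add: Sx cblinfun_sum_right cpow_self_commute flip: MP)
  have SA: "S (A x) = A (S x)" for x
    by (simp add: Sx cblinfun_sum_right cpow_commute_apply[of M A, OF MA] flip: AP)
  have PS: "P (S x) = S x" for x
    by (simp add: Sx cblinfun_sum_right PP cpow_commute_apply[of M P, OF MP, symmetric])
  have SP: "S (P x) = S x" for x by (simp add: Sx PP)
  have S_inv: "S x - M (S x) = P x" for x
  proof -
    have "S x - M (S x) = (\<Sum>k<n. cpow M k (P x) - cpow M (Suc k) (P x))"
      by (simp add: Sx cblinfun_sum_right sum_subtractf)
    also have "\<dots> = P x - cpow M n (P x)"
      using sum_lessThan_telescope'[of "\<lambda>k. cpow M k (P x)" n] by (simp del: cpow_simps(2))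
    finally show ?thesis by (simp add: nil)
  qed
  \<comment> \<open>On the range of P, w A = M - 1 has the inverse - S, so A has the inverse - w S
    there. Adding w and using S - M S = P turns this into - w M S.\<close>
  define N where "N = (- w) *\<^sub>C (M o\<^sub>C\<^sub>L S)"
  have Nx: "N x = (- w) *\<^sub>C M (S x)" for x by (simp add: N_def cblinfun_simps)
  have AN: "A (N x) = M (P x)" for x
  proof -
    have "A (N x) = M (S x) - M (M (S x))"
      by (simp add: Nx cblinfun_simps Mx[of "M (S x)"] complex_vector.scale_minus_left)
    also have "\<dots> = M (S x - M (S x))" by (simp add: cblinfun_simps)
    finally show ?thesis by (simp add: S_inv)
  qed
  have PN: "P (N x) = N x" for x by (simp add: Nx cblinfun_simps PS flip: MP)
  have NA: "N (A x) = A (N x)" for x by (simp add: Nx cblinfun_simps SA MA)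
  have NP: "N (P x) = N x" for x by (simp add: Nx SP)
  have N_pow: "cpow N k x = ((- w) ^ k) *\<^sub>C cpow S k (cpow M k x)" for k x
  proof (induction k)
    case (Suc k)
    define Z where "Z = cpow S k (cpow M k x)"
    have "cpow S (Suc k) (cpow M (Suc k) x) = M (S Z)"
      by (simp add: Z_def cpow_commute_apply[of S M, OF SM] SM)
    moreover have "cpow N (Suc k) x = N ((- w) ^ k *\<^sub>C Z)" using Suc by (simp add: Z_def)
    then have "cpow N (Suc k) x = (- w) ^ k *\<^sub>C ((- w) *\<^sub>C M (S Z))"
      by (simp only: cblinfun_scaleC_right Nx)
    ultimately show ?case by (simp only: scaleC_scaleC power_Suc mult.commute)
  qed (simp add: scaleC_one)
  have "cpow N n o\<^sub>C\<^sub>L P = 0" by (rule cblinfun_eqI) (simp add: N_pow nil)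
  \<comment> \<open>The order of the pole. Minimality keeps the leading Laurent coefficient nonzero,
    and m = 0 means P = 0, when the expansion also holds at t = 0.\<close>
  define m where "m = (LEAST m. cpow N m o\<^sub>C\<^sub>L P = 0)"
  have m0: "cpow N m o\<^sub>C\<^sub>L P = 0" unfolding m_def by (rule LeastI) fact
  have m_least: "cpow N k o\<^sub>C\<^sub>L P \<noteq> 0" if "m = Suc k" for k
    using not_less_Least[of k "\<lambda>m. cpow N m o\<^sub>C\<^sub>L P = 0"] that by (simp add: m_def)
  \<comment> \<open>On the kernel of P, 1 + (w + t) A = M + t A factors as M (1 + t K). The radius d
    keeps t K of norm at most 1/2, and the added 1 covers K = 0.\<close>
  define K where "K = G o\<^sub>C\<^sub>L A"
  define d where "d = 1 / (2 * (norm K + 1))"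
  have d0: "d > 0" by (simp add: d_def add_nonneg_pos)
  have "\<exists>V. (\<forall>x. cblinfun_apply V x + t *\<^sub>C K (cblinfun_apply V x) = x) \<and>
      (\<forall>x. cblinfun_apply V x + t *\<^sub>C cblinfun_apply V (K x) = x) \<and> norm V \<le> 2"
    if "t \<in> ball 0 d" for t
  proof -
    have "cmod t * norm K \<le> d * (norm K + 1)" using that d0 by (intro mult_mono) auto
    also have "d * (norm K + 1) = 1 / 2"
      using norm_ge_zero[of K] by (simp add: d_def add_nonneg_eq_0_iff)
    finally show ?thesis by (rule inverse_near_id) blast
  qed
  then obtain V :: "complex \<Rightarrow> 'a endo" where V1: "\<And>t x. t \<in> ball 0 d \<Longrightarrow> V t x + t *\<^sub>C K (V t x) = x"
    and V2: "\<And>t x. t \<in> ball 0 d \<Longrightarrow> V t x + t *\<^sub>C V t (K x) = x"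
    and V3: "\<And>t. t \<in> ball 0 d \<Longrightarrow> norm (V t) \<le> 2"
    by metis
  have holV: "vholomorphic_on V (ball 0 d)" by (rule vholomorphic_on_inverse_family[OF V1 V2 V3])
  define H where "H t = A o\<^sub>C\<^sub>L (V t o\<^sub>C\<^sub>L G)" for t
  have Hx: "H t x = A (V t (G x))" for t x by (simp add: H_def)
  have holH: "vholomorphic_on H (ball 0 d)"
    unfolding H_def
    by (rule vholomorphic_on_linear[OF vholomorphic_on_linear[OF holV]])
       (auto intro: bounded_bilinear.bounded_linear_left[OF bounded_bilinear_cblinfun_compose]
         bounded_bilinear.bounded_linear_right[OF bounded_bilinear_cblinfun_compose]
         simp: cblinfun_eq_iff cblinfun_simps)
  define X where "X t = (\<Sum>k<m. ((- 1) ^ k / t ^ Suc k) *\<^sub>C (cpow N k o\<^sub>C\<^sub>L P))" for t :: complex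
  have Xx: "X t x = (\<Sum>k<m. ((- 1) ^ k / t ^ Suc k) *\<^sub>C cpow N k (P x))" for t x
    by (simp add: X_def cblinfun_sum_left cblinfun_simps)
  have PX: "P (X t x) = X t x" for t x
  proof -
    have "P (cpow N k (P y)) = cpow N k (P y)" for k y
      by (simp add: cpow_commute_apply[of N P, symmetric] NP PN PP)
    then show ?thesis by (simp add: Xx cblinfun_sum_right cblinfun_simps)
  qed
  have XA: "X t (A x) = A (X t x)" for t x
    by (simp add: Xx cblinfun_sum_right cblinfun_simps cpow_commute_apply[of N A, OF NA] flip: AP)
  \<comment> \<open>X t is the terminating geometric series for the inverse of t + N on the range of
    P; the sum telescopes and its last term carries the vanishing m-th power of N.\<close>
  have tX: "t *\<^sub>C X t x + N (X t x) = P x" if "t \<noteq> 0 \<or> m = 0" for t x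
  proof (cases "m = 0")
    case True
    then have "P = 0" using m0 by simp
    with True show ?thesis by (simp add: Xx)
  next
    case False
    with that have t: "t \<noteq> 0" by simp
    have "t *\<^sub>C X t x + N (X t x) = (\<Sum>k<m. ((- 1) ^ k / t ^ k) *\<^sub>C cpow N k (P x) -
        ((- 1) ^ Suc k / t ^ Suc k) *\<^sub>C cpow N (Suc k) (P x))"
      using t by (simp add: Xx cblinfun_sum_right complex_vector.scale_sum_right scaleC_scaleC
          cblinfun_simps sum.distrib[symmetric] complex_vector.scale_minus_left)
    also have "\<dots> = P x - ((- 1) ^ m / t ^ m) *\<^sub>C cpow N m (P x)"
      by (subst sum_lessThan_telescope'[of "\<lambda>k. ((- 1) ^ k / t ^ k) *\<^sub>C cpow N k (P x)"])
         (simp add: scaleC_one)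
    also have "cpow N m (P x) = 0" using m0 by (metis cblinfun_apply_compose cblinfun_apply_zero)
    finally show ?thesis by simp
  qed
  have X_res: "X t x + (w + t) *\<^sub>C A (X t x) = A (P x)" if "t \<noteq> 0 \<or> m = 0" for t x
  proof -
    have "X t x + (w + t) *\<^sub>C A (X t x) = M (X t x) + t *\<^sub>C A (X t x)"
      by (simp add: Mx scaleC_add_left)
    also have "M (X t x) = A (N (X t x))" by (simp add: AN PX)
    also have "A (N (X t x)) + t *\<^sub>C A (X t x) = A (P x)"
      by (simp add: cblinfun_simps add.commute flip: tX[OF that])
    finally show ?thesis .
  qed
  have VA: "V t (A x) = A (V t x)" if "t \<in> ball 0 d" for t x
  proof -
    have "A (V t x) = V t (A (V t x)) + t *\<^sub>C V t (K (A (V t x)))" using V2[OF that] by simp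
    also have "\<dots> = V t (A (V t x + t *\<^sub>C K (V t x)))" by (simp add: cblinfun_simps K_def AG)
    finally show ?thesis using V1[OF that] by simp
  qed
  have PV: "P (V t x) = P x" if "t \<in> ball 0 d" for t x
  proof -
    have "P (V t x) + t *\<^sub>C P (K (V t x)) = P x"
      using V1[OF that, of x] by (metis cblinfun_add_right cblinfun_scaleC_right)
    then show ?thesis by (simp add: K_def PG)
  qed
  have H_res: "H t x + (w + t) *\<^sub>C A (H t x) = A x - A (P x)" if t: "t \<in> ball 0 d" for t x
  proof -
    define y where "y = V t (G x)"
    have Py: "P y = 0" by (simp add: y_def PV[OF t] PG)
    have "M (y + t *\<^sub>C K y) = M y + t *\<^sub>C (A y - P (A y))"
      by (simp add: cblinfun_simps K_def MG)
    also have "P (A y) = 0" by (simp add: Py flip: AP)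
    finally have "M y + t *\<^sub>C A y = x - P x"
      using V1[OF t, of "G x"] by (simp add: MG flip: y_def)
    then have "A (M y + t *\<^sub>C A y) = A (x - P x)" by simp
    then show ?thesis by (simp add: Hx Mx cblinfun_simps scaleC_add_left add.assoc flip: y_def)
  qed
  have HA: "H t (A x) = A (H t x)" if "t \<in> ball 0 d" for t x
    by (simp add: Hx VA[OF that] flip: AG)
  have "resolvent_at A (w + t) (X t + H t)" if t: "t \<in> ball 0 d" "t \<noteq> 0 \<or> m = 0" for t
  proof -
    have *: "(X t + H t) x + (w + t) *\<^sub>C A ((X t + H t) x) = A x" for x
    proof -
      have "(X t + H t) x + (w + t) *\<^sub>C A ((X t + H t) x)
        = (X t x + (w + t) *\<^sub>C A (X t x)) + (H t x + (w + t) *\<^sub>C A (H t x))"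
        by (simp add: cblinfun_simps scaleC_add_right)
      then show ?thesis by (simp only: X_res[OF t(2)] H_res[OF t(1)]) simp
    qed
    moreover have "(X t + H t) (A x) = A ((X t + H t) x)" for x
      by (simp add: cblinfun_simps XA HA[OF t(1)])
    ultimately show ?thesis by (simp add: resolvent_at_def)
  qed
  then show ?thesis
    using m0 by (intro that[OF PP MP nil MG GM finP d0 holH _ _ m_least]) (simp_all add: X_def)
qed

section \<open>Residues of meromorphic extensions\<close>

lemma vholomorphic_at_imp_not_vpole:
  assumes "e > 0" "vholomorphic_on g (ball a e)"
  shows "\<not> vpole g a"
proof
  assume "vpole g a"
  then obtain n d h where n: "n > 0" and d: "d > 0" and h: "vholomorphic_on h (ball a d)" "h a \<noteq> 0"
    and eq: "\<And>s. s \<in> ball a d - {a} \<Longrightarrow> (s - a) ^ n *\<^sub>C g s = h s"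
    unfolding vpole_def by blast
  have "continuous (at a) h"
    using vholomorphic_on_imp_continuous_on[OF h(1)] d by (simp add: continuous_on_eq_continuous_at)
  then have "(h \<longlongrightarrow> h a) (at a)" by (simp add: isCont_def)
  moreover have "\<forall>\<^sub>F s in at a. h s = (s - a) ^ n *\<^sub>C g s"
    using d eq by (auto simp: eventually_at dist_commute intro!: exI[of _ d])
  ultimately have 1: "((\<lambda>s. (s - a) ^ n *\<^sub>C g s) \<longlongrightarrow> h a) (at a)" by (simp cong: tendsto_cong)
  have "continuous (at a) g"
    using vholomorphic_on_imp_continuous_on[OF assms(2)] assms(1) by (simp add: continuous_on_eq_continuous_at)
  then have "((\<lambda>s. (s - a) ^ n *\<^sub>C g s) \<longlongrightarrow> (a - a) ^ n *\<^sub>C g a) (at a)"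
    by (intro tendsto_scaleC tendsto_intros) (simp add: isCont_def)
  from tendsto_unique[OF _ 1 this] show False using h(2) n by (simp add: power_0_left)
qed

lemma vholomorphic_on_smaller_ball:
  assumes "vholomorphic_on g (ball a e)" "p \<in> ball a e"
  obtains e' where "e' > 0" "vholomorphic_on g (ball p e')"
  using assms vholomorphic_on_subset openE[OF open_ball assms(2)] by metis

text \<open>Poles are isolated, so the choice in \<open>small_radius\<close> has a witness.\<close>

lemma vmeromorphic_punctured:
  assumes "vmeromorphic g"
  obtains d where "d > 0" "\<And>s. s \<in> ball a d - {a} \<Longrightarrow> \<not> vpole g s"
proof (cases "vpole g a")
  case False
  then obtain d where "d > 0" "vholomorphic_on g (ball a d)"
    using assms unfolding vmeromorphic_def by blast
  then show ?thesis
    using that vholomorphic_on_smaller_ball vholomorphic_at_imp_not_vpole by (metis DiffD1)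
next
  case True
  then obtain n d h where n: "n > 0" and d: "d > 0" and h: "vholomorphic_on h (ball a d)" "h a \<noteq> 0"
    and eq: "\<And>s. s \<in> ball a d - {a} \<Longrightarrow> (s - a) ^ n *\<^sub>C g s = h s"
    unfolding vpole_def by blast
  have "vholomorphic_on (\<lambda>s. inverse ((s - a) ^ n) *\<^sub>C h s) (ball a d - {a})"
    by (intro vholomorphic_on_scaleC vholomorphic_on_subset[OF h(1)] holomorphic_intros) auto
  moreover have "g s = inverse ((s - a) ^ n) *\<^sub>C h s" if "s \<in> ball a d - {a}" for s
    using that by (simp add: scaleC_scaleC scaleC_one flip: eq[OF that])
  ultimately have hol: "vholomorphic_on g (ball a d - {a})"
    using vholomorphic_on_cong by (metis (no_types, lifting))
  have "\<not> vpole g s" if s: "s \<in> ball a d - {a}" for s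
  proof -
    have "open (ball a d - {a})" by (simp add: open_delete)
    then obtain e where "e > 0" "ball s e \<subseteq> ball a d - {a}" using s by (metis openE)
    then show ?thesis using vholomorphic_at_imp_not_vpole vholomorphic_on_subset[OF hol] by blast
  qed
  with d show ?thesis by (rule that)
qed

lemma residue_principal_part:
  "residue (\<lambda>s. \<Sum>k<m. c k / (s - z) ^ Suc k) z = (if m = 0 then 0 else c 0)"
proof (induction m)
  case 0
  show ?case using residue_const[of 0 z] by simp
next
  case (Suc m)
  have "residue (\<lambda>s. (\<Sum>k<m. c k / (s - z) ^ Suc k) + c m / (s - z) ^ Suc m) z
      = residue (\<lambda>s. \<Sum>k<m. c k / (s - z) ^ Suc k) z + residue (\<lambda>s. c m / (s - z) ^ Suc m) z"
    by (rule residue_add[of UNIV]) (auto intro!: holomorphic_intros)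
  also have "residue (\<lambda>s. c m / (s - z) ^ Suc m) z = (deriv ^^ m) (\<lambda>_. c m) z / fact m"
    by (rule residue_holomorphic_over_power[of UNIV]) auto
  also have "(deriv ^^ m) (\<lambda>_. c m) z = (if m = 0 then c m else 0)" by simp
  finally show ?case using Suc by auto
qed

text \<open>Matrix coefficients are bounded linear functionals, so they commute with the integral
  and reduce it to the scalar residue theorem. The radius is a choice, about which only the absence
  of other poles in the closed disc is known.\<close>

theorem vresidue_weak:
  fixes g :: "complex \<Rightarrow> 'a::chilbert_space endo"
  assumes "vmeromorphic g"
  shows "cinner x (vresidue g a y) = residue (\<lambda>s. cinner x (g s y)) a"
proof -
  define L where "L T = cinner x (cblinfun_apply T y)" for T :: "'a endo"
  have bl: "bounded_linear L" unfolding L_def by (rule bounded_linear_matrix_coefficient)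
  have Lc: "L (c *\<^sub>C T) = c * L T" for c T by (simp add: L_def cblinfun_simps cinner_simps)
  define S where "S = {p. \<exists>e>0. vholomorphic_on g (ball p e)}"
  have "open S"
    unfolding open_contains_ball
  proof
    fix p assume "p \<in> S"
    then obtain e where e: "e > 0" "vholomorphic_on g (ball p e)" unfolding S_def by blast
    then have "ball p e \<subseteq> S" unfolding S_def using vholomorphic_on_smaller_ball[OF e(2)] by blast
    with e(1) show "\<exists>e>0. ball p e \<subseteq> S" by blast
  qed
  have notS: "p \<in> S" if "\<not> vpole g p" for p
    using that assms unfolding vmeromorphic_def S_def by blast
  have holg: "vholomorphic_on g S"
    by (rule vholomorphic_on_local) (simp add: S_def)
  define r where "r = small_radius g a"
  obtain d where d: "d > 0" "\<And>s. s \<in> ball a d - {a} \<Longrightarrow> \<not> vpole g s"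
    using vmeromorphic_punctured[OF assms] by blast
  have "0 < d / 2 \<and> (\<forall>s\<in>cball a (d / 2) - {a}. \<not> vpole g s)" using d by auto
  then have "0 < r \<and> (\<forall>s\<in>cball a r - {a}. \<not> vpole g s)"
    unfolding r_def small_radius_def by (rule someI)
  then have r: "0 < r" "\<And>s. s \<in> cball a r - {a} \<Longrightarrow> \<not> vpole g s" by auto
  then have sub: "cball a r - {a} \<subseteq> S" using notS by blast
  \<comment> \<open>The residue theorem needs an open set around the closed disc: S supplies the
    boundary circle, the ball supplies the interior with its possible pole a.\<close>
  define U where "U = S \<union> ball a r"
  have "open U" "a \<in> U" using \<open>open S\<close> r(1) by (auto simp: U_def)
  moreover have "cball a r \<subseteq> U" "U - {a} \<subseteq> S"
    using sub \<open>a \<in> U\<close> ball_subset_cball[of a r] unfolding U_def by blast+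
  ultimately have U: "open U" "a \<in> U" "cball a r \<subseteq> U" "U - {a} \<subseteq> S" by blast+
  have "(\<lambda>s. L (g s)) holomorphic_on S"
    using vholomorphic_on_linear[OF holg bl] by (simp add: Lc scaleC_complex_def vholomorphic_on_complex)
  then have "((\<lambda>s. L (g s)) has_contour_integral 2 * pi * \<i> * residue (\<lambda>s. L (g s)) a) (circlepath a r)"
    using U r(1) by (intro base_residue[of U]) (auto intro: holomorphic_on_subset)
  then have 1: "((\<lambda>t. L (g (circlepath a r t)) * vector_derivative (circlepath a r) (at t within {0..1}))
      has_integral 2 * pi * \<i> * residue (\<lambda>s. L (g s)) a) {0..1}"
    by (simp add: has_contour_integral_def)
  define q where "q t = vector_derivative (circlepath a r) (at t within {0..1}) *\<^sub>C g (circlepath a r t)" for t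
  have q_eq: "q t = (2 * pi * \<i> * r * exp (2 * of_real pi * \<i> * t)) *\<^sub>C g (circlepath a r t)"
    if "t \<in> {0..1}" for t
    using that by (simp add: q_def vector_derivative_circlepath01)
  have "circlepath a r t \<in> S" if "t \<in> {0..1}" for t
  proof -
    have "circlepath a r t \<in> path_image (circlepath a r)" using that by (simp add: path_image_def)
    then have "dist a (circlepath a r t) = r" using r(1) by simp
    then show ?thesis using sub r(1) by auto
  qed
  moreover have "continuous_on {0..1} (circlepath a r)"
    using path_circlepath[of a r] unfolding path_def .
  ultimately have "continuous_on {0..1} (\<lambda>t. g (circlepath a r t))"
    by (intro continuous_on_compose2[OF vholomorphic_on_imp_continuous_on[OF holg]]) auto
  then have "continuous_on {0..1} (\<lambda>t. (2 * pi * \<i> * r * exp (2 * of_real pi * \<i> * t)) *\<^sub>C g (circlepath a r t))"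
    by (intro bounded_bilinear.continuous_on[OF bounded_bilinear_scaleC] continuous_intros)
  then have "continuous_on {0..1} q" by (rule continuous_on_eq) (simp add: q_eq)
  then have "q integrable_on {0..1}" by (rule integrable_continuous_real)
  then have "(q has_integral vcontour_integral (circlepath a r) g) {0..1}"
    unfolding vcontour_integral_def q_def[symmetric] by (rule integrable_integral)
  from has_integral_linear[OF this bl]
  have "((\<lambda>t. L (q t)) has_integral L (vcontour_integral (circlepath a r) g)) {0..1}" by (simp add: o_def)
  moreover have "L (q t) = L (g (circlepath a r t)) * vector_derivative (circlepath a r) (at t within {0..1})" for t
    by (simp add: q_def Lc)
  ultimately have "L (vcontour_integral (circlepath a r) g) = 2 * pi * \<i> * residue (\<lambda>s. L (g s)) a"
    using 1 has_integral_unique by simp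
  then have "L (vresidue g a) = residue (\<lambda>s. L (g s)) a"
    by (simp add: vresidue_def Lc flip: r_def)
  then show ?thesis by (simp add: L_def)
qed

text \<open>The chosen extension g is known only on X, but the third hypothesis puts every real
  point with a resolvent into X. Near r0 the Laurent expansion provides resolvents, so g agrees with
  it on a real interval, hence on a connected punctured disc. The coefficient of the simple-pole
  term is the Riesz projection.\<close>

theorem riesz_projection_eq_vresidue:
  fixes A :: "'a::chilbert_space endo" and f :: "real \<Rightarrow> 'a endo"
  assumes A: "seq_compact_op A"
    and f: "\<And>r. r \<in> X \<Longrightarrow> resolvent_at A (complex_of_real (r - s)) (f r)"
    and X: "\<And>r R. resolvent_at A (complex_of_real (r - s)) R \<Longrightarrow> r \<in> X"
    and M_def: "M = id_cblinfun + complex_of_real (r0 - s) *\<^sub>C A"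
    and P_def: "P = vresidue (meromorphic_extension X f) (complex_of_real r0)"
  obtains G n where
    "\<And>x. P (P x) = P x" "\<And>x. M (P x) = P (M x)" "\<And>x. cpow M n (P x) = 0"
    "\<And>x. M (cblinfun_apply G x) = x - P x" "\<And>x. G (M x) = x - P x"
    "finite_dim (ran P)"
proof -
  \<comment> \<open>Witness that some meromorphic extension exists. Where no resolvent exists the
    description is arbitrary, which is harmless because \<open>vpole\<close> ignores the value at
    the pole.\<close>
  define g0 where "g0 w = (THE R. resolvent_at A (w - complex_of_real s) R)" for w
  have g0: "g0 w = R" if "resolvent_at A (w - complex_of_real s) R" for w R
    unfolding g0_def using that resolvent_at_unique by (intro the_equality) auto
  have "vmeromorphic g0"
    unfolding vmeromorphic_def
  proof
    fix a
    obtain P G N :: "'a endo" and H n m d where d: "d > 0" and H: "vholomorphic_on H (ball 0 d)"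
      and res: "\<And>t. t \<in> ball 0 d \<Longrightarrow> t \<noteq> 0 \<or> m = 0 \<Longrightarrow>
        resolvent_at A (a - complex_of_real s + t)
          ((\<Sum>k<m. ((- 1) ^ k / t ^ Suc k) *\<^sub>C (cpow N k o\<^sub>C\<^sub>L P)) + H t)"
      and lead: "\<And>k. m = Suc k \<Longrightarrow> cpow N k o\<^sub>C\<^sub>L P \<noteq> 0"
      by (rule resolvent_laurent[OF A refl, of "a - complex_of_real s"]) (rule that; assumption)
    have g0_eq: "g0 w = (\<Sum>k<m. ((- 1) ^ k / (w - a) ^ Suc k) *\<^sub>C (cpow N k o\<^sub>C\<^sub>L P)) + H (w - a)"
      if "w \<in> ball a d" "w \<noteq> a \<or> m = 0" for w
      using that by (intro g0) (use res[of "w - a"] in \<open>auto simp: dist_norm norm_minus_commute\<close>)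
    have H': "vholomorphic_on (\<lambda>w. H (w - a)) (ball a d)" by (rule vholomorphic_on_shift[OF H])
    show "(\<exists>\<rho>>0. vholomorphic_on g0 (ball a \<rho>)) \<or> vpole g0 a"
    proof (cases m)
      case 0
      then have "vholomorphic_on g0 (ball a d)"
        using vholomorphic_on_cong[of "ball a d" g0 "\<lambda>w. H (w - a)"] g0_eq H' by simp
      with d show ?thesis by blast
    next
      case (Suc j)
      \<comment> \<open>The Laurent expansion multiplied by the m-th power of w - a with the
        division carried out; m = Suc j leaves the exponent j - k, so at a only the leading term k =
        j survives.\<close>
      define h where "h w = (\<Sum>k<m. ((- 1) ^ k * (w - a) ^ (j - k)) *\<^sub>C (cpow N k o\<^sub>C\<^sub>L P))
          + (w - a) ^ m *\<^sub>C H (w - a)" for w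
      have "vholomorphic_on h (ball a d)"
        unfolding h_def
        by (intro vholomorphic_on_add vholomorphic_on_sum vholomorphic_on_scaleC vholomorphic_on_const H'
            holomorphic_intros)
      moreover have "h a \<noteq> 0"
      proof -
        have "h a = (\<Sum>k<m. if k = j then (- 1) ^ j *\<^sub>C (cpow N j o\<^sub>C\<^sub>L P) else 0)"
          unfolding h_def using Suc by (auto intro!: sum.cong simp: power_0_left)
        also have "\<dots> = (- 1) ^ j *\<^sub>C (cpow N j o\<^sub>C\<^sub>L P)" using Suc by simp
        finally show ?thesis using lead[OF Suc] by simp
      qed
      moreover have "(w - a) ^ m *\<^sub>C g0 w = h w" if "w \<in> ball a d - {a}" for w
      proof -
        have "(w - a) ^ m * ((- 1) ^ k / (w - a) ^ Suc k) = (- 1) ^ k * (w - a) ^ (j - k)" if "k < m" for k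
        proof -
          have "m = (j - k) + Suc k" using that Suc by simp
          then have "(w - a) ^ m = (w - a) ^ (j - k) * (w - a) ^ Suc k" by (metis power_add)
          then show ?thesis using \<open>w \<in> ball a d - {a}\<close> by simp
        qed
        then show ?thesis
          using that by (simp add: g0_eq h_def scaleC_add_right complex_vector.scale_sum_right scaleC_scaleC
              del: power_Suc)
      qed
      ultimately show ?thesis unfolding vpole_def using d Suc by blast
    qed
  qed
  moreover have "g0 (complex_of_real r) = f r" if "r \<in> X" for r
    using f[OF that] by (intro g0) simp
  ultimately have "\<exists>g. vmeromorphic g \<and> (\<forall>s\<in>X. g (complex_of_real s) = f s)" by blast
  define g where "g = meromorphic_extension X f"
  have g: "vmeromorphic g" "\<And>r. r \<in> X \<Longrightarrow> g (complex_of_real r) = f r"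
    using someI_ex[OF \<open>\<exists>g. _\<close>] unfolding g_def meromorphic_extension_def by blast+
  obtain P' G N :: "'a endo" and H n m d where P': "\<And>x. P' (P' x) = P' x" "\<And>x. M (P' x) = P' (M x)"
      "\<And>x. cpow M n (P' x) = 0" "\<And>x. M (G x) = x - P' x" "\<And>x. G (M x) = x - P' x"
      "finite_dim (ran P')"
    and d: "d > 0" and H: "vholomorphic_on H (ball 0 d)"
    and res: "\<And>t. t \<in> ball 0 d \<Longrightarrow> t \<noteq> 0 \<or> m = 0 \<Longrightarrow>
      resolvent_at A (complex_of_real (r0 - s) + t)
        ((\<Sum>k<m. ((- 1) ^ k / t ^ Suc k) *\<^sub>C (cpow N k o\<^sub>C\<^sub>L P')) + H t)"
    and m0: "m = 0 \<Longrightarrow> P' = 0"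
    by (rule resolvent_laurent[OF A M_def]) (rule that; assumption)
  define a where "a = complex_of_real r0"
  define Q where "Q w = (\<Sum>k<m. ((- 1) ^ k / (w - a) ^ Suc k) *\<^sub>C (cpow N k o\<^sub>C\<^sub>L P')) + H (w - a)" for w
  have resQ: "resolvent_at A (w - complex_of_real s) (Q w)" if "w \<in> ball a d - {a}" for w
    using that res[of "w - a"] by (auto simp: Q_def a_def dist_norm norm_minus_commute)
  have H': "vholomorphic_on (\<lambda>w. H (w - a)) (ball a d)" by (rule vholomorphic_on_shift[OF H])
  have holQ: "vholomorphic_on Q (ball a d - {a})"
    unfolding Q_def
    by (intro vholomorphic_on_add vholomorphic_on_sum vholomorphic_on_scaleC vholomorphic_on_const
        vholomorphic_on_subset[OF H'] holomorphic_intros) auto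
  obtain d' where d': "d' > 0" "\<And>s. s \<in> ball a d' - {a} \<Longrightarrow> \<not> vpole g s"
    using vmeromorphic_punctured[OF g(1)] by blast
  define e where "e = min d d'"
  have e: "e > 0" "ball a e \<subseteq> ball a d" "ball a e \<subseteq> ball a d'" using d d' by (auto simp: e_def)
  define B where "B = ball a e - {a}"
  have openB: "open B" by (simp add: B_def open_delete)
  have holg: "vholomorphic_on g B"
  proof (rule vholomorphic_on_local)
    fix p assume p: "p \<in> B"
    then have "\<not> vpole g p" using d' e by (auto simp: B_def)
    then show "\<exists>e>0. vholomorphic_on g (ball p e)"
      using g(1) unfolding vmeromorphic_def by blast
  qed
  have P_eq: "cinner x (P y) = cinner x (P' y)" for x y
  proof -
    define L where "L T = cinner x (cblinfun_apply T y)" for T :: "'a endo"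
    have bl: "bounded_linear L" unfolding L_def by (rule bounded_linear_matrix_coefficient)
    have Lc: "L (c *\<^sub>C T) = c *\<^sub>C L T" for c T
      by (simp add: L_def cblinfun_simps cinner_simps scaleC_complex_def)
    have L_hol: "(\<lambda>w. L (h w)) holomorphic_on T" if "vholomorphic_on h T" for h T
      using vholomorphic_on_linear[OF that bl Lc] by (simp add: vholomorphic_on_complex)
    have agree: "L (g w) = L (Q w)" if "w \<in> B" for w
    proof -
      have "L (g w) - L (Q w) = 0"
      \<comment> \<open>The accumulation point must lie inside the punctured disc, so it is a + e/2
        and not a itself.\<close>
      proof (rule analytic_continuation[of "\<lambda>w. L (g w) - L (Q w)" B "complex_of_real ` {r0<..<r0 + e}" "a + e / 2"])
        show "(\<lambda>w. L (g w) - L (Q w)) holomorphic_on B"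
          using e by (intro holomorphic_on_diff L_hol holg vholomorphic_on_subset[OF holQ]) (auto simp: B_def)
        show "connected B" unfolding B_def by (intro connected_open_delete) (auto simp: DIM_complex)
        show "complex_of_real ` {r0<..<r0 + e} \<subseteq> B"
          by (auto simp: B_def a_def dist_norm simp flip: of_real_diff)
        show "a + e / 2 \<in> B" using e(1) by (auto simp: B_def dist_norm)
        show "a + e / 2 islimpt complex_of_real ` {r0<..<r0 + e}"
          unfolding islimpt_approachable
        proof (intro allI impI)
          fix c :: real assume "c > 0"
          define u where "u = min (c / 2) (e / 4)"
          have u: "0 < u" "u < c" "u < e / 2" using \<open>c > 0\<close> e(1) by (auto simp: u_def)
          have "complex_of_real (r0 + e / 2 + u) - (a + e / 2) = complex_of_real u" by (simp add: a_def)
          then have "complex_of_real (r0 + e / 2 + u) \<noteq> a + e / 2"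
            "dist (complex_of_real (r0 + e / 2 + u)) (a + e / 2) < c"
            using u by (auto simp: dist_norm)
          then show "\<exists>z\<in>complex_of_real ` {r0<..<r0 + e}. z \<noteq> a + e / 2 \<and> dist z (a + e / 2) < c"
            using u e(1) by (intro bexI[of _ "complex_of_real (r0 + e / 2 + u)"] conjI imageI) auto
        qed
        show "L (g z) - L (Q z) = 0" if z: "z \<in> complex_of_real ` {r0<..<r0 + e}" for z
        proof -
          obtain r where r: "z = complex_of_real r" "r0 < r" "r < r0 + e" using z by auto
          have "z \<in> ball a d - {a}"
            using r e by (auto simp: a_def e_def dist_norm simp flip: of_real_diff)
          from resQ[OF this] have R: "resolvent_at A (complex_of_real (r - s)) (Q z)" by (simp add: r(1))
          then have "r \<in> X" by (rule X)
          then have "g z = Q z" using resolvent_at_unique[OF f R] g(2) r(1) by simp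
          then show ?thesis by simp
        qed
      qed (use openB that in auto)
      then show ?thesis by simp
    qed
    have "cinner x (P y) = residue (\<lambda>w. L (g w)) a"
      using vresidue_weak[OF g(1)] by (simp add: P_def L_def g_def a_def)
    also have "\<dots> = residue (\<lambda>w. L (Q w)) a"
      using e(1) agree by (intro residue_cong) (auto simp: eventually_at B_def dist_commute intro!: exI[of _ e])
    also have "(\<lambda>w. L (Q w)) = (\<lambda>w. (\<Sum>k<m. ((- 1) ^ k * L (cpow N k o\<^sub>C\<^sub>L P')) / (w - a) ^ Suc k) + L (H (w - a)))"
      by (simp add: Q_def linear_add[OF bounded_linear.linear[OF bl]] linear_sum[OF bounded_linear.linear[OF bl]]
          Lc scaleC_complex_def)
    also have "residue \<dots> a = residue (\<lambda>w. \<Sum>k<m. ((- 1) ^ k * L (cpow N k o\<^sub>C\<^sub>L P')) / (w - a) ^ Suc k) a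
        + residue (\<lambda>w. L (H (w - a))) a"
      using d L_hol[OF H'] by (intro residue_add[of "ball a d"]) (auto intro!: holomorphic_intros intro: holomorphic_on_subset)
    also have "residue (\<lambda>w. L (H (w - a))) a = 0"
      using d L_hol[OF H'] by (intro residue_holo[of "ball a d"]) auto
    also have "residue (\<lambda>w. \<Sum>k<m. ((- 1) ^ k * L (cpow N k o\<^sub>C\<^sub>L P')) / (w - a) ^ Suc k) a = L P'"
      using m0 by (subst residue_principal_part) (auto simp: L_def)
    finally show ?thesis by (simp add: L_def)
  qed
  have "P = P'" by (rule cblinfun_eqI, rule cinner_extI, rule P_eq)
  then show ?thesis using that P' by blast
qed

section \<open>Boundary values of the sandwiched resolvent\<close>

lemma eq_on_dense:
  fixes f g :: "'a::topological_space \<Rightarrow> 'b::t2_space"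
  assumes "closure Z = UNIV" "continuous_on UNIV f" "continuous_on UNIV g" "\<And>x. x \<in> Z \<Longrightarrow> f x = g x"
  shows "f x = g x"
proof -
  have "closure Z \<subseteq> {x. f x = g x}"
    by (rule closure_minimal) (use assms in \<open>auto intro: closed_Collect_eq\<close>)
  then show ?thesis using assms(1) by blast
qed

lemma continuous_on_cblinfun [continuous_intros]:
  "continuous_on S f \<Longrightarrow> continuous_on S (\<lambda>x. cblinfun_apply T (f x))"
  by (rule bounded_linear.continuous_on[OF bounded_linear_cblinfun_apply])

lemmas continuous_on_cinner [continuous_intros] =
  bounded_bilinear.continuous_on[OF bounded_bilinear_cinner]

lemma cblinfun_eq_on_dense:
  assumes "closure Z = UNIV" "\<And>x. x \<in> Z \<Longrightarrow> cblinfun_apply S x = cblinfun_apply T x"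
  shows "S = T"
  by (rule cblinfun_eqI, rule eq_on_dense[OF assms(1)]) (auto intro!: continuous_intros simp: assms(2))

lemma op_adjointI: "(\<And>u v. (u, v) \<in> F \<Longrightarrow> cinner v y = cinner u x) \<Longrightarrow> (y, x) \<in> op_adjoint F"
  unfolding op_adjoint_def by blast

lemma op_adjointD: "(y, x) \<in> op_adjoint F \<Longrightarrow> (u, v) \<in> F \<Longrightarrow> cinner v y = cinner u x"
  unfolding op_adjoint_def by blast

lemma op_adjoint_add:
  assumes "(x, a) \<in> op_adjoint F" "(y, b) \<in> op_adjoint F"
  shows "(x + y, a + b) \<in> op_adjoint F"
  by (rule op_adjointI)
     (simp add: cinner_add_right op_adjointD[OF assms(1)] op_adjointD[OF assms(2)])

lemma op_adjoint_scaleC: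
  assumes "(x, a) \<in> op_adjoint F"
  shows "(c *\<^sub>C x, c *\<^sub>C a) \<in> op_adjoint F"
  by (rule op_adjointI) (simp add: cinner_scaleC_right op_adjointD[OF assms])

lemma op_plusI: "(x, y) \<in> G \<Longrightarrow> (x, z) \<in> K \<Longrightarrow> (x, y + z) \<in> op_plus G K"
  unfolding op_plus_def by blast

lemma op_scaleI: "(x, y) \<in> G \<Longrightarrow> (x, c *\<^sub>C y) \<in> op_scale c G"
  unfolding op_scale_def by blast

text \<open>For y orthogonal to the domain of the adjoint, let q be the component of (0, y)
  orthogonal to the graph. Swapping q with a sign gives an element of the adjoint, so q is
  orthogonal to (0, y) and therefore 0. Thus (0, y) lies in the graph and y = 0.\<close>

lemma adjoint_densely_defined:
  fixes F :: "('h::chilbert_space \<times> 'k::chilbert_space) set"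
  assumes lin: "linear_operator F" and cl: "closed F"
  shows "closure (Domain (op_adjoint F)) = UNIV"
proof (rule dense_if_no_orthogonal_vector)
  show "csubspace (Domain (op_adjoint F))"
  proof (rule complex_vector.subspaceI)
    show "0 \<in> Domain (op_adjoint F)"
      by (rule DomainI[of _ 0]) (simp add: op_adjointI)
  qed (blast intro: op_adjoint_add op_adjoint_scaleC)+
next
  fix y assume orth: "\<And>z. z \<in> Domain (op_adjoint F) \<Longrightarrow> cinner z y = 0"
  have sub: "csubspace F"
    using lin unfolding linear_operator_def
    by (intro complex_vector.subspaceI) (auto simp: zero_prod_def scaleC_prod_def)
  obtain p where p: "p \<in> F" "\<And>z. z \<in> F \<Longrightarrow> cinner z ((0, y) - p) = 0"
    using orthogonal_decomposition[OF sub cl] by blast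
  define q where "q = (0, y) - p"
  have "(snd q, - fst q) \<in> op_adjoint F"
  proof (rule op_adjointI)
    fix u v assume "(u, v) \<in> F"
    then have "cinner (u, v) q = 0" using p(2) by (simp add: q_def)
    then show "cinner v (snd q) = cinner u (- fst q)"
      by (simp add: cinner_prod_def cinner_minus_right eq_neg_iff_add_eq_0 add.commute)
  qed
  then have "cinner (snd q) y = 0" using orth by blast
  then have "cinner q (0, y) = 0" by (simp add: cinner_prod_def)
  moreover have "cinner q p = 0" using p cinner_commute[of q p] by (simp add: q_def)
  moreover have "cinner q q = cinner q (0, y) - cinner q p"
    unfolding cinner_diff_right[symmetric] by (simp add: q_def)
  ultimately have "q = 0" by simp
  then have "(0, y) \<in> F" using p(1) by (simp add: q_def)
  then show "y = 0" using lin unfolding linear_operator_def single_valued_def by blast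
qed

text \<open>Total boundedness: a finite net for the image of the ball under a nearby
  \<open>T y\<close> also serves L. The error is at most a quarter of e each for the net, the
  operator distance and the closure.\<close>

lemma compact_op_limit:
  fixes T :: "real \<Rightarrow> 'a::complex_normed_vector \<Rightarrow>\<^sub>C\<^sub>L 'b::chilbert_space"
  assumes lim: "(T \<longlongrightarrow> L) G" and "G \<noteq> bot" and cpt: "\<forall>\<^sub>F y in G. compact_op (T y)"
  shows "compact_op L"
proof -
  define S where "S = cblinfun_apply L ` cball 0 1"
  have "\<exists>k. finite k \<and> closure S \<subseteq> (\<Union>x\<in>k. ball x e)" if "e > 0" for e
  proof -
    have e4: "e / 4 > 0" using that by simp
    have "\<forall>\<^sub>F y in G. dist (T y) L < e / 4" using tendstoD[OF lim, of "e / 4"] that by simp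
    with cpt have "\<forall>\<^sub>F y in G. compact_op (T y) \<and> dist (T y) L < e / 4" by (rule eventually_conj)
    then obtain y where y: "compact_op (T y)" "dist (T y) L < e / 4"
      using eventually_happens'[OF \<open>G \<noteq> bot\<close>] by blast
    obtain k where k: "finite k" "closure (cblinfun_apply (T y) ` cball 0 1) \<subseteq> (\<Union>x\<in>k. ball x (e / 4))"
      using y(1) e4 unfolding compact_op_def compact_eq_totally_bounded by blast
    have "closure S \<subseteq> (\<Union>x\<in>k. ball x e)"
    proof
      fix z assume "z \<in> closure S"
      then obtain w where "w \<in> S" "dist w z < e / 4"
        using e4 unfolding closure_approachable by blast
      then obtain v where v: "norm v \<le> 1" "dist (L v) z < e / 4" by (auto simp: S_def)
      have "T y v \<in> closure (cblinfun_apply (T y) ` cball 0 1)"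
        using v(1) by (intro subsetD[OF closure_subset]) auto
      then obtain x where x: "x \<in> k" "dist x (T y v) < e / 4" using k(2) by auto
      have "dist (T y v) (L v) \<le> norm (T y - L) * norm v"
        unfolding dist_norm cblinfun_apply_diff[symmetric] by (rule norm_cblinfun)
      also have "\<dots> \<le> norm (T y - L)" using v(1) by (simp add: mult_left_le)
      finally have "dist (T y v) (L v) < e / 4" using y(2) by (simp add: dist_norm)
      then have "dist x z < e"
        using x(2) v(2) dist_triangle[of x z "T y v"] dist_triangle[of "T y v" z "L v"] that by linarith
      then show "z \<in> (\<Union>x\<in>k. ball x e)" using x(1) by auto
    qed
    with k(1) show ?thesis by blast
  qed
  moreover have "complete (closure S)" by (simp add: complete_eq_closed)
  ultimately show ?thesis unfolding compact_op_def compact_eq_totally_bounded S_def by blast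
qed

text \<open>The Fredholm alternative: injectivity makes nilpotency on the range of P force P =
  0.\<close>

lemma injective_compact_perturbation_inverse:
  fixes M :: "'a::chilbert_space endo"
  assumes "compact_perturbation M" and inj: "\<And>x. M x = 0 \<Longrightarrow> x = 0"
  obtains C :: "'a endo" where "\<And>x. M (C x) = x"
proof -
  obtain P C :: "'a endo" and n where "\<And>x. cpow M n (P x) = 0" "\<And>x. M (C x) = x - P x"
    using assms(1) by (rule riesz_decomposition) (rule that; assumption)
  moreover have "y = 0" if "cpow M k y = 0" for k y
    using that by (induction k) (auto dest: inj)
  ultimately show ?thesis by (metis diff_zero that)
qed

locale resonance_line =
  fixes F :: "('h::chilbert_space \<times> 'k::chilbert_space) set"
    and J :: "'k endo"
    and V :: "('h \<times> 'h) set"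
    and H :: "real \<Rightarrow> ('h \<times> 'h) set"
    and D :: "'h set"
    and lam :: real
  assumes F_linear: "linear_operator F" and F_closed: "closed F"
    and J_selfadjoint: "selfadjoint_op J"
    and V_eq: "V = F O op_graph J O op_adjoint F" and V_selfadjoint: "selfadjoint V"
    and H_line: "\<And>r. H r = op_plus (H 0) (op_scale (complex_of_real r) V)"
    and H_selfadjoint: "\<And>r. selfadjoint (H r)"
    and H_domain: "\<And>r. Domain (H r) = D"
    and D_sub: "D \<subseteq> Domain F \<inter> Domain V"
    and V_compact: "\<And>r. relatively_compact V (H r)"
    and T_compact: "\<And>r z. Im z \<noteq> 0 \<Longrightarrow> \<exists>T. compact_op T \<and> sandwiched_graph F (H r) z \<subseteq> op_graph T"
begin

section \<open>The sandwiched resolvent at nonreal points\<close>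

abbreviation T_op :: "real \<Rightarrow> complex \<Rightarrow> 'k endo" where
  "T_op r z \<equiv> sandwiched F (H r) z"

abbreviation Z :: "'k set" where "Z \<equiv> Domain (op_adjoint F)"

lemma dense: "closure Z = UNIV"
  by (rule adjoint_densely_defined[OF F_linear F_closed])

lemma F_single: "(u, v) \<in> F \<Longrightarrow> (u, v') \<in> F \<Longrightarrow> v = v'"
  using F_linear unfolding linear_operator_def single_valued_def by blast

text \<open>Solvability of (H - z) u = x for every x is read off from relative compactness, since
  the product of V with the resolvent is defined everywhere.\<close>

lemma resolvent_witness:
  assumes "Im z \<noteq> 0"
  obtains u y v where "(u, y) \<in> H r" "y - z *\<^sub>C u = x" "(u, v) \<in> F"
proof -
  obtain T where "op_resolvent (H r) z O V = op_graph T"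
    using V_compact[of r] assms unfolding relatively_compact_def by blast
  moreover have "(x, T x) \<in> op_graph T" by (auto simp: op_graph_def)
  ultimately obtain u where "(x, u) \<in> op_resolvent (H r) z" by blast
  then obtain y where y: "(u, y) \<in> H r" "y - z *\<^sub>C u = x"
    by (auto simp: op_resolvent_def op_plus_def op_graph_def cblinfun_simps)
  then have "u \<in> Domain F" using H_domain D_sub by blast
  with y that show ?thesis by blast
qed

lemma sandwiched_graph_witness:
  assumes "(x, f) \<in> op_adjoint F" "(u, y) \<in> H r" "y - z *\<^sub>C u = f" "(u, v) \<in> F"
  shows "(x, v) \<in> sandwiched_graph F (H r) z"
proof -
  have "(f, u) \<in> op_resolvent (H r) z"
    using assms(2,3) by (force simp: op_resolvent_def op_plus_def op_graph_def cblinfun_simps)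
  then show ?thesis using assms(1,4) unfolding sandwiched_graph_def by blast
qed

text \<open>\<open>sandwiched\<close> is a definite description. Its graph is defined on the whole
  domain of the adjoint of F, which is dense, so the bounded extension is unique.\<close>

lemma T_op_spec:
  assumes "Im z \<noteq> 0"
  shows "compact_op (T_op r z)" "sandwiched_graph F (H r) z \<subseteq> op_graph (T_op r z)"
proof -
  obtain T where T: "compact_op T" "sandwiched_graph F (H r) z \<subseteq> op_graph T"
    using T_compact[OF assms] by blast
  have uniq: "S = T" if S: "sandwiched_graph F (H r) z \<subseteq> op_graph S" for S
  proof (rule cblinfun_eq_on_dense[OF dense])
    fix x assume "x \<in> Z"
    then obtain f where f: "(x, f) \<in> op_adjoint F" by blast
    obtain u y v where "(u, y) \<in> H r" "y - z *\<^sub>C u = f" "(u, v) \<in> F"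
      by (rule resolvent_witness[OF assms])
    with f have "(x, v) \<in> sandwiched_graph F (H r) z" by (rule sandwiched_graph_witness)
    with S T(2) have "(x, v) \<in> op_graph S" "(x, v) \<in> op_graph T" by blast+
    then show "S x = T x" by (auto simp: op_graph_def)
  qed
  have "T_op r z = T" unfolding sandwiched_def by (rule the_equality, rule T(2), rule uniq)
  with T show "compact_op (T_op r z)" "sandwiched_graph F (H r) z \<subseteq> op_graph (T_op r z)" by simp_all
qed

lemma T_op_eq:
  assumes "Im z \<noteq> 0" "(x, f) \<in> op_adjoint F" "(u, y) \<in> H r" "y - z *\<^sub>C u = f" "(u, v) \<in> F"
  shows "T_op r z x = v"
  using sandwiched_graph_witness[OF assms(2-5)] T_op_spec(2)[OF assms(1), of r]
  by (auto simp: op_graph_def)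

lemma H_symmetric: "(u, y) \<in> H r \<Longrightarrow> (u', y') \<in> H r \<Longrightarrow> cinner y' u = cinner u' y"
  using H_selfadjoint[of r] unfolding selfadjoint_def by (metis op_adjointD)

lemma T_op_adjoint:
  assumes "Im z \<noteq> 0"
  shows "cinner (T_op r z x') x = cinner x' (T_op r (cnj z) x)"
proof -
  have z': "Im (cnj z) \<noteq> 0" using assms by simp
  have dense_eq: "cinner (T_op r z x') x = cinner x' (T_op r (cnj z) x)" if x: "x' \<in> Z" "x \<in> Z" for x' x
  proof -
    obtain f f' where f: "(x, f) \<in> op_adjoint F" "(x', f') \<in> op_adjoint F" using x by blast
    obtain u y v where u: "(u, y) \<in> H r" "y - cnj z *\<^sub>C u = f" "(u, v) \<in> F"
      by (rule resolvent_witness[OF z'])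
    obtain u' y' v' where u': "(u', y') \<in> H r" "y' - z *\<^sub>C u' = f'" "(u', v') \<in> F"
      by (rule resolvent_witness[OF assms])
    have "cinner (T_op r z x') x = cinner v' x" using T_op_eq[OF assms f(2) u'] by simp
    also have "\<dots> = cinner u' y - cnj z * cinner u' u"
      using op_adjointD[OF f(1) u'(3)] by (simp add: cinner_simps flip: u(2))
    also have "\<dots> = cinner f' u"
      using H_symmetric[OF u(1) u'(1)] by (simp add: cinner_simps flip: u'(2))
    also have "\<dots> = cinner x' v"
      using op_adjointD[OF f(2) u(3)] by (metis cinner_commute)
    also have "v = T_op r (cnj z) x" using T_op_eq[OF z' f(1) u] by simp
    finally show ?thesis .
  qed
  have "cinner (T_op r z x') x = cinner x' (T_op r (cnj z) x)" if "x \<in> Z" for x' x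
    using dense_eq that
    by (rule_tac eq_on_dense[OF dense, of "\<lambda>x'. cinner (T_op r z x') x"]) (auto intro!: continuous_intros)
  then show ?thesis
    by (rule_tac eq_on_dense[OF dense, of "\<lambda>x. cinner (T_op r z x') x"]) (auto intro!: continuous_intros)
qed

text \<open>On the dense domain, with f the image of x under the adjoint of F and f = (H - z) u, the
  form \<open><x, T x>\<close> equals \<open><f, u>\<close>. Symmetry of H leaves Im z times the
  squared norm of u as its imaginary part.\<close>

lemma T_op_dissipative:
  assumes "Im z \<noteq> 0"
  shows "0 \<le> Im z * Im (cinner x (T_op r z x))"
proof -
  have "closure Z \<subseteq> {x. 0 \<le> Im z * Im (cinner x (T_op r z x))}"
  proof (rule closure_minimal)
    show "closed {x. 0 \<le> Im z * Im (cinner x (T_op r z x))}"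
      by (intro closed_Collect_le continuous_intros)
    show "Z \<subseteq> {x. 0 \<le> Im z * Im (cinner x (T_op r z x))}"
    proof
      fix x assume "x \<in> Z"
      then obtain f where f: "(x, f) \<in> op_adjoint F" by blast
      obtain u y v where u: "(u, y) \<in> H r" "y - z *\<^sub>C u = f" "(u, v) \<in> F"
        by (rule resolvent_witness[OF assms])
      have "cinner x (T_op r z x) = cinner x v" using T_op_eq[OF assms f u] by simp
      also have "\<dots> = cinner f u" using op_adjointD[OF f u(3)] by (metis cinner_commute)
      also have "\<dots> = cinner y u - cnj z * complex_of_real ((norm u)\<^sup>2)"
        by (simp add: cinner_simps cinner_self flip: u(2))
      finally have eq: "cinner x (T_op r z x) = cinner y u - cnj z * complex_of_real ((norm u)\<^sup>2)" .
      have "cinner y u = cnj (cinner y u)" using H_symmetric[OF u(1) u(1)] by (metis cinner_commute)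
      then have "Im (cinner y u) = 0" by (simp add: complex_eq_iff)
      then have "Im (cinner x (T_op r z x)) = Im z * (norm u)\<^sup>2" by (simp add: eq)
      then show "x \<in> {x. 0 \<le> Im z * Im (cinner x (T_op r z x))}"
        by (simp flip: mult.assoc)
    qed
  qed
  then show ?thesis using dense by blast
qed

text \<open>Both sides use the same u. If f = (H_s - z) u, then f + (r - s) V u = (H_r - z) u;
  moreover T_s x = F u, and V u is the adjoint of F applied to J F u.\<close>

lemma T_op_resolvent:
  assumes "Im z \<noteq> 0"
  shows "T_op r z (x + of_real (r - s) *\<^sub>C J (T_op s z x)) = T_op s z x"
proof (rule eq_on_dense[OF dense, of "\<lambda>x. T_op r z (x + of_real (r - s) *\<^sub>C J (T_op s z x))"])
  fix x assume "x \<in> Z"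
  then obtain f where f: "(x, f) \<in> op_adjoint F" by blast
  obtain u y v where u: "(u, y) \<in> H s" "y - z *\<^sub>C u = f" "(u, v) \<in> F"
    by (rule resolvent_witness[OF assms])
  have v: "T_op s z x = v" by (rule T_op_eq[OF assms f u])
  have "u \<in> Domain V" using u(1) H_domain D_sub by blast
  then obtain w where w: "(u, w) \<in> V" by blast
  then obtain v' where "(u, v') \<in> F" "(J v', w) \<in> op_adjoint F"
    unfolding V_eq op_graph_def by auto
  then have Jv: "(J v, w) \<in> op_adjoint F" using F_single[OF u(3)] by blast
  define c where "c = complex_of_real (r - s)"
  have 1: "(x + c *\<^sub>C J v, f + c *\<^sub>C w) \<in> op_adjoint F"
    by (intro op_adjoint_add op_adjoint_scaleC f Jv)
  obtain h w' where h: "(u, h) \<in> H 0" "(u, w') \<in> V" "y = h + of_real s *\<^sub>C w'"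
    using u(1) unfolding H_line[of s] op_plus_def op_scale_def by auto
  have "single_valued V" using V_selfadjoint by (simp add: selfadjoint_def linear_operator_def)
  then have "w' = w" using h(2) w by (rule single_valuedD)
  then have "(u, h + of_real r *\<^sub>C w) \<in> H r"
    unfolding H_line[of r] using h(1) w by (intro op_plusI op_scaleI)
  moreover have "h + of_real r *\<^sub>C w = y + c *\<^sub>C w"
    using h(3) \<open>w' = w\<close> by (simp add: c_def complex_vector.scale_left_diff_distrib)
  ultimately have 2: "(u, y + c *\<^sub>C w) \<in> H r" by simp
  have 3: "(y + c *\<^sub>C w) - z *\<^sub>C u = f + c *\<^sub>C w" using u(2) by (simp add: algebra_simps)
  show "T_op r z (x + of_real (r - s) *\<^sub>C J (T_op s z x)) = T_op s z x"
    using T_op_eq[OF assms 1 2 3 u(3)] by (simp add: v c_def)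
qed (intro continuous_intros bounded_linear.continuous_on[OF bounded_linear_scaleC])+

section \<open>Boundary values at nonresonant points, and a criterion for nonresonance\<close>

abbreviation X :: "real set" where "X \<equiv> nonresonant F H lam"

abbreviation T_bdry :: "real \<Rightarrow> real \<Rightarrow> 'k endo" where
  "T_bdry \<sigma> r \<equiv> sandwiched_bdry F (H r) lam \<sigma>"

lemma T_bdry_tendsto:
  assumes "r \<in> X" "\<sigma> \<in> {1, -1}"
  shows "((\<lambda>y. T_op r (Complex lam (\<sigma> * y))) \<longlongrightarrow> T_bdry \<sigma> r) (at_right 0)"
proof -
  obtain L where L: "((\<lambda>y. T_op r (Complex lam (\<sigma> * y))) \<longlongrightarrow> L) (at_right 0)"
    using assms unfolding nonresonant_def regular_points_def by blast
  then have "T_bdry \<sigma> r = L" unfolding sandwiched_bdry_def by (intro tendsto_Lim) simp_all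
  with L show ?thesis by simp
qed

lemma eventually_nonreal:
  assumes "\<sigma> \<in> {1, -1}"
  shows "\<forall>\<^sub>F y in at_right 0. Im (Complex lam (\<sigma> * y)) \<noteq> 0 \<and> 0 < y"
  by (rule eventually_mono[OF eventually_at_right_less]) (use assms in auto)

lemma T_bdry_tendsto_apply:
  assumes "r \<in> X" "\<sigma> \<in> {1, -1}"
  shows "((\<lambda>y. T_op r (Complex lam (\<sigma> * y)) x) \<longlongrightarrow> T_bdry \<sigma> r x) (at_right 0)"
  by (intro tendsto_cblinfun_apply T_bdry_tendsto assms tendsto_const)

lemma T_bdry_compact:
  assumes "r \<in> X" "\<sigma> \<in> {1, -1}"
  shows "compact_op (T_bdry \<sigma> r)"
  by (rule compact_op_limit[OF T_bdry_tendsto[OF assms]])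
     (auto intro!: eventually_mono[OF eventually_nonreal[OF assms(2)]] T_op_spec(1))

lemma T_bdry_adjoint:
  assumes "r \<in> X" "\<sigma> \<in> {1, -1}"
  shows "cinner (T_bdry \<sigma> r x) y = cinner x (T_bdry (- \<sigma>) r y)"
proof (rule tendsto_unique)
  show "((\<lambda>t. cinner (T_op r (Complex lam (\<sigma> * t)) x) y) \<longlongrightarrow> cinner (T_bdry \<sigma> r x) y) (at_right 0)"
    by (intro tendsto_cinner T_bdry_tendsto_apply assms tendsto_const)
  have "((\<lambda>t. cinner x (T_op r (Complex lam (- \<sigma> * t)) y)) \<longlongrightarrow> cinner x (T_bdry (- \<sigma>) r y)) (at_right 0)"
    using assms by (intro tendsto_cinner T_bdry_tendsto_apply tendsto_const) auto
  moreover have "\<forall>\<^sub>F t in at_right 0. cinner x (T_op r (Complex lam (- \<sigma> * t)) y)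
      = cinner (T_op r (Complex lam (\<sigma> * t)) x) y"
    using eventually_nonreal[OF assms(2)]
    by eventually_elim (simp add: T_op_adjoint complex_cnj)
  ultimately show "((\<lambda>t. cinner (T_op r (Complex lam (\<sigma> * t)) x) y) \<longlongrightarrow> cinner x (T_bdry (- \<sigma>) r y)) (at_right 0)"
    by (rule Lim_transform_eventually)
qed simp

lemma T_bdry_dissipative:
  assumes "r \<in> X" "\<sigma> \<in> {1, -1}"
  shows "0 \<le> \<sigma> * Im (cinner x (T_bdry \<sigma> r x))"
proof (rule tendsto_lowerbound)
  show "((\<lambda>t. \<sigma> * Im (cinner x (T_op r (Complex lam (\<sigma> * t)) x))) \<longlongrightarrow> \<sigma> * Im (cinner x (T_bdry \<sigma> r x))) (at_right 0)"
    by (intro tendsto_intros tendsto_cinner T_bdry_tendsto_apply assms)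
  show "\<forall>\<^sub>F t in at_right 0. 0 \<le> \<sigma> * Im (cinner x (T_op r (Complex lam (\<sigma> * t)) x))"
    using eventually_nonreal[OF assms(2)]
  proof eventually_elim
    case (elim t)
    then have "0 \<le> t * (\<sigma> * Im (cinner x (T_op r (Complex lam (\<sigma> * t)) x)))"
      using T_op_dissipative[of "Complex lam (\<sigma> * t)" x r] by (simp add: mult_ac)
    then show ?case using elim by (simp add: zero_le_mult_iff)
  qed
qed simp

lemma T_bdry_resolvent:
  assumes "r \<in> X" "s \<in> X" "\<sigma> \<in> {1, -1}"
  shows "T_bdry \<sigma> r (x + of_real (r - s) *\<^sub>C J (T_bdry \<sigma> s x)) = T_bdry \<sigma> s x"
proof (rule tendsto_unique)
  let ?T = "\<lambda>r t. T_op r (Complex lam (\<sigma> * t))"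
  show "((\<lambda>t. ?T s t x) \<longlongrightarrow> T_bdry \<sigma> s x) (at_right 0)"
    by (rule T_bdry_tendsto_apply[OF assms(2,3)])
  have "((\<lambda>t. ?T r t (x + of_real (r - s) *\<^sub>C J (?T s t x))) \<longlongrightarrow>
      T_bdry \<sigma> r (x + of_real (r - s) *\<^sub>C J (T_bdry \<sigma> s x))) (at_right 0)"
    by (intro tendsto_cblinfun_apply[OF T_bdry_tendsto] tendsto_add tendsto_scaleC
        tendsto_cblinfun_apply[OF tendsto_const] T_bdry_tendsto_apply tendsto_const assms)
  moreover have "\<forall>\<^sub>F t in at_right 0. ?T r t (x + of_real (r - s) *\<^sub>C J (?T s t x)) = ?T s t x"
    using eventually_nonreal[OF assms(3)] by eventually_elim (rule T_op_resolvent, simp)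
  ultimately show "((\<lambda>t. ?T s t x) \<longlongrightarrow>
      T_bdry \<sigma> r (x + of_real (r - s) *\<^sub>C J (T_bdry \<sigma> s x))) (at_right 0)"
    by (rule Lim_transform_eventually)
qed simp

text \<open>A right inverse C of \<open>1 + (r - s) J T_s\<close> at the boundary is almost one
  nearby: the resolvent identity becomes Tr y (1 + E y) = Ts y C with E y tending to 0. Hence Tr y
  stays bounded and converges to L C.\<close>

lemma regular_if_inverse:
  assumes s: "s \<in> X" and \<sigma>: "\<sigma> \<in> {1, -1}"
    and C: "\<And>x. cblinfun_apply C x + of_real (r - s) *\<^sub>C J (T_bdry \<sigma> s (cblinfun_apply C x)) = x"
  shows "\<exists>L. ((\<lambda>y. T_op r (Complex lam (\<sigma> * y))) \<longlongrightarrow> L) (at_right 0)"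
proof -
  define c where "c = complex_of_real (r - s)"
  define Ts where "Ts y = T_op s (Complex lam (\<sigma> * y))" for y
  define Tr where "Tr y = T_op r (Complex lam (\<sigma> * y))" for y
  define L where "L = T_bdry \<sigma> s"
  define E where "E y = c *\<^sub>C (J o\<^sub>C\<^sub>L ((Ts y - L) o\<^sub>C\<^sub>L C))" for y
  have Ts: "(Ts \<longlongrightarrow> L) (at_right 0)" unfolding Ts_def L_def by (rule T_bdry_tendsto[OF s \<sigma>])
  have TsC: "((\<lambda>y. Ts y o\<^sub>C\<^sub>L C) \<longlongrightarrow> L o\<^sub>C\<^sub>L C) (at_right 0)"
    by (intro tendsto_cblinfun_compose Ts tendsto_const)
  have "(E \<longlongrightarrow> c *\<^sub>C (J o\<^sub>C\<^sub>L ((L - L) o\<^sub>C\<^sub>L C))) (at_right 0)"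
    unfolding E_def by (intro tendsto_scaleC tendsto_cblinfun_compose tendsto_diff Ts tendsto_const)
  then have E: "((\<lambda>y. norm (E y)) \<longlongrightarrow> 0) (at_right 0)" by (simp add: tendsto_norm_zero)
  have eq: "\<forall>\<^sub>F y in at_right 0. Tr y = (Ts y o\<^sub>C\<^sub>L C) - (Tr y o\<^sub>C\<^sub>L E y)"
    using eventually_nonreal[OF \<sigma>]
  proof eventually_elim
    case (elim y)
    show ?case
    proof (rule cblinfun_eqI)
      fix x
      define a where "a = c *\<^sub>C J (Ts y (C x))"
      define b where "b = c *\<^sub>C J (L (C x))"
      have "E y x = a - b"
        by (simp add: E_def a_def b_def cblinfun_simps complex_vector.scale_right_diff_distrib)
      moreover have "C x + b = x" using C[of x] by (simp add: b_def c_def L_def)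
      ultimately have "x + E y x = C x + c *\<^sub>C J (Ts y (C x))"
        unfolding a_def[symmetric] by (metis add.assoc add.commute diff_add_cancel)
      then have "Tr y (x + E y x) = Ts y (C x)"
        using T_op_resolvent[of "Complex lam (\<sigma> * y)" r "C x" s] elim by (simp add: Tr_def Ts_def c_def)
      then show "Tr y x = ((Ts y o\<^sub>C\<^sub>L C) - (Tr y o\<^sub>C\<^sub>L E y)) x"
        by (simp add: cblinfun_simps eq_diff_eq)
    qed
  qed
  \<comment> \<open>When E y has norm below 1/2, Tr y is bounded by twice the norm of Ts y C, which
    eventually exceeds that of its limit by less than 1.\<close>
  define k where "k = 2 * (norm (L o\<^sub>C\<^sub>L C) + 1)"
  have "\<forall>\<^sub>F y in at_right 0. norm (E y) < 1 / 2" using E by (rule order_tendstoD) simp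
  moreover have "\<forall>\<^sub>F y in at_right 0. norm (Ts y o\<^sub>C\<^sub>L C) < norm (L o\<^sub>C\<^sub>L C) + 1"
    using tendsto_norm[OF TsC] by (rule order_tendstoD) simp
  ultimately have bound: "\<forall>\<^sub>F y in at_right 0. norm (Tr y - (L o\<^sub>C\<^sub>L C)) \<le>
      norm ((Ts y o\<^sub>C\<^sub>L C) - (L o\<^sub>C\<^sub>L C)) + k * norm (E y)"
    using eq
  proof eventually_elim
    case (elim y)
    have TE: "norm (Tr y o\<^sub>C\<^sub>L E y) \<le> norm (Tr y) * norm (E y)" by (rule norm_cblinfun_compose)
    have "norm (Tr y) \<le> norm (Ts y o\<^sub>C\<^sub>L C) + norm (Tr y o\<^sub>C\<^sub>L E y)"
      using norm_triangle_ineq4[of "Ts y o\<^sub>C\<^sub>L C" "Tr y o\<^sub>C\<^sub>L E y"] elim(3) by simp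
    also have "norm (Tr y o\<^sub>C\<^sub>L E y) \<le> norm (Tr y) * (1 / 2)"
      using TE mult_left_mono[of "norm (E y)" "1/2" "norm (Tr y)"] elim(1) by simp
    finally have "norm (Tr y) \<le> k" using elim(2) by (simp add: k_def)
    then have "norm (Tr y o\<^sub>C\<^sub>L E y) \<le> k * norm (E y)"
      using TE mult_right_mono[of "norm (Tr y)" k "norm (E y)"] by simp
    moreover have "Tr y - (L o\<^sub>C\<^sub>L C) = ((Ts y o\<^sub>C\<^sub>L C) - (L o\<^sub>C\<^sub>L C)) - (Tr y o\<^sub>C\<^sub>L E y)"
      using elim(3) by (simp add: algebra_simps)
    then have "norm (Tr y - (L o\<^sub>C\<^sub>L C)) \<le> norm ((Ts y o\<^sub>C\<^sub>L C) - (L o\<^sub>C\<^sub>L C)) + norm (Tr y o\<^sub>C\<^sub>L E y)"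
      by (metis norm_triangle_ineq4)
    ultimately show ?case by linarith
  qed
  have "((\<lambda>y. norm ((Ts y o\<^sub>C\<^sub>L C) - (L o\<^sub>C\<^sub>L C)) + k * norm (E y)) \<longlongrightarrow> 0 + k * 0) (at_right 0)"
    using TsC E by (intro tendsto_intros) (simp add: tendsto_norm_zero LIM_zero)
  then have "((\<lambda>y. Tr y - (L o\<^sub>C\<^sub>L C)) \<longlongrightarrow> 0) (at_right 0)"
    using Lim_null_comparison[OF bound] by simp
  then show ?thesis unfolding Tr_def[symmetric] using Lim_null by blast
qed

lemma seq_compact_JT:
  assumes "s \<in> X" "\<sigma> \<in> {1, -1}"
  shows "seq_compact_op (J o\<^sub>C\<^sub>L T_bdry \<sigma> s)" "seq_compact_op (T_bdry \<sigma> s o\<^sub>C\<^sub>L J)"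
  using compact_op_imp_seq_compact[OF T_bdry_compact[OF assms]]
  by (simp_all add: seq_compact_op_compose_left seq_compact_op_compose_right)

text \<open>Regularity asks for limits from both half-planes, while injectivity is given on one side
  only. Injectivity there gives surjectivity by the Fredholm alternative, and adjoints turn that
  into injectivity on the other side.\<close>

lemma nonresonantI:
  assumes s: "s \<in> X" and \<sigma>: "\<sigma> \<in> {1, -1}"
    and inj: "\<And>x. x + of_real (r - s) *\<^sub>C J (T_bdry \<sigma> s x) = 0 \<Longrightarrow> x = 0"
  shows "r \<in> X"
proof -
  define c where "c = complex_of_real (r - s)"
  have inv: "\<exists>C. \<forall>x. cblinfun_apply C x + c *\<^sub>C J (T_bdry \<tau> s (cblinfun_apply C x)) = x"
    if \<tau>: "\<tau> \<in> {1, -1}" and inj: "\<And>x. x + c *\<^sub>C J (T_bdry \<tau> s x) = 0 \<Longrightarrow> x = 0" for \<tau>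
  proof -
    have cp: "compact_perturbation (id_cblinfun + c *\<^sub>C (J o\<^sub>C\<^sub>L T_bdry \<tau> s))"
      by (intro compact_perturbation_id_plus seq_compact_JT s \<tau>)
    have injM: "x = 0" if "(id_cblinfun + c *\<^sub>C (J o\<^sub>C\<^sub>L T_bdry \<tau> s)) x = 0" for x
      by (rule inj) (use that in \<open>simp add: cblinfun_simps\<close>)
    obtain C :: "'k endo" where "\<And>x. (id_cblinfun + c *\<^sub>C (J o\<^sub>C\<^sub>L T_bdry \<tau> s)) (C x) = x"
      using injective_compact_perturbation_inverse[OF cp injM] by blast
    then have "C x + c *\<^sub>C J (T_bdry \<tau> s (C x)) = x" for x by (simp add: cblinfun_simps)
    then show ?thesis by blast
  qed
  have "\<exists>C. \<forall>x. cblinfun_apply C x + c *\<^sub>C J (T_bdry \<sigma> s (cblinfun_apply C x)) = x"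
    by (rule inv[OF \<sigma>]) (rule inj, simp add: c_def)
  then obtain C where C: "\<And>x. cblinfun_apply C x + c *\<^sub>C J (T_bdry \<sigma> s (cblinfun_apply C x)) = x"
    by blast
  have m\<sigma>: "- \<sigma> \<in> {1, -1}" using \<sigma> by auto
  \<comment> \<open>Applying T to the kernel equation gives y + c T J y = 0 for the other sign. This
    operator is the adjoint of the surjective \<open>1 + c J T\<close>, so y = 0 and then x =
    0.\<close>
  have inj': "x = 0" if x: "x + c *\<^sub>C J (T_bdry (- \<sigma>) s x) = 0" for x
  proof -
    define y where "y = T_bdry (- \<sigma>) s x"
    have "T_bdry (- \<sigma>) s (x + c *\<^sub>C J (T_bdry (- \<sigma>) s x)) = 0" using x by simp
    then have y0: "y + c *\<^sub>C T_bdry (- \<sigma>) s (J y) = 0" by (simp add: y_def cblinfun_simps)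
    have "cinner y z = 0" for z
    proof -
      have "cinner y z = cinner y (C z) + c * cinner y (J (T_bdry \<sigma> s (C z)))"
        by (subst C[of z, symmetric]) (simp only: cinner_simps)
      also have "cinner y (J (T_bdry \<sigma> s (C z))) = cinner (T_bdry (- \<sigma>) s (J y)) (C z)"
        using T_bdry_adjoint[OF s m\<sigma>] selfadjoint_opD[OF J_selfadjoint] by simp
      also have "cinner y (C z) + c * \<dots> = cinner (y + c *\<^sub>C T_bdry (- \<sigma>) s (J y)) (C z)"
        by (simp add: cinner_simps c_def)
      finally show ?thesis by (simp add: y0)
    qed
    then have "y = 0" using cinner_eq_zero_iff by blast
    then show ?thesis using x by (simp flip: y_def)
  qed
  obtain C' where C': "\<And>x. cblinfun_apply C' x + c *\<^sub>C J (T_bdry (- \<sigma>) s (cblinfun_apply C' x)) = x"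
    using inv[OF m\<sigma> inj'] by blast
  have "\<exists>L. ((\<lambda>y. T_op r (Complex lam (\<sigma> * y))) \<longlongrightarrow> L) (at_right 0)"
    using C unfolding c_def by (rule regular_if_inverse[OF s \<sigma>])
  moreover have "\<exists>L. ((\<lambda>y. T_op r (Complex lam (- \<sigma> * y))) \<longlongrightarrow> L) (at_right 0)"
    using C' unfolding c_def by (rule regular_if_inverse[OF s m\<sigma>])
  ultimately show ?thesis using \<sigma> unfolding nonresonant_def regular_points_def by auto
qed

lemma resolvent_at_T_bdry:
  assumes "r \<in> X" "s \<in> X" "\<sigma> \<in> {1, -1}"
  shows "resolvent_at (T_bdry \<sigma> s o\<^sub>C\<^sub>L J) (complex_of_real (r - s)) (T_bdry \<sigma> r o\<^sub>C\<^sub>L J)"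
    and "resolvent_at (J o\<^sub>C\<^sub>L T_bdry \<sigma> s) (complex_of_real (r - s)) (J o\<^sub>C\<^sub>L T_bdry \<sigma> r)"
proof -
  define c where "c = complex_of_real (r - s)"
  have 1: "T_bdry \<sigma> r x + c *\<^sub>C T_bdry \<sigma> r (J (T_bdry \<sigma> s x)) = T_bdry \<sigma> s x" for x
    using T_bdry_resolvent[OF assms, of x] by (simp add: cblinfun_simps c_def)
  have 2: "T_bdry \<sigma> r x + c *\<^sub>C T_bdry \<sigma> s (J (T_bdry \<sigma> r x)) = T_bdry \<sigma> s x" for x
  proof -
    define w where "w = T_bdry \<sigma> s (J (T_bdry \<sigma> r x))"
    have "complex_of_real (s - r) = - c" by (simp add: c_def)
    then have "T_bdry \<sigma> r x = T_bdry \<sigma> s x + (- c) *\<^sub>C w"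
      using T_bdry_resolvent[OF assms(2,1,3), of x] by (simp only: cblinfun_simps w_def)
    then have "T_bdry \<sigma> r x + c *\<^sub>C w = T_bdry \<sigma> s x" by simp
    then show ?thesis unfolding w_def .
  qed
  have 3: "J (T_bdry \<sigma> r x) + c *\<^sub>C J (T_bdry \<sigma> r (J (T_bdry \<sigma> s x))) = J (T_bdry \<sigma> s x)"
    "J (T_bdry \<sigma> r x) + c *\<^sub>C J (T_bdry \<sigma> s (J (T_bdry \<sigma> r x))) = J (T_bdry \<sigma> s x)" for x
    using arg_cong[OF 1[of x], of J] arg_cong[OF 2[of x], of J] by (simp_all only: cblinfun_simps)
  show "resolvent_at (T_bdry \<sigma> s o\<^sub>C\<^sub>L J) (complex_of_real (r - s)) (T_bdry \<sigma> r o\<^sub>C\<^sub>L J)"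
    "resolvent_at (J o\<^sub>C\<^sub>L T_bdry \<sigma> s) (complex_of_real (r - s)) (J o\<^sub>C\<^sub>L T_bdry \<sigma> r)"
    using 1 2 3 by (simp_all add: resolvent_at_def c_def)
qed

text \<open>With \<open>resolvent_at_T_bdry\<close> this identifies the nonresonant points with the
  real points where the resolvent exists. A kernel vector x of 1 + c A has A x = R (x + c A x) = 0,
  hence x = 0. For A = T J the argument is applied to T x.\<close>

lemma resolvent_at_imp_nonresonant:
  assumes s: "s \<in> X" and \<sigma>: "\<sigma> \<in> {1, -1}"
    and res: "resolvent_at (J o\<^sub>C\<^sub>L T_bdry \<sigma> s) (complex_of_real (r - s)) R \<or>
      resolvent_at (T_bdry \<sigma> s o\<^sub>C\<^sub>L J) (complex_of_real (r - s)) R"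
  shows "r \<in> X"
proof (rule nonresonantI[OF s \<sigma>])
  define c where "c = complex_of_real (r - s)"
  have inj: "x = 0" if "resolvent_at A c R" "x + c *\<^sub>C A x = 0" for A :: "'k endo" and x
  proof -
    have "A x = R (x + c *\<^sub>C A x)" using that(1) by (simp add: resolvent_at_def cblinfun_simps)
    then show ?thesis using that(2) by simp
  qed
  fix x assume "x + of_real (r - s) *\<^sub>C J (T_bdry \<sigma> s x) = 0"
  then have x: "x + c *\<^sub>C J (T_bdry \<sigma> s x) = 0" by (simp add: c_def)
  from res show "x = 0"
  proof
    assume "resolvent_at (J o\<^sub>C\<^sub>L T_bdry \<sigma> s) (complex_of_real (r - s)) R"
    then show ?thesis using x by (rule_tac inj[of "J o\<^sub>C\<^sub>L T_bdry \<sigma> s"]) (simp_all add: c_def)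
  next
    assume R: "resolvent_at (T_bdry \<sigma> s o\<^sub>C\<^sub>L J) (complex_of_real (r - s)) R"
    have "T_bdry \<sigma> s (x + c *\<^sub>C J (T_bdry \<sigma> s x)) = 0" using x by simp
    then have "T_bdry \<sigma> s x = 0"
      by (rule_tac inj[OF R[folded c_def]]) (simp add: cblinfun_simps)
    then show ?thesis using x by simp
  qed
qed

end

section \<open>The signature bound\<close>

lemma span_insert_subspace:
  assumes "csubspace W"
  shows "x \<in> cspan (insert w W) \<longleftrightarrow> (\<exists>v\<in>W. \<exists>k. x = v + k *\<^sub>C w)"
proof -
  have "cspan W = W" using assms by (simp add: complex_vector.span_eq_iff)
  then have "x \<in> cspan (insert w W) \<longleftrightarrow> (\<exists>k. x - k *\<^sub>C w \<in> W)"
    by (simp only: complex_vector.span_insert mem_Collect_eq)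
  also have "\<dots> \<longleftrightarrow> (\<exists>v\<in>W. \<exists>k. x = v + k *\<^sub>C w)"
    by (metis add_diff_cancel_right' diff_add_cancel)
  finally show ?thesis .
qed

lemma cdim_insert_gt:
  assumes sub: "csubspace W" and fin: "finite_dim (cspan (insert w W))"
    and w: "w \<notin> W"
  shows "cdim W < cdim (cspan (insert w W))"
proof -
  have WW: "W \<subseteq> cspan (insert w W)"
    using complex_vector.span_superset[of "insert w W"] by blast
  obtain B where B: "B \<subseteq> W" "cindependent B" "finite B"
    "W \<subseteq> cspan B" "card B = cdim W"
    using finite_dim_subset[OF fin WW] by (rule finite_dim_basis)
  have "cspan B \<subseteq> W" using B(1) sub by (rule complex_vector.span_minimal)
  then have "w \<notin> cspan B" using w by blast
  then have "cindependent (insert w B)"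
    using B(2) by (rule complex_vector.independent_insertI)
  moreover have "insert w B \<subseteq> cspan (insert w W)"
    using B(1) complex_vector.span_superset[of "insert w W"] by blast
  ultimately have "card (insert w B) \<le> cdim (cspan (insert w W))"
    using card_le_cdim[OF fin] by blast
  moreover have "w \<notin> B" using B(1) w by blast
  ultimately show ?thesis using B(3,5) by simp
qed

text \<open>Here \<open>T' = T\<^sup>*\<close>, and \<open>h(u, v) = \<langle>u, J v\<rangle>\<close> is an indefinite form for which \<open>M = 1 + c T J\<close>
  is dissipative up to sign. On the range \<open>E\<close> of the Riesz projection \<open>P\<close> of \<open>M\<close> at \<open>0\<close> the
  operator \<open>M\<close> is nilpotent.\<close>

locale dissipative_nilpotent =
  fixes J T T' M P G :: "'k::chilbert_space endo" and c \<sigma> :: real and n :: nat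
  assumes J_selfadjoint: "selfadjoint_op J"
    and adjoint: "cinner (T x) y = cinner x (T' y)"
    and sign: "\<sigma> \<in> {1, -1}"
    and dissipative: "0 \<le> \<sigma> * Im (cinner x (T x))"
    and c_nonzero: "c \<noteq> 0"
    and M_eq: "M x = x + of_real c *\<^sub>C T (J x)"
    and P_idem: "P (P x) = P x"
    and MP: "M (P x) = P (M x)"
    and nilpotent: "cpow M n (P x) = 0"
    and GM: "G (M x) = x - P x"
    and finite_dim_P: "finite_dim (ran P)"
begin

lemma adjoint': "cinner (T' x) y = cinner x (T y)"
  by (metis adjoint cinner_commute)

lemma J_sym: "cinner (J x) y = cinner x (J y)"
  by (rule selfadjoint_opD[OF J_selfadjoint])

text \<open>S is the imaginary part of T multiplied by its sign: a positive operator, which vanishes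
  wherever its form does.\<close>

lemma T_eq_if_form_real:
  assumes "Im (cinner x (T x)) = 0"
  shows "T x = T' x"
proof -
  define S where "S = (complex_of_real \<sigma> / (2 * \<i>)) *\<^sub>C (T - T')"
  have S_form: "cinner y (S y) = complex_of_real (\<sigma> * Im (cinner y (T y)))" for y
  proof -
    have "cinner y (T' y) = cnj (cinner y (T y))" by (metis adjoint cinner_commute)
    then have "cinner y (S y) = complex_of_real \<sigma> / (2 * \<i>) * (cinner y (T y) - cnj (cinner y (T y)))"
      by (simp add: S_def cblinfun_simps cinner_simps)
    also have "cinner y (T y) - cnj (cinner y (T y)) = 2 * \<i> * complex_of_real (Im (cinner y (T y)))"
      by (simp add: complex_eq_iff)
    also have "complex_of_real \<sigma> / (2 * \<i>) * (2 * \<i> * complex_of_real (Im (cinner y (T y))))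
        = complex_of_real (\<sigma> * Im (cinner y (T y)))"
      by (simp add: field_simps)
    finally show ?thesis .
  qed
  have "positive_op S" using dissipative by (simp add: positive_op_def S_form)
  then have "S x = 0" by (rule positive_op_null) (simp add: S_form assms)
  then show ?thesis using sign by (auto simp: S_def cblinfun_simps)
qed

text \<open>h(w, M w) is the real number h(w, w) plus c times \<open><J w, T (J w)>\<close>, so if
  it vanishes the latter is real.\<close>

lemma T_eq_if_M_form_zero:
  assumes "cinner w (J (M w)) = 0"
  shows "T (J w) = T' (J w)"
proof (rule T_eq_if_form_real)
  have "cinner w (J w) = cnj (cinner w (J w))" by (metis J_sym cinner_commute)
  then have "Im (cinner w (J w)) = 0" by (simp add: complex_eq_iff)
  moreover have "cinner w (J w) + of_real c * cinner (J w) (T (J w)) = 0"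
    using assms by (simp add: M_eq cblinfun_simps cinner_simps J_sym)
  then have "Im (cinner w (J w) + of_real c * cinner (J w) (T (J w))) = 0" by simp
  ultimately show "Im (cinner (J w) (T (J w))) = 0" using c_nonzero by simp
qed

text \<open>A kernel equation for either operator makes the form of T real at J u, where T and T'
  then agree. Thus both signs of z give the same kernel.\<close>

lemma kernel_adjoint: "u + of_real c *\<^sub>C T' (J u) = 0 \<longleftrightarrow> M u = 0"
proof -
  have "T (J u) = T' (J u)" if "u + of_real c *\<^sub>C T' (J u) = 0"
  proof (rule T_eq_if_form_real)
    have "cinner (J u) u = cnj (cinner (J u) u)" by (metis J_sym cinner_commute)
    then have "Im (cinner (J u) u) = 0" by (simp add: complex_eq_iff)
    moreover have "cinner (J u) (u + of_real c *\<^sub>C T' (J u)) = 0" using that by simp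
    then have "Im (cinner (J u) u + of_real c * cinner (J u) (T' (J u))) = 0"
      by (simp only: cinner_simps) simp
    moreover have "cinner (J u) (T' (J u)) = cnj (cinner (J u) (T (J u)))"
      by (metis adjoint cinner_commute)
    ultimately show "Im (cinner (J u) (T (J u))) = 0" using c_nonzero by simp
  qed
  moreover have "T (J u) = T' (J u)" if "M u = 0"
    by (rule T_eq_if_M_form_zero) (simp add: that)
  ultimately show ?thesis by (auto simp: M_eq)
qed

lemma M_symmetric:
  assumes "T (J w) = T' (J w)"
  shows "cinner (M w) (J u) = cinner w (J (M u))"
proof -
  have "cinner (T (J w)) (J u) = cinner w (J (T (J u)))"
    unfolding assms by (simp add: adjoint' J_sym)
  then show ?thesis by (simp add: M_eq cblinfun_simps cinner_simps)
qed

lemma kernel_subset: "{u. M u = 0} \<subseteq> ran P"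
proof
  fix u assume "u \<in> {u. M u = 0}"
  then have "u = P u" using GM[of u] by simp
  then show "u \<in> ran P" by (rule range_eqI)
qed

section \<open>Isotropic invariant subspaces and the dimension count\<close>

abbreviation E :: "'k set" where "E \<equiv> ran P"

text \<open>The last condition makes M symmetric for h between W and every vector; with invariance
  of W, the h-complement of W is then invariant under M too.\<close>

definition admissible :: "'k set \<Rightarrow> bool" where
  "admissible W \<longleftrightarrow> csubspace W \<and> W \<subseteq> E \<and> (\<forall>w\<in>W. M w \<in> W) \<and>
    (\<forall>w\<in>W. \<forall>v\<in>W. cinner w (J v) = 0) \<and> (\<forall>w\<in>W. T (J w) = T' (J w))"

lemma ME: "u \<in> E \<Longrightarrow> M u \<in> E"
  by (auto simp: MP)

lemma J_flip: "cinner u (J v) = 0 \<Longrightarrow> cinner v (J u) = 0"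
  by (metis J_sym cinner_commute complex_cnj_zero)

text \<open>If \<open>W\<close> is admissible and \<open>M\<close> maps some \<open>u \<in> W\<^sup>\<bottom>\<close> outside \<open>W\<close> but \<open>M (M u) \<in> W\<close>, then \<open>M u\<close> can
  be added to \<open>W\<close>: it is orthogonal to its image under \<open>M\<close>, so \<open>M\<close> is symmetric at \<open>M u\<close>, and hence
  \<open>h(M u, M u) = h(M (M u), u) = 0\<close>.\<close>

lemma admissible_insert:
  assumes W: "admissible W" and u: "u \<in> E" "\<And>w. w \<in> W \<Longrightarrow> cinner w (J u) = 0"
    and MMu: "M (M u) \<in> W"
  shows "admissible (cspan (insert (M u) W))"
proof -
  define v where "v = M u"
  have sub: "csubspace W" and WE: "W \<subseteq> E" and MW: "\<And>w. w \<in> W \<Longrightarrow> M w \<in> W"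
    and iso: "\<And>w x. w \<in> W \<Longrightarrow> x \<in> W \<Longrightarrow> cinner w (J x) = 0" and TW: "\<And>w. w \<in> W \<Longrightarrow> T (J w) = T' (J w)"
    using W unfolding admissible_def by auto
  have vW: "cinner w (J v) = 0" "cinner v (J w) = 0" if "w \<in> W" for w
  proof -
    show "cinner w (J v) = 0"
      unfolding v_def M_symmetric[OF TW[OF that], symmetric] by (rule u(2)[OF MW[OF that]])
    then show "cinner v (J w) = 0" by (rule J_flip)
  qed
  have Tv: "T (J v) = T' (J v)"
    by (rule T_eq_if_M_form_zero, rule vW(2)) (use MMu in \<open>simp add: v_def\<close>)
  have vv: "cinner v (J v) = 0"
    using M_symmetric[OF Tv, of u] u(2)[OF MMu] by (simp add: v_def)
  have in_span: "x \<in> cspan (insert v W) \<longleftrightarrow> (\<exists>w\<in>W. \<exists>k. x = w + k *\<^sub>C v)" for x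
    by (rule span_insert_subspace[OF sub])
  have "admissible (cspan (insert v W))"
    unfolding admissible_def
  proof (intro conjI ballI)
    show "cspan (insert v W) \<subseteq> E"
      using WE ME[OF u(1)] by (intro complex_vector.span_minimal subspace_range) (auto simp: v_def)
  next
    fix x assume "x \<in> cspan (insert v W)"
    then obtain w k where x: "w \<in> W" "x = w + k *\<^sub>C v" using in_span by blast
    have "M x = (M w + k *\<^sub>C M v) + 0 *\<^sub>C v" by (simp add: x(2) cblinfun_simps)
    moreover have "M w + k *\<^sub>C M v \<in> W"
      using MW[OF x(1)] MMu csubspaceD[OF sub] unfolding v_def by blast
    ultimately show "M x \<in> cspan (insert v W)" using in_span by blast
    show "T (J x) = T' (J x)" by (simp add: x(2) cblinfun_simps TW[OF x(1)] Tv)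
    fix y assume "y \<in> cspan (insert v W)"
    then obtain w' k' where y: "w' \<in> W" "y = w' + k' *\<^sub>C v" using in_span by blast
    show "cinner x (J y) = 0"
      by (simp add: x(2) y(2) cblinfun_simps cinner_simps vv vW[OF x(1)] vW[OF y(1)] iso[OF x(1) y(1)])
  qed (rule complex_vector.subspace_span)
  then show ?thesis by (simp add: v_def)
qed

text \<open>W has maximal dimension. For u in its h-complement a high power of M sends u to 0 in W,
  and maximality allows the power to be lowered: if M (M u) is in W, so is M u. Induction, passing
  to M u, stops at the first power.\<close>

lemma maximal_admissible:
  obtains W where "admissible W" "\<And>u. u \<in> E \<Longrightarrow> (\<And>w. w \<in> W \<Longrightarrow> cinner w (J u) = 0) \<Longrightarrow> M u \<in> W"
proof -
  define ex where "ex k \<longleftrightarrow> (\<exists>W. admissible W \<and> cdim W = k)" for k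
  define k where "k = (GREATEST k. ex k)"
  have "0 \<in> E" by (rule csubspaceD(1)[OF subspace_range])
  then have "admissible {0}"
    by (simp add: admissible_def complex_vector.subspace_single_0)
  then have ex0: "ex (cdim {0 :: 'k})" unfolding ex_def by blast
  have ex_le: "i \<le> cdim E" if "ex i" for i
    using that cdim_mono[OF finite_dim_P] unfolding ex_def admissible_def by blast
  have "ex k" unfolding k_def by (rule GreatestI_nat[of ex, OF ex0 ex_le])
  then obtain W where W: "admissible W" "cdim W = k" unfolding ex_def by blast
  have sub: "csubspace W" and MW: "\<And>w. w \<in> W \<Longrightarrow> M w \<in> W"
    and TW: "\<And>w. w \<in> W \<Longrightarrow> T (J w) = T' (J w)"
    using W(1) unfolding admissible_def by auto
  have step: "M u \<in> W" if u: "u \<in> E" "\<And>w. w \<in> W \<Longrightarrow> cinner w (J u) = 0" "M (M u) \<in> W" for u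
  proof (rule ccontr)
    assume "M u \<notin> W"
    define W' where "W' = cspan (insert (M u) W)"
    have W': "admissible W'" unfolding W'_def by (rule admissible_insert[OF W(1) u])
    then have "finite_dim W'" using finite_dim_subset[OF finite_dim_P] unfolding admissible_def by blast
    then have "k < cdim W'"
      unfolding W'_def W(2)[symmetric] by (rule cdim_insert_gt[OF sub _ \<open>M u \<notin> W\<close>])
    moreover have "cdim W' \<le> k"
      unfolding k_def by (rule Greatest_le_nat[of ex, OF _ ex_le]) (use W' in \<open>auto simp: ex_def\<close>)
    ultimately show False by simp
  qed
  have "M u \<in> W" if "cpow M (Suc j) u \<in> W" "u \<in> E" "\<And>w. w \<in> W \<Longrightarrow> cinner w (J u) = 0" for j u
    using that
  proof (induction j arbitrary: u)
    case (Suc j)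
    have "cinner w (J (M u)) = 0" if "w \<in> W" for w
      using M_symmetric[OF TW[OF that], of u] Suc.prems(3)[OF MW[OF that]] by simp
    moreover have "cpow M (Suc j) (M u) \<in> W"
      using Suc.prems(1) by (simp only: cpow_Suc_right)
    ultimately have "M (M u) \<in> W" using Suc.IH ME[OF Suc.prems(2)] by blast
    then show ?case using step Suc.prems by blast
  qed simp
  moreover have "cpow M (Suc n) u \<in> W" if "u \<in> E" for u
  proof -
    have "cpow M n u = 0" using that nilpotent by auto
    then show ?thesis using csubspaceD(1)[OF sub] by simp
  qed
  ultimately show ?thesis using that[OF W(1)] by blast
qed

theorem signature_le:
  fixes S :: "'k endo"
  assumes S: "\<And>x y. cinner x (S y) = cinner (P x) (J (P y))"
  shows "\<bar>signature_op S\<bar> \<le> int (cdim {u. M u = 0})"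
proof -
  have sa: "selfadjoint_op S"
    unfolding selfadjoint_op_def
  proof (intro allI)
    fix x y
    have "cinner (S x) y = cnj (cinner (P y) (J (P x)))" by (metis S cinner_commute)
    also have "\<dots> = cinner x (S y)" by (metis S J_sym cinner_commute)
    finally show "cinner (S x) y = cinner x (S y)" .
  qed
  have SP: "S (P y) = S y" for y by (rule cinner_extI) (simp add: S P_idem)
  have range_S: "ran S = cblinfun_apply S ` E"
  proof -
    have "S y \<in> cblinfun_apply S ` E" for y unfolding SP[of y, symmetric] by blast
    then show ?thesis by blast
  qed
  then have "finite_dim (ran S)"
    using finite_dim_image[OF finite_dim_P clinear_cblinfun] by metis
  then obtain B l where "diagonalized S B l" by (rule diagonalization_exists[OF sa])
  then interpret diagonalized S B l .
  define Bp where "Bp = {b\<in>B. l b > 0}"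
  define Bn where "Bn = {b\<in>B. l b < 0}"
  have PE: "P u = u" if "u \<in> E" for u using that P_idem by auto
  have form: "cinner u (S v) = cinner u (J v)" if "u \<in> E" "v \<in> E" for u v
    by (simp only: S PE[OF that(1)] PE[OF that(2)])
  obtain W where W: "admissible W"
    and max: "\<And>u. u \<in> E \<Longrightarrow> (\<And>w. w \<in> W \<Longrightarrow> cinner w (J u) = 0) \<Longrightarrow> M u \<in> W"
    using maximal_admissible by blast
  have sub: "csubspace W" and WE: "W \<subseteq> E"
    and iso: "\<And>w x. w \<in> W \<Longrightarrow> x \<in> W \<Longrightarrow> cinner w (J x) = 0"
    using W unfolding admissible_def by auto
  have finW: "finite_dim W" by (rule finite_dim_subset[OF finite_dim_P WE])
  \<comment> \<open>The h-complement of W in E, written as orthogonality to S W. It then costs at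
    most dim S W dimensions, a sharper bound than dim W when S kills part of W.\<close>
  define W' where "W' = {u\<in>E. \<forall>y\<in>cblinfun_apply S ` W. cinner y u = 0}"
  have W'_eq: "cinner w (J u) = 0" if "u \<in> W'" "w \<in> W" for u w
  proof -
    have "cinner (S w) u = 0" "u \<in> E" using that unfolding W'_def by auto
    then show ?thesis using form[of w u] selfadjoint_opD[OF sa, of w u] that(2) WE by auto
  qed
  have finW': "finite_dim W'" by (rule finite_dim_subset[OF finite_dim_P]) (auto simp: W'_def)
  have subW': "csubspace W'"
  proof (rule complex_vector.subspaceI)
    show "0 \<in> W'" using csubspaceD(1)[OF subspace_range[of P]] by (simp add: W'_def)
    show "x + y \<in> W'" if "x \<in> W'" "y \<in> W'" for x y
      using that csubspaceD(2)[OF subspace_range[of P]] unfolding W'_def by (simp add: cinner_add_right)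
    show "k *\<^sub>C x \<in> W'" if "x \<in> W'" for k x
      using that csubspaceD(4)[OF subspace_range[of P]] unfolding W'_def by (simp add: cinner_scaleC_right)
  qed
  have "cdim W' = cdim {u\<in>W'. M u = 0} + cdim (cblinfun_apply M ` W')"
    by (rule rank_nullity[OF subW' finW' clinear_cblinfun])
  moreover have "cdim {u\<in>W'. M u = 0} \<le> cdim {u. M u = 0}"
    by (rule cdim_mono) (auto intro: finite_dim_subset[OF finite_dim_P kernel_subset])
  moreover have "cdim (cblinfun_apply M ` W') \<le> cdim W"
  proof (rule cdim_mono[OF finW])
    have "M u \<in> W" if "u \<in> W'" for u
      using max[of u] W'_eq[OF that] that unfolding W'_def by blast
    then show "cblinfun_apply M ` W' \<subseteq> W" by blast
  qed
  moreover have "cdim E \<le> cdim W' + cdim (cblinfun_apply S ` W)"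
    unfolding W'_def
    by (rule cdim_le_orthogonal[OF subspace_range finite_dim_P finite_dim_image[OF finW clinear_cblinfun]])
  moreover have "cdim E = cdim {u\<in>E. S u = 0} + cdim (cblinfun_apply S ` E)"
    by (rule rank_nullity[OF subspace_range finite_dim_P clinear_cblinfun])
  moreover have "cdim (cblinfun_apply S ` E) = card B" using rank_eq unfolding range_S .
  moreover have "card B = card Bp + card Bn"
  proof -
    have "B = Bp \<union> Bn" using l_nonzero by (auto simp: Bp_def Bn_def neq_iff)
    moreover have "finite Bp" "finite Bn" "Bp \<inter> Bn = {}" using finite_B by (auto simp: Bp_def Bn_def)
    ultimately show ?thesis by (simp add: card_Un_disjoint)
  qed
  moreover have "cdim W = cdim {w\<in>W. S w = 0} + cdim (cblinfun_apply S ` W)"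
    by (rule rank_nullity[OF sub finW clinear_cblinfun])
  moreover have "cdim {w\<in>W. S w = 0} \<le> cdim {u\<in>E. S u = 0}"
    using WE by (intro cdim_mono finite_dim_subset[OF finite_dim_P]) auto
  \<comment> \<open>S W contains no nonzero vector orthogonal to C. If S w were such a vector, all
    eigenvalue terms of \<open><w, S w>\<close> would have one sign, but their sum is 0 by isotropy;
    so each vanishes and S w = 0.\<close>
  moreover have "cdim (cblinfun_apply S ` W) \<le> card C" if C: "C = Bp \<or> C = Bn" for C
  proof -
    have CB: "C \<subseteq> B" using C by (auto simp: Bp_def Bn_def)
    have finC: "finite C" using CB finite_B by (rule finite_subset)
    have subSW: "csubspace (cblinfun_apply S ` W)"
      using sub by (rule module_hom.subspace_image[OF clinear_cblinfun[unfolded linear_iff_module_hom]])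
    have finSW: "finite_dim (cblinfun_apply S ` W)" by (rule finite_dim_image[OF finW clinear_cblinfun])
    have "y = 0" if y: "y \<in> cblinfun_apply S ` W" and orth: "\<And>b. b \<in> C \<Longrightarrow> cinner b y = 0" for y
    proof -
      obtain w where w: "w \<in> W" "y = S w" using y by blast
      have C0: "cinner b w = 0" if "b \<in> C" for b
        using orth[OF that] cinner_basis_G[of b w] CB that l_nonzero[of b]
        by (auto simp: w(2))
      have "cinner w (S w) = 0" using form[of w w] iso[OF w(1) w(1)] w(1) WE by auto
      then have sum0: "(\<Sum>b\<in>B. l b * (cmod (cinner b w))\<^sup>2) = 0"
        using cinner_G[of w] by (simp only: of_real_eq_0_iff)
      \<comment> \<open>The sign that makes all terms left after removing C nonnegative.\<close>
      obtain e :: real where e: "\<And>b. b \<in> B \<Longrightarrow> 0 \<le> e * (l b * (cmod (cinner b w))\<^sup>2)" "e \<noteq> 0"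
      proof (cases "C = Bp")
        case True
        have "0 \<le> (- 1) * (l b * (cmod (cinner b w))\<^sup>2)" if "b \<in> B" for b
          using C0[of b] that by (cases "l b > 0") (auto simp: True Bp_def mult_nonpos_nonneg not_less)
        then show ?thesis by (rule that[of "- 1"]) auto
      next
        case False
        have "0 \<le> 1 * (l b * (cmod (cinner b w))\<^sup>2)" if "b \<in> B" for b
          using C0[of b] that C False by (cases "l b < 0") (auto simp: Bn_def not_less)
        then show ?thesis by (rule that[of 1]) auto
      qed
      have "(\<Sum>b\<in>B. e * (l b * (cmod (cinner b w))\<^sup>2)) = 0"
        unfolding sum_distrib_left[symmetric] sum0 by simp
      then have "l b * (cmod (cinner b w))\<^sup>2 = 0" if "b \<in> B" for b
        using that e by (simp add: sum_nonneg_eq_0_iff[OF finite_B])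
      then show "y = 0" unfolding w(2) G_eq[of w] using l_nonzero by (intro sum.neutral) auto
    qed
    moreover have "0 \<in> cblinfun_apply S ` W" by (rule csubspaceD(1)[OF subSW])
    ultimately have zero: "{y\<in>cblinfun_apply S ` W. \<forall>b\<in>cspan C. cinner b y = 0} \<subseteq> {0}"
      using complex_vector.span_base by blast
    have "cdim {y\<in>cblinfun_apply S ` W. \<forall>b\<in>cspan C. cinner b y = 0} \<le> 0"
      using complex_vector.dim_le_card[of _ "{}"] zero by auto
    moreover have "finite_dim (cspan C)" using finC unfolding finite_dim_def by blast
    moreover have "cdim (cspan C) \<le> card C"
      using finC by (simp add: complex_vector.dim_le_card')
    ultimately show ?thesis using cdim_le_orthogonal[OF subSW finSW, of "cspan C"] by linarith
  qed
  then have "cdim (cblinfun_apply S ` W) \<le> card Bp" "cdim (cblinfun_apply S ` W) \<le> card Bn"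
    by simp_all
  moreover have "signature_op S = int (card Bp) - int (card Bn)"
    unfolding Bp_def Bn_def by (rule signature_eq)
  \<comment> \<open>With p, q the numbers of positive and negative eigenvalues and d = dim S W: the
    kernel of S on W is no larger than that on E, and the two cancel to leave p + q at most dim ker
    M + 2 d. As d is at most both p and q, the claim follows.\<close>
  ultimately show ?thesis by linarith
qed

end

text \<open>M is invertible on the complement of ran P, so y - P y is an n'-th power of M applied to
  some z. Moving the power across the inner product annihilates Q x. The same argument makes x - Q x
  orthogonal to P y.\<close>

lemma spectral_projection_adjoint:
  fixes M M' P Q G G' :: "'a::chilbert_space endo"
  assumes adj: "\<And>x y. cinner (M' x) y = cinner x (M y)"
    and P: "\<And>x. P (P x) = P x" "\<And>x. M (P x) = P (M x)" "\<And>x. cpow M n (P x) = 0"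
      "\<And>x. M (G x) = x - P x"
    and Q: "\<And>x. Q (Q x) = Q x" "\<And>x. M' (Q x) = Q (M' x)" "\<And>x. cpow M' n' (Q x) = 0"
      "\<And>x. M' (G' x) = x - Q x"
  shows "cinner (Q x) y = cinner x (P y)"
proof -
  have pow_adj: "cinner (cpow M' k x) y = cinner x (cpow M k y)" for k x y
    by (induction k arbitrary: x y) (simp_all add: adj cpow_self_commute)
  have range_pow: "\<exists>z. R z = 0 \<and> w = cpow L k z"
    if "\<And>x. R (R x) = R x" "\<And>x. L (R x) = R (L x)" "\<And>x. L (K x) = x - R x" "R w = 0"
    for L R K :: "'a endo" and w k
  proof (induction k)
    case 0
    show ?case using that(4) by auto
  next
    case (Suc k)
    then obtain z where z: "R z = 0" "w = cpow L k z" by blast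
    define z' where "z' = K z - R (K z)"
    have "R z' = 0" by (simp add: z'_def cblinfun_simps that(1))
    moreover have "L z' = z" by (simp add: z'_def cblinfun_simps that z(1))
    ultimately show ?case using z(2) by (metis cpow_Suc_right)
  qed
  have "P (y - P y) = 0" by (simp add: cblinfun_simps P)
  with range_pow[OF P(1,2,4)] obtain z where z: "y - P y = cpow M n' z" by blast
  have "cinner (Q x) (y - P y) = 0"
    unfolding z pow_adj[symmetric] by (simp add: Q(3))
  moreover have "Q (x - Q x) = 0" by (simp add: cblinfun_simps Q)
  with range_pow[OF Q(1,2,4)] obtain v where v: "x - Q x = cpow M' n v" by blast
  have "cinner (x - Q x) (P y) = 0"
    unfolding v pow_adj by (simp add: P(3))
  ultimately show ?thesis by (simp add: cinner_simps)
qed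

theorem theorem1p34:
  fixes F :: "('h::chilbert_space \<times> 'k::chilbert_space) set"
    and J :: "'k \<Rightarrow>\<^sub>C\<^sub>L 'k"
    and V :: "('h \<times> 'h) set"
    and H :: "real \<Rightarrow> ('h \<times> 'h) set"
    and D :: "'h set"
    and lam r0 \<sigma> s :: real
  assumes "separable_space (euclidean :: 'h topology)"
    and "separable_space (euclidean :: 'k topology)"
    and "linear_operator F" and "closed F" and "densely_defined F"
    and "op_kernel F = {0}" and "op_cokernel F = {0}"
    and "selfadjoint_op J"
    and "V = F O op_graph J O op_adjoint F" and "selfadjoint V"
    and "\<And>r. H r = op_plus (H 0) (op_scale (complex_of_real r) V)"
    and "\<And>r. selfadjoint (H r)"
    and "\<And>r. Domain (H r) = D" and "closure D = UNIV"
    and "D \<subseteq> Domain F \<inter> Domain V"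
    and "\<And>r. relatively_compact V (H r)"
    and "\<And>r z. Im z \<noteq> 0 \<Longrightarrow> \<exists>T. compact_op T \<and> sandwiched_graph F (H r) z \<subseteq> op_graph T"
    and "\<And>r. - regular_points F (H r) \<in> null_sets lebesgue"
    and "\<exists>r. lam \<in> regular_points F (H r)"
    and "r0 \<notin> nonresonant F H lam"
    and "\<sigma> \<in> {1, -1}"
    and "s \<in> nonresonant F H lam"
  shows "\<bar>signature_op (Q_op F J H lam (- \<sigma>) r0 o\<^sub>C\<^sub>L J o\<^sub>C\<^sub>L P_op F J H lam \<sigma> r0)\<bar>
           \<le> int (cdim (Upsilon1 F J H lam 1 r0 s))"
proof -
  interpret resonance_line F J V H D lam
    by unfold_locales fact+
  note \<sigma> = \<open>\<sigma> \<in> {1, -1}\<close> and s = \<open>s \<in> X\<close>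
  have m\<sigma>: "- \<sigma> \<in> {1, -1}" using \<sigma> by auto
  define c where "c = r0 - s"
  define A where "A = T_bdry \<sigma> s o\<^sub>C\<^sub>L J"
  define B where "B = J o\<^sub>C\<^sub>L T_bdry (- \<sigma>) s"
  define M where "M = id_cblinfun + of_real c *\<^sub>C A"
  define M' where "M' = id_cblinfun + of_real c *\<^sub>C B"
  define P where "P = P_op F J H lam \<sigma> r0"
  define Q where "Q = Q_op F J H lam (- \<sigma>) r0"
  have P_eq: "P = vresidue (meromorphic_extension X (A_op F J H lam \<sigma>)) (complex_of_real r0)"
    unfolding P_def P_op_def ..
  have resA: "resolvent_at A (complex_of_real (r - s)) (A_op F J H lam \<sigma> r)" if "r \<in> X" for r
    unfolding A_def A_op_def by (rule resolvent_at_T_bdry(1)[OF that s \<sigma>])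
  have XA: "r \<in> X" if "resolvent_at A (complex_of_real (r - s)) R" for r R
    by (rule resolvent_at_imp_nonresonant[OF s \<sigma> disjI2[OF that[unfolded A_def]]])
  have cpA: "seq_compact_op A" unfolding A_def by (rule seq_compact_JT(2)[OF s \<sigma>])
  obtain G :: "'k endo" and n where P: "\<And>x. P (P x) = P x" "\<And>x. M (P x) = P (M x)" "\<And>x. cpow M n (P x) = 0"
    "\<And>x. M (G x) = x - P x" "\<And>x. G (M x) = x - P x"
    "finite_dim (ran P)"
    by (rule riesz_projection_eq_vresidue[OF cpA _ _ M_def[unfolded c_def] P_eq])
       (erule resA, erule XA, (rule that; assumption))
  have Q_eq: "Q = vresidue (meromorphic_extension X (B_op F J H lam (- \<sigma>))) (complex_of_real r0)"
    unfolding Q_def Q_op_def ..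
  have resB: "resolvent_at B (complex_of_real (r - s)) (B_op F J H lam (- \<sigma>) r)" if "r \<in> X" for r
    unfolding B_def B_op_def by (rule resolvent_at_T_bdry(2)[OF that s m\<sigma>])
  have XB: "r \<in> X" if "resolvent_at B (complex_of_real (r - s)) R" for r R
    by (rule resolvent_at_imp_nonresonant[OF s m\<sigma> disjI1[OF that[unfolded B_def]]])
  have cpB: "seq_compact_op B" unfolding B_def by (rule seq_compact_JT(1)[OF s m\<sigma>])
  obtain G' :: "'k endo" and n' where Q: "\<And>x. Q (Q x) = Q x" "\<And>x. M' (Q x) = Q (M' x)" "\<And>x. cpow M' n' (Q x) = 0"
    "\<And>x. M' (G' x) = x - Q x" "\<And>x. G' (M' x) = x - Q x"
    "finite_dim (ran Q)"
    by (rule riesz_projection_eq_vresidue[OF cpB _ _ M'_def[unfolded c_def] Q_eq])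
       (erule resB, erule XB, (rule that; assumption))
  have J_sym: "cinner (J x) y = cinner x (J y)" for x y
    by (rule selfadjoint_opD[OF J_selfadjoint])
  have "cinner (M' x) y = cinner x (M y)" for x y
    using T_bdry_adjoint[OF s m\<sigma>]
    by (simp add: M_def M'_def A_def B_def cblinfun_simps cinner_simps J_sym)
  from spectral_projection_adjoint[OF this P(1-4) Q(1-4)]
  have QP: "cinner (Q x) y = cinner x (P y)" for x y .
  interpret dissipative_nilpotent J "T_bdry \<sigma> s" "T_bdry (- \<sigma>) s" M P G c \<sigma> n
  proof
    show "c \<noteq> 0" using \<open>r0 \<notin> X\<close> s by (auto simp: c_def)
  qed (use P \<sigma> T_bdry_adjoint[OF s \<sigma>] T_bdry_dissipative[OF s \<sigma>] J_selfadjoint in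
      \<open>auto simp: M_def A_def cblinfun_simps\<close>)
  have "cinner x ((Q o\<^sub>C\<^sub>L J o\<^sub>C\<^sub>L P) y) = cinner (P x) (J (P y))" for x y
    by (metis QP cblinfun_apply_compose cinner_commute)
  then have "\<bar>signature_op (Q o\<^sub>C\<^sub>L J o\<^sub>C\<^sub>L P)\<bar> \<le> int (cdim {u. M u = 0})"
    by (rule signature_le)
  moreover have "{u. M u = 0} = Upsilon1 F J H lam 1 r0 s"
  proof -
    have "u + (r0 - s) *\<^sub>R A_op F J H lam 1 s u = u + of_real c *\<^sub>C T_bdry 1 s (J u)" for u
      by (simp add: A_op_def c_def scaleR_scaleC)
    moreover have "u + of_real c *\<^sub>C T_bdry 1 s (J u) = 0 \<longleftrightarrow> M u = 0" for u
      using \<sigma> M_eq[of u] kernel_adjoint[of u] by auto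
    ultimately show ?thesis unfolding Upsilon1_def by simp
  qed
  ultimately show ?thesis by (simp add: P_def Q_def)
qed

end
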